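(* $Z^\beta$ (the assignment $T\mapsto Z^\beta(T)$ constructed in the context) is an invariant of oriented tangle diagrams, i.e. it is unchanged under the Reidemeister moves.
   Context: **Notation.** Maps are composed from left to right: $P/\!/f/\!/g=g(f(P))$. **Reidemeister moves.** These are the three standard moves $I$, $I\!I$, $I\!I\!I$ on tangle diagrams. **Signs.** The sign of a crossing of an oriented tangle diagram is determined by the right-hand rule: if the right-hand thumb points along the direction of the upper strand of a positive crossing, then the fingers curl in the direction of the lower strand. **The sets $\beta(\eta,\tau)$.** For finite sets $\eta$ (head labels) and $\tau$ (tail labels), $\beta(\eta,\tau)$ is the collection of arrays $(\alpha_{ij})$ with rows labelled by $t_i\in\tau$ and columns labelled by $h_j\in\eta$, along with a distinguished element $\omega$ (the corner element, displayed in the upper left corner). The $\alpha_{ij}$ and $\omega$ are rational functions of variables $T_i$, which are in bijection with the row labels $t_i$. For a column $\alpha$, $\langle\alpha\rangle=\sum_i\alpha_i$. **Operations.** $$tm^{xy}_z:\ \begin{array}{c|c}\omega&\dots\\ \hline t_x&\alpha\\ t_y&\beta\\ \vdots&\gamma\end{array}\ \mapsto\ \begin{array}{c|c}\omega&\dots\\ \hline t_z&\alpha+\beta\\ \vdots&\gamma\end{array}$$ ($\alpha,\beta$ rows, $\gamma$ a matrix), accompanied by the change of variables $T_x,T_y\mapsto T_z$; $$hm^{xy}_z:\ \begin{array}{c|ccc}\omega&h_x&h_y&\dots\\ \hline \vdots&\alpha&\beta&\gamma\end{array}\ \mapsto\ \begin{array}{c|cc}\omega&h_z&\dots\\ \hline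 \vdots&\alpha+\beta+\langle\alpha\rangle\beta&\gamma\end{array}$$ ($\alpha,\beta$ columns, $\gamma$ a matrix); $$sw^{th}_{xy}:\ \begin{array}{c|cc}\omega&h_y&\dots\\ \hline t_x&\alpha&\beta\\ \vdots&\gamma&\delta\end{array}\ \mapsto\ \begin{array}{c|cc}\omega\epsilon&h_y&\dots\\ \hline t_x&\alpha(1+\langle\gamma\rangle/\epsilon)&\beta(1+\langle\gamma\rangle/\epsilon)\\ \vdots&\gamma/\epsilon&\delta-\gamma\beta/\epsilon\end{array},\qquad\epsilon=1+\alpha,$$ where $\alpha$ is a single entry, $\beta$ a row, $\gamma$ a column, $\delta$ the matrix of the remaining entries, and $\gamma\beta$ the matrix product of the column $\gamma$ with the row $\beta$. Set $$gm^{xy}_z:=sw^{th}_{xy}/\!/tm^{xy}_z/\!/hm^{xy}_z.$$ The disjoint union of an array $\alpha_1$ with corner $\omega_1$ and an array $\alpha_2$ with corner $\omega_2$ is the block-diagonal array $\begin{pmatrix}\alpha_1&0\\0&\alpha_2\end{pmatrix}$ with corner $\omega_1\omega_2$. **R-matrices.** $$R^+_{xy}=\begin{array}{c|cc}1&h_x&h_y\\ \hline t_x&0&T_x-1\\ t_y&0&0\end{array}\,,\qquad R^-_{xy}=\begin{array}{c|cc}1&h_x&h_y\\ \hline t_x&0&T_x^{-1}-1\\ t_y&0&0\end{array}\,.$$ **Construction of $Z^\beta(T)$.** Let $T$ be an oriented tangle diagram. At each crossing, assign a number (label) to the upper strand and a number to the lower strand, all these labels being distinct. Form the disjoint union $\bigcup_{\{i,j\}}R^{\pm}_{ij}$,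 where $\{i,j\}$ runs over all pairs assigned to crossings, with $i$ labelling the upper strand and $j$ the lower strand, and where $\pm$ is the sign of the given crossing. Then for each strand multiply all the labels in the order in which they appear: if the first label on the strand is $k$, repeatedly apply $gm^{kl}_k$, where $l$ runs over all labels subsequently encountered on the strand, in order. If $T$ has $n$ strands, the result is an $n\times n$ array with an extra corner element; this array is $Z^\beta(T)$.
   Formalization: Strict invariance under move I is false (a positive kink has entry T-1, a straight strand 0). Instead, a kink of sign s on strand i multiplies the corner by T_i^s (upper passage first) or 1 and adds (1+<column i>)(T_i^s-1) to entry (i,i). Moves II and III: exact equality. *)

theory Defs
  imports Complex_Main "HOL-Library.Poly_Mapping" "HOL-Computational_Algebra.Fraction_Field"
begin

section \<open>Rational functions in the variables \<open>T\<^sub>0, T\<^sub>1, \<dots>\<close>\<close>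

text \<open>Polynomials are finitely supported functions from monomials to rational coefficients,
  a monomial being a finitely supported exponent vector.\<close>

type_synonym label = nat
type_synonym mpoly = "(label \<Rightarrow>\<^sub>0 nat) \<Rightarrow>\<^sub>0 rat"
type_synonym ratfun = "mpoly fract"

definition var :: "label \<Rightarrow> ratfun" where
  "var i = Fract (Poly_Mapping.single (Poly_Mapping.single i 1) 1) 1"

definition change_vars_monom :: "(label \<Rightarrow> label) \<Rightarrow> (label \<Rightarrow>\<^sub>0 nat) \<Rightarrow> (label \<Rightarrow>\<^sub>0 nat)" where
  "change_vars_monom f m =
     (\<Sum>i\<in>Poly_Mapping.keys m. Poly_Mapping.single (f i) (Poly_Mapping.lookup m i))"

definition change_vars_poly :: "(label \<Rightarrow> label) \<Rightarrow> mpoly \<Rightarrow> mpoly" where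
  "change_vars_poly f p =
     (\<Sum>m\<in>Poly_Mapping.keys p.
        Poly_Mapping.single (change_vars_monom f m) (Poly_Mapping.lookup p m))"

text \<open>The substitution \<open>T\<^sub>i \<mapsto> T\<^bsub>f i\<^esub>\<close> is only partially defined on rational functions: it
  needs a representation as a fraction whose denominator does not become zero. The value does
  not depend on the choice of such a representation. If there is none, the value is \<open>0\<close>. (For
  the arrays obtained from diagrams there always is one, because all entries are regular at
  the point where every \<open>T\<^sub>i\<close> is \<open>1\<close>.)\<close>

definition change_vars :: "(label \<Rightarrow> label) \<Rightarrow> ratfun \<Rightarrow> ratfun" where
  "change_vars f r =
     (if \<exists>p q. r = Fract p q \<and> change_vars_poly f q \<noteq> 0
      then (THE v. \<exists>p q. r = Fract p q \<and> change_vars_poly f q \<noteq> 0 \<and>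
                     v = Fract (change_vars_poly f p) (change_vars_poly f q))
      else 0)"


section \<open>Arrays and their operations\<close>

text \<open>An element of \<open>\<beta>(\<eta>,\<tau>)\<close>. Rows are labelled by \<open>tails\<close>, columns by \<open>heads\<close>;
  \<open>entry A t h\<close> is the entry in row \<open>t\<close> and column \<open>h\<close>. By convention \<open>entry\<close> is \<open>0\<close> off
  \<open>tails \<times> heads\<close>, so that equal arrays are equal as records; all operations below respect
  this convention.\<close>

record beta =
  heads :: "label set"
  tails :: "label set"
  corner :: ratfun
  entry :: "label \<Rightarrow> label \<Rightarrow> ratfun"

definition col_sum :: "beta \<Rightarrow> label \<Rightarrow> ratfun" where
  "col_sum A h = (\<Sum>t\<in>tails A. entry A t h)"

definition tm :: "label \<Rightarrow> label \<Rightarrow> label \<Rightarrow> beta \<Rightarrow> beta" where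
  "tm x y z A =
     (let \<sigma> = id(x := z, y := z) in
      \<lparr> heads = heads A,
        tails = insert z (tails A - {x, y}),
        corner = change_vars \<sigma> (corner A),
        entry = (\<lambda>t h. change_vars \<sigma>
          (if t = z then entry A x h + entry A y h
           else if t \<in> {x, y} then 0
           else entry A t h)) \<rparr>)"

definition hm :: "label \<Rightarrow> label \<Rightarrow> label \<Rightarrow> beta \<Rightarrow> beta" where
  "hm x y z A =
     \<lparr> heads = insert z (heads A - {x, y}),
       tails = tails A,
       corner = corner A,
       entry = (\<lambda>t h.
         if h = z then entry A t x + entry A t y + col_sum A x * entry A t y
         else if h \<in> {x, y} then 0
         else entry A t h) \<rparr>"

definition sw :: "label \<Rightarrow> label \<Rightarrow> beta \<Rightarrow> beta" where
  "sw x y A =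
     (let \<epsilon> = 1 + entry A x y;
          \<gamma>sum = (\<Sum>t\<in>tails A - {x}. entry A t y)
      in
      \<lparr> heads = heads A,
        tails = tails A,
        corner = corner A * \<epsilon>,
        entry = (\<lambda>t h.
          if t = x then entry A x h * (1 + \<gamma>sum / \<epsilon>)
          else if h = y then entry A t y / \<epsilon>
          else entry A t h - entry A t y * entry A x h / \<epsilon>) \<rparr>)"

definition gm :: "label \<Rightarrow> label \<Rightarrow> label \<Rightarrow> beta \<Rightarrow> beta" where
  "gm x y z A = hm x y z (tm x y z (sw x y A))"

text \<open>Block-diagonal union of a finite family of arrays with pairwise disjoint label sets: as the
  entries of each block are \<open>0\<close> off the block, the sum below has at most one nonzero term.\<close>

definition disjoint_union :: "'i set \<Rightarrow> ('i \<Rightarrow> beta) \<Rightarrow> beta" where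
  "disjoint_union I A =
     \<lparr> heads = (\<Union>i\<in>I. heads (A i)),
       tails = (\<Union>i\<in>I. tails (A i)),
       corner = (\<Prod>i\<in>I. corner (A i)),
       entry = (\<lambda>t h. \<Sum>i\<in>I. entry (A i) t h) \<rparr>"

text \<open>\<open>R_matrix 1 x y\<close> and \<open>R_matrix (-1) x y\<close> are \<open>R\<^sup>+\<close> and \<open>R\<^sup>-\<close> with indices \<open>x, y\<close>.\<close>

definition R_matrix :: "int \<Rightarrow> label \<Rightarrow> label \<Rightarrow> beta" where
  "R_matrix s x y =
     \<lparr> heads = {x, y},
       tails = {x, y},
       corner = 1,
       entry = (\<lambda>t h. if t = x \<and> h = y then var x powi s - 1 else 0) \<rparr>"

definition trivial_array :: "label \<Rightarrow> beta" where
  "trivial_array x = \<lparr> heads = {x}, tails = {x}, corner = 1, entry = (\<lambda>_ _. 0) \<rparr>"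

text \<open>Renaming of labels and variables along a function that is injective on the labels of the
  array.\<close>

definition relabel :: "(label \<Rightarrow> label) \<Rightarrow> beta \<Rightarrow> beta" where
  "relabel f A =
     \<lparr> heads = f ` heads A,
       tails = f ` tails A,
       corner = change_vars f (corner A),
       entry = (\<lambda>t h.
         if t \<in> f ` tails A \<and> h \<in> f ` heads A
         then change_vars f (entry A (inv_into (tails A) f t) (inv_into (heads A) f h))
         else 0) \<rparr>"


section \<open>Oriented tangle diagrams\<close>

text \<open>
  Diagrams are drawn in an oriented disk; the strands are intervals with end points on the
  boundary circle, there are no closed components. A diagram is considered up to planar
  isotopy, and is then determined by the following combinatorial data. Each strand is the list
  of passages through crossings that are met when following its orientation. The planar picture
  at a crossing \<open>c\<close> is given by \<open>from_right c\<close>: it is true iff, for an observer looking along the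
  upper strand, the lower strand passes from the right to the left. The end points of the
  strands are listed in counterclockwise order along the boundary circle.
\<close>

datatype level = Upper | Lower

type_synonym passage = "nat \<times> level"

datatype half_edge = Source nat | Sink nat | Incoming passage | Outgoing passage

record tangle =
  strands :: "passage list list"
  from_right :: "nat \<Rightarrow> bool"
  boundary :: "half_edge list"

definition passages :: "tangle \<Rightarrow> passage set" where
  "passages D = (\<Union>s\<in>set (strands D). set s)"

definition crossings :: "tangle \<Rightarrow> nat set" where
  "crossings D = fst ` passages D"

text \<open>
  The underlying planar graph. The boundary circle is collapsed to one vertex, so that the disk
  becomes a sphere. Every strand is then a closed walk through that vertex; in particular the
  graph is connected.
\<close>

definition half_edges :: "tangle \<Rightarrow> half_edge set" where
  "half_edges D =
     Source ` {..<length (strands D)} \<union> Sink ` {..<length (strands D)}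
     \<union> Incoming ` passages D \<union> Outgoing ` passages D"

definition strand_half_edges :: "tangle \<Rightarrow> nat \<Rightarrow> half_edge list" where
  "strand_half_edges D i =
     Source i # concat (map (\<lambda>p. [Incoming p, Outgoing p]) (strands D ! i)) @ [Sink i]"

definition edges :: "tangle \<Rightarrow> (half_edge \<times> half_edge) set" where
  "edges D =
     {(strand_half_edges D i ! (2 * k), strand_half_edges D i ! (2 * k + 1)) | i k.
        i < length (strands D) \<and> k \<le> length (strands D ! i)}"

text \<open>\<open>next_ccw D h h'\<close>: among the half-edges at their common vertex, \<open>h'\<close> comes directly after
  \<open>h\<close> in counterclockwise order. Around the collapsed boundary circle the order is reversed,
  as that vertex lies outside the disk.\<close>

inductive next_ccw :: "tangle \<Rightarrow> half_edge \<Rightarrow> half_edge \<Rightarrow> bool" for D where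
  "c \<in> crossings D \<Longrightarrow> from_right D c \<Longrightarrow> next_ccw D (Outgoing (c, Upper)) (Outgoing (c, Lower))"
| "c \<in> crossings D \<Longrightarrow> from_right D c \<Longrightarrow> next_ccw D (Outgoing (c, Lower)) (Incoming (c, Upper))"
| "c \<in> crossings D \<Longrightarrow> from_right D c \<Longrightarrow> next_ccw D (Incoming (c, Upper)) (Incoming (c, Lower))"
| "c \<in> crossings D \<Longrightarrow> from_right D c \<Longrightarrow> next_ccw D (Incoming (c, Lower)) (Outgoing (c, Upper))"
| "c \<in> crossings D \<Longrightarrow> \<not> from_right D c \<Longrightarrow> next_ccw D (Outgoing (c, Upper)) (Incoming (c, Lower))"
| "c \<in> crossings D \<Longrightarrow> \<not> from_right D c \<Longrightarrow> next_ccw D (Incoming (c, Lower)) (Incoming (c, Upper))"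
| "c \<in> crossings D \<Longrightarrow> \<not> from_right D c \<Longrightarrow> next_ccw D (Incoming (c, Upper)) (Outgoing (c, Lower))"
| "c \<in> crossings D \<Longrightarrow> \<not> from_right D c \<Longrightarrow> next_ccw D (Outgoing (c, Lower)) (Outgoing (c, Upper))"
| "k < length (boundary D) \<Longrightarrow>
   next_ccw D (boundary D ! (Suc k mod length (boundary D))) (boundary D ! k)"

text \<open>Faces are traced by crossing the edge at hand and then turning to the next half-edge.
  On the half-edges of a diagram this is a permutation, so the reflexive transitive closure is
  an equivalence relation whose classes are its cycles.\<close>

definition face_step :: "tangle \<Rightarrow> (half_edge \<times> half_edge) set" where
  "face_step D = {(h, h'). \<exists>g. ((h, g) \<in> edges D \<or> (g, h) \<in> edges D) \<and> next_ccw D g h'}"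

definition faces :: "tangle \<Rightarrow> half_edge set set" where
  "faces D = half_edges D // (face_step D)\<^sup>*"

text \<open>The graph has \<open>C + 1\<close> vertices and \<open>2 C + n\<close> edges, where \<open>C\<close> is the number of crossings and
  \<open>n > 0\<close> the number of strands; so the last condition is Euler's formula
  \<open>V - E + F = 2\<close>, i.e. planarity.\<close>

definition tangle_diagram :: "tangle \<Rightarrow> bool" where
  "tangle_diagram D \<longleftrightarrow>
     distinct (concat (strands D)) \<and>
     (\<forall>c. (c, Upper) \<in> passages D \<longleftrightarrow> (c, Lower) \<in> passages D) \<and>
     distinct (boundary D) \<and>
     set (boundary D) = Source ` {..<length (strands D)} \<union> Sink ` {..<length (strands D)} \<and>
     (strands D = [] \<or> card (faces D) = card (crossings D) + length (strands D) + 1)"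

text \<open>Right-hand rule: with the thumb along the upper strand, the fingers point from right to
  left below it.\<close>

definition crossing_sign :: "tangle \<Rightarrow> nat \<Rightarrow> int" where
  "crossing_sign D c = (if from_right D c then 1 else -1)"


section \<open>The construction of \<open>Z\<^sup>\<beta>\<close>\<close>

text \<open>The construction depends on a choice of labels and on the order in which the strands are
  treated. The labels are attached to the passages; a strand without crossings gets one label
  for itself, and contributes a zero row and a zero column.\<close>

datatype slot = Passage passage | Bare_strand nat

definition bare_strands :: "tangle \<Rightarrow> nat set" where
  "bare_strands D = {i. i < length (strands D) \<and> strands D ! i = []}"

definition slots :: "tangle \<Rightarrow> slot set" where
  "slots D = Passage ` passages D \<union> Bare_strand ` bare_strands D"

definition strand_slots :: "tangle \<Rightarrow> nat \<Rightarrow> slot list" where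
  "strand_slots D i =
     (if strands D ! i = [] then [Bare_strand i] else map Passage (strands D ! i))"

definition labelling :: "tangle \<Rightarrow> (slot \<Rightarrow> label) \<Rightarrow> bool" where
  "labelling D lab \<longleftrightarrow> inj_on lab (slots D)"

definition strand_order :: "tangle \<Rightarrow> nat list \<Rightarrow> bool" where
  "strand_order D ord \<longleftrightarrow> distinct ord \<and> set ord = {..<length (strands D)}"

definition crossing_array :: "tangle \<Rightarrow> (slot \<Rightarrow> label) \<Rightarrow> beta" where
  "crossing_array D lab =
     disjoint_union (crossings D <+> bare_strands D)
       (\<lambda>u. case u of
          Inl c \<Rightarrow> R_matrix (crossing_sign D c) (lab (Passage (c, Upper))) (lab (Passage (c, Lower)))
        | Inr i \<Rightarrow> trivial_array (lab (Bare_strand i)))"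

fun multiply_labels :: "label list \<Rightarrow> beta \<Rightarrow> beta" where
  "multiply_labels [] A = A"
| "multiply_labels (k # ls) A = fold (\<lambda>l. gm k l k) ls A"

definition first_label :: "tangle \<Rightarrow> (slot \<Rightarrow> label) \<Rightarrow> nat \<Rightarrow> label" where
  "first_label D lab i = lab (hd (strand_slots D i))"

text \<open>After the multiplications the array is indexed by the first labels of the strands. In
  order that the results for different diagrams can be compared, these are finally replaced
  by the strands themselves (that is, by their positions in the list of strands).\<close>

definition Z_beta :: "tangle \<Rightarrow> (slot \<Rightarrow> label) \<Rightarrow> nat list \<Rightarrow> beta" where
  "Z_beta D lab ord =
     relabel (inv_into {..<length (strands D)} (first_label D lab))
       (fold (\<lambda>i. multiply_labels (map lab (strand_slots D i))) ord (crossing_array D lab))"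


section \<open>Reidemeister moves\<close>

definition consecutive :: "tangle \<Rightarrow> passage \<Rightarrow> passage \<Rightarrow> bool" where
  "consecutive D p q \<longleftrightarrow> (\<exists>s\<in>set (strands D). \<exists>u v. s = u @ [p, q] @ v)"

text \<open>\<open>erases D' C D\<close>: the diagram \<open>D\<close> arises from \<open>D'\<close> by omitting the crossings in \<open>C\<close>.\<close>

definition erases :: "tangle \<Rightarrow> nat set \<Rightarrow> tangle \<Rightarrow> bool" where
  "erases D' C D \<longleftrightarrow>
     strands D = map (filter (\<lambda>p. fst p \<notin> C)) (strands D') \<and>
     (\<forall>c\<in>crossings D. from_right D c = from_right D' c) \<and>
     boundary D = boundary D'"

text \<open>The first move creates a kink \<open>c\<close> on strand \<open>i\<close> of \<open>D\<close>; the strand first passes \<open>c\<close> on level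
  \<open>l\<close>. The sign of \<open>c\<close> is arbitrary, so that there are four kinds of kinks.\<close>

definition reidemeister_I :: "nat \<Rightarrow> nat \<Rightarrow> level \<Rightarrow> tangle \<Rightarrow> tangle \<Rightarrow> bool" where
  "reidemeister_I i c l D D' \<longleftrightarrow>
     erases D' {c} D \<and> i < length (strands D') \<and>
     (\<exists>u v. strands D' ! i = u @ (if l = Upper then [(c, Upper), (c, Lower)]
                                            else [(c, Lower), (c, Upper)]) @ v)"

text \<open>The second move creates two crossings of opposite signs such that one arc lies over
  another one between them; the arcs can be parallel or antiparallel. In a planar diagram the
  two arcs between \<open>c\<close> and \<open>d\<close> automatically bound a bigonal face.\<close>

definition reidemeister_II :: "tangle \<Rightarrow> tangle \<Rightarrow> bool" where
  "reidemeister_II D D' \<longleftrightarrow>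
     (\<exists>c d. c \<noteq> d \<and> from_right D' c \<noteq> from_right D' d \<and>
        erases D' {c, d} D \<and>
        consecutive D' (c, Upper) (d, Upper) \<and>
        (consecutive D' (c, Lower) (d, Lower) \<or> consecutive D' (d, Lower) (c, Lower)))"

text \<open>
  The third move: a top, a middle and a bottom arc bound a triangular face, with crossings
  \<open>a\<close> (top over middle), \<open>b\<close> (top over bottom) and \<open>c\<close> (middle over bottom). The move reverses
  the order of the two crossings on each of the arcs, and keeps the signs.

  The conditions on the order say that the triangle is a face. Let \<open>u, v, w\<close> be the directions
  of the top, middle and bottom arc, and \<open>[\<cdot>,\<cdot>]\<close> the planar cross product. By the identity
  \<open>[v,w] u + [w,u] v + [u,v] w = 0\<close>, going round the triangle from \<open>b\<close> to \<open>a\<close> to \<open>c\<close> to \<open>b\<close> one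
  follows the directions \<open>[v,w] u\<close>, \<open>[w,u] v\<close>, \<open>[u,v] w\<close>, or the opposite of all three. Here
  \<open>[v,w]\<close>, \<open>-[w,u]\<close>, \<open>[u,v]\<close> have the signs of the crossings \<open>c\<close>, \<open>b\<close>, \<open>a\<close>. The Boolean \<open>e\<close>
  tells the two cases apart; they are the two sides of the move.
\<close>

definition triangle :: "tangle \<Rightarrow> nat \<Rightarrow> nat \<Rightarrow> nat \<Rightarrow> bool \<Rightarrow> bool" where
  "triangle D a b c e \<longleftrightarrow>
     distinct [a, b, c] \<and>
     (if from_right D c = e then consecutive D (b, Upper) (a, Upper)
                            else consecutive D (a, Upper) (b, Upper)) \<and>
     (if from_right D b = e then consecutive D (c, Upper) (a, Lower)
                            else consecutive D (a, Lower) (c, Upper)) \<and>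
     (if from_right D a = e then consecutive D (c, Lower) (b, Lower)
                            else consecutive D (b, Lower) (c, Lower))"

definition flip_triangle :: "nat \<Rightarrow> nat \<Rightarrow> nat \<Rightarrow> passage \<Rightarrow> passage" where
  "flip_triangle a b c =
     id((a, Upper) := (b, Upper), (b, Upper) := (a, Upper),
        (a, Lower) := (c, Upper), (c, Upper) := (a, Lower),
        (b, Lower) := (c, Lower), (c, Lower) := (b, Lower))"

definition reidemeister_III :: "tangle \<Rightarrow> tangle \<Rightarrow> bool" where
  "reidemeister_III D D' \<longleftrightarrow>
     (\<exists>a b c e. triangle D a b c e \<and>
        strands D' = map (map (flip_triangle a b c)) (strands D) \<and>
        (\<forall>x\<in>crossings D. from_right D' x = from_right D x) \<and>
        boundary D' = boundary D)"

text \<open>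
  The array of a kink is not the trivial one: its only entry is \<open>T\<^sup>s - 1\<close>, where \<open>s\<close> is the
  sign, and its corner is \<open>T\<^sup>s\<close> or \<open>1\<close> according as the upper or the lower passage comes first.
  So \<open>Z\<^sup>\<beta>\<close> detects the framing, and strict invariance under the first move fails: it is respected
  only up to multiplication by the array of the kink. On strand \<open>i\<close> this multiplication is the following operation.
\<close>

definition multiply_kink :: "nat \<Rightarrow> int \<Rightarrow> level \<Rightarrow> beta \<Rightarrow> beta" where
  "multiply_kink i s l A =
     A \<lparr> corner := corner A * (if l = Upper then var i powi s else 1),
         entry := (\<lambda>t h. entry A t h +
           (if t = i \<and> h = i then (1 + col_sum A i) * (var i powi s - 1) else 0)) \<rparr>"

end

theory Submission
  imports Defs "HOL-Library.Multiset"
begin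

text \<open>
  For an array \<open>A\<close> with column sums \<open>c\<close> put \<open>G = diag(1 + c) - A\<close>. In terms of \<open>G\<close> the operation
  \<open>gm\<close> feeds the output of one strand into the input of another one, which is the rank-one update
  \<open>G r s + G r y * G x s / (1 - G x y)\<close>, while the corner element is multiplied by the pivot
  \<open>1 - G x y\<close>; the numbers \<open>1 + c\<close> are multiplicative along strands. Such updates commute as soon as
  the pivots do not vanish. This is guaranteed by regularity at the point where all variables
  are 1: there \<open>G\<close> is the identity matrix. Regularity also makes the changes of variables ring
  homomorphisms, so that all variables can be renamed at the beginning. The \<open>R\<close>-matrices become
  Burau matrices, and by commutation every Reidemeister move can be checked on its own
  crossings: a kink and a bigon become identity matrices, up to the corner element of the kink.
\<close>

section \<open>Evaluation at the point where all variables are 1\<close>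

text \<open>Think of \<open>G r s\<close> as the response at output \<open>r\<close> to a signal
  entering at input \<open>s\<close>. Feeding output \<open>x\<close> into input \<open>y\<close>
  sums the geometric series of the loop between them; this is the origin of the denominator
  \<open>1 - G x y\<close>. For arrays with regular entries every column of \<open>G\<close> sums to
  1, so the numbers 1 + c cannot be read off from the column sums of \<open>G\<close>: they are
  carried along separately, and the array is recovered as diag(1 + c) - G. Two obstacles shape the
  proof. \<open>change_vars\<close> takes a mere default value where no admissible fraction exists,
  so it is controlled only on functions that are regular at the base point. And \<open>G\<close>
  does not stay close to the identity while pieces are linked without renaming: at the base point
  every link lets the signal pass on to later pieces. Only a triangular shape along the strands
  survives, and it keeps the pivots invertible in whatever order the links are made.\<close>

text \<open>Substitution in monomials, substitution in polynomials and evaluation at a point are all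
  of this form, so additivity and multiplicativity are proved once for all three.\<close>

definition keys_sum :: "('a \<Rightarrow> 'b \<Rightarrow> 'c) \<Rightarrow> ('a \<Rightarrow>\<^sub>0 'b::zero) \<Rightarrow> 'c::comm_monoid_add" where
  "keys_sum \<phi> p = (\<Sum>m\<in>Poly_Mapping.keys p. \<phi> m (Poly_Mapping.lookup p m))"

lemma keys_sum_zero [simp]: "keys_sum \<phi> 0 = 0"
  by (simp add: keys_sum_def)

lemma keys_sum_single: "(\<And>m. \<phi> m 0 = 0) \<Longrightarrow> keys_sum \<phi> (Poly_Mapping.single m c) = \<phi> m c"
  by (cases "c = 0") (simp_all add: keys_sum_def)

lemma keys_sum_add:
  assumes "\<And>m. \<phi> m 0 = 0" "\<And>m c d. \<phi> m (c + d) = \<phi> m c + \<phi> m d"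
  shows "keys_sum \<phi> (p + q) = keys_sum \<phi> p + keys_sum \<phi> q"
  unfolding keys_sum_def using assms by (rule setsum_keys_plus_distrib)

lemma keys_sum_sum:
  assumes "\<And>m. \<phi> m 0 = 0" "\<And>m c d. \<phi> m (c + d) = \<phi> m c + \<phi> m d"
  shows "keys_sum \<phi> (\<Sum>i\<in>I. p i) = (\<Sum>i\<in>I. keys_sum \<phi> (p i))"
  by (induction I rule: infinite_finite_induct) (simp_all add: keys_sum_add assms)

lemma poly_mapping_sum_single: "(\<Sum>m\<in>Poly_Mapping.keys p. Poly_Mapping.single m (Poly_Mapping.lookup p m)) = p"
proof (rule poly_mapping_eqI)
  fix k
  show "Poly_Mapping.lookup (\<Sum>m\<in>Poly_Mapping.keys p. Poly_Mapping.single m (Poly_Mapping.lookup p m)) k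
    = Poly_Mapping.lookup p k"
    by (cases "k \<in> Poly_Mapping.keys p")
      (auto simp: lookup_sum lookup_single when_def not_in_keys_iff_lookup_eq_zero)
qed

text \<open>Both factors are written as sums of their monomials; by additivity the claim reduces to
  products of two single monomials.\<close>

lemma keys_sum_mult:
  fixes \<phi> :: "'a::monoid_add \<Rightarrow> 'b::semiring_0 \<Rightarrow> 'c::semiring_0"
  assumes \<phi>: "\<And>m. \<phi> m 0 = 0" "\<And>m c d. \<phi> m (c + d) = \<phi> m c + \<phi> m d"
    and mult: "\<And>m n c d. \<phi> (m + n) (c * d) = \<phi> m c * \<phi> n d"
  shows "keys_sum \<phi> (p * q) = keys_sum \<phi> p * keys_sum \<phi> q"
proof -
  let ?s = "\<lambda>p m. Poly_Mapping.single m (Poly_Mapping.lookup p m)"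
  have "keys_sum \<phi> (p * q) =
      keys_sum \<phi> ((\<Sum>m\<in>Poly_Mapping.keys p. ?s p m) * (\<Sum>n\<in>Poly_Mapping.keys q. ?s q n))"
    by (simp only: poly_mapping_sum_single)
  also have "\<dots> = (\<Sum>m\<in>Poly_Mapping.keys p. \<Sum>n\<in>Poly_Mapping.keys q.
      \<phi> m (Poly_Mapping.lookup p m) * \<phi> n (Poly_Mapping.lookup q n))"
    by (simp add: sum_product mult_single keys_sum_sum keys_sum_single \<phi> mult)
  finally show ?thesis
    by (simp add: keys_sum_def sum_product)
qed

section \<open>Substitution of variables in monomials and polynomials\<close>

lemma change_vars_monom_zero [simp]: "change_vars_monom f 0 = 0"
  by (simp add: change_vars_monom_def)

lemma change_vars_monom_eq:
  "change_vars_monom f = keys_sum (\<lambda>i. Poly_Mapping.single (f i))"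
  by (simp add: change_vars_monom_def keys_sum_def fun_eq_iff)

lemma change_vars_poly_eq:
  "change_vars_poly f = keys_sum (\<lambda>m. Poly_Mapping.single (change_vars_monom f m))"
  by (simp add: change_vars_poly_def keys_sum_def fun_eq_iff)

lemma change_vars_monom_add: "change_vars_monom f (m + n) = change_vars_monom f m + change_vars_monom f n"
  by (simp add: change_vars_monom_eq keys_sum_add single_add)

lemma change_vars_monom_single [simp]:
  "change_vars_monom f (Poly_Mapping.single i k) = Poly_Mapping.single (f i) k"
  by (simp add: change_vars_monom_eq keys_sum_single)

lemma change_vars_monom_comp: "change_vars_monom f (change_vars_monom g m) = change_vars_monom (f \<circ> g) m"
  unfolding change_vars_monom_eq keys_sum_def [of _ m]
  by (simp add: keys_sum_sum keys_sum_single single_add)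

lemma change_vars_poly_add: "change_vars_poly f (p + q) = change_vars_poly f p + change_vars_poly f q"
  by (simp add: change_vars_poly_eq keys_sum_add single_add)

lemma change_vars_poly_mult: "change_vars_poly f (p * q) = change_vars_poly f p * change_vars_poly f q"
  by (simp add: change_vars_poly_eq keys_sum_mult single_add mult_single change_vars_monom_add)

lemma change_vars_poly_single [simp]:
  "change_vars_poly f (Poly_Mapping.single m c) = Poly_Mapping.single (change_vars_monom f m) c"
  by (simp add: change_vars_poly_eq keys_sum_single)

lemma change_vars_poly_zero [simp]: "change_vars_poly f 0 = 0"
  by (simp add: change_vars_poly_eq)

lemma change_vars_poly_one [simp]: "change_vars_poly f 1 = 1"
  using change_vars_poly_single [of f 0 1] by simp

lemma change_vars_poly_comp: "change_vars_poly f (change_vars_poly g p) = change_vars_poly (f \<circ> g) p"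
  unfolding change_vars_poly_eq keys_sum_def [of _ p]
  by (simp add: keys_sum_sum keys_sum_single single_add change_vars_monom_comp)

definition at_one :: "mpoly \<Rightarrow> rat" where
  "at_one = keys_sum (\<lambda>_ c. c)"

lemma at_one_zero [simp]: "at_one 0 = 0"
  by (simp add: at_one_def)

lemma at_one_add [simp]: "at_one (p + q) = at_one p + at_one q"
  by (simp add: at_one_def keys_sum_add)

lemma at_one_mult [simp]: "at_one (p * q) = at_one p * at_one q"
  by (simp add: at_one_def keys_sum_mult)

lemma at_one_single [simp]: "at_one (Poly_Mapping.single m c) = c"
  by (simp add: at_one_def keys_sum_single)

lemma at_one_one [simp]: "at_one 1 = 1"
  using at_one_single [of 0 1] by simp

lemma at_one_uminus [simp]: "at_one (- p) = - at_one p"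
  using at_one_add [of p "- p"] by simp

lemma at_one_diff [simp]: "at_one (p - q) = at_one p - at_one q"
  using at_one_add [of "p - q" q] by simp

text \<open>All variables take the same value at the base point, so identifying some of them does
  not change the value there. Hence a denominator that is non-zero at the base point survives every
  substitution.\<close>

lemma at_one_change_vars_poly [simp]: "at_one (change_vars_poly f p) = at_one p"
  unfolding at_one_def change_vars_poly_eq keys_sum_def [of _ p]
  by (simp add: keys_sum_sum keys_sum_single)

lemma nonzero_if_at_one: "at_one q \<noteq> 0 \<Longrightarrow> q \<noteq> 0"
  by auto

text \<open>The local ring of the point where all variables are 1, and its maximal ideal.\<close>

definition regular :: "ratfun set" where
  "regular = {Fract p q | p q. at_one q \<noteq> 0}"

definition vanishing :: "ratfun set" where
  "vanishing = {Fract p q | p q. at_one q \<noteq> 0 \<and> at_one p = 0}"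

lemma regularE:
  assumes "x \<in> regular"
  obtains p q where "x = Fract p q" "at_one q \<noteq> 0" "q \<noteq> 0"
proof -
  obtain p q where "x = Fract p q" "at_one q \<noteq> 0"
    using assms by (auto simp: regular_def)
  then show thesis using that nonzero_if_at_one by simp
qed

lemma vanishingE:
  assumes "x \<in> vanishing"
  obtains p q where "x = Fract p q" "at_one q \<noteq> 0" "q \<noteq> 0" "at_one p = 0"
proof -
  obtain p q where "x = Fract p q" "at_one q \<noteq> 0" "at_one p = 0"
    using assms by (auto simp: vanishing_def)
  then show thesis using that nonzero_if_at_one by simp
qed

lemma regularI: "at_one q \<noteq> 0 \<Longrightarrow> Fract p q \<in> regular"
  unfolding regular_def by blast

lemma vanishingI: "at_one q \<noteq> 0 \<Longrightarrow> at_one p = 0 \<Longrightarrow> Fract p q \<in> vanishing"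
  unfolding vanishing_def by blast

lemma vanishing_regular: "x \<in> vanishing \<Longrightarrow> x \<in> regular"
  unfolding vanishing_def regular_def by blast

lemma regular_add: "x \<in> regular \<Longrightarrow> y \<in> regular \<Longrightarrow> x + y \<in> regular"
  by (auto elim!: regularE simp: intro!: regularI)

lemma regular_mult: "x \<in> regular \<Longrightarrow> y \<in> regular \<Longrightarrow> x * y \<in> regular"
  by (auto elim!: regularE simp: intro!: regularI)

lemma vanishing_0 [simp]: "0 \<in> vanishing"
  unfolding Zero_fract_def by (rule vanishingI) simp_all

lemma regular_1 [simp]: "1 \<in> regular"
  unfolding One_fract_def by (rule regularI) simp_all

lemma regular_0 [simp]: "0 \<in> regular"
  by (simp add: vanishing_regular)

lemma vanishing_add: "x \<in> vanishing \<Longrightarrow> y \<in> vanishing \<Longrightarrow> x + y \<in> vanishing"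
  by (auto elim!: vanishingE simp: intro!: vanishingI)

lemma vanishing_uminus: "x \<in> vanishing \<Longrightarrow> - x \<in> vanishing"
  by (auto elim!: vanishingE simp: intro!: vanishingI)

lemma vanishing_diff: "x \<in> vanishing \<Longrightarrow> y \<in> vanishing \<Longrightarrow> x - y \<in> vanishing"
  using vanishing_add [of x "- y"] vanishing_uminus [of y] by simp

lemma vanishing_mult_right: "x \<in> vanishing \<Longrightarrow> y \<in> regular \<Longrightarrow> x * y \<in> vanishing"
  by (auto elim!: vanishingE regularE simp: intro!: vanishingI)

lemma vanishing_mult_left: "x \<in> regular \<Longrightarrow> y \<in> vanishing \<Longrightarrow> x * y \<in> vanishing"
  by (auto elim!: vanishingE regularE simp: intro!: vanishingI)

lemma one_not_vanishing: "1 \<notin> vanishing"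
proof
  assume "1 \<in> vanishing"
  then obtain p q where "Fract 1 1 = Fract p q" "at_one q \<noteq> 0" "q \<noteq> 0" "at_one p = 0"
    unfolding One_fract_def by (rule vanishingE)
  then show False by (simp add: eq_fract)
qed

lemma near_one_nonzero: "x - 1 \<in> vanishing \<Longrightarrow> x \<noteq> 0"
  using vanishing_uminus [of "x - 1"] one_not_vanishing by auto

lemma near_one_regular: "x - 1 \<in> vanishing \<Longrightarrow> x \<in> regular"
  using regular_add [of "x - 1" 1] vanishing_regular by simp

lemma near_one_mult: "x - 1 \<in> vanishing \<Longrightarrow> y - 1 \<in> vanishing \<Longrightarrow> x * y - 1 \<in> vanishing"
  using vanishing_add [OF vanishing_mult_right [of "x - 1" y] , of "y - 1"]
  by (simp add: near_one_regular algebra_simps)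

lemma near_one_inverse:
  assumes "x - 1 \<in> vanishing"
  shows "inverse x - 1 \<in> vanishing"
proof -
  obtain p q where pq: "x - 1 = Fract p q" "at_one q \<noteq> 0" "q \<noteq> 0" "at_one p = 0"
    using assms by (rule vanishingE)
  have x: "x = Fract (p + q) q"
    using pq(1,3) by (simp add: One_fract_def diff_eq_eq eq_fract algebra_simps)
  have nz: "at_one (p + q) \<noteq> 0" "p + q \<noteq> 0"
    using pq nonzero_if_at_one [of "p + q"] by simp_all
  have "inverse x - 1 = Fract (- p) (p + q)"
    using nz by (simp add: x One_fract_def)
  then show ?thesis
    using pq nz by (simp add: vanishingI)
qed

lemma near_one_divide: "x - 1 \<in> vanishing \<Longrightarrow> y - 1 \<in> vanishing \<Longrightarrow> x / y - 1 \<in> vanishing"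
  by (simp add: near_one_mult near_one_inverse divide_inverse)

lemma regular_divide: "x \<in> regular \<Longrightarrow> y - 1 \<in> vanishing \<Longrightarrow> x / y \<in> regular"
  by (simp add: regular_mult near_one_inverse near_one_regular divide_inverse)

lemma vanishing_divide: "x \<in> vanishing \<Longrightarrow> y - 1 \<in> vanishing \<Longrightarrow> x / y \<in> vanishing"
  by (simp add: vanishing_mult_right near_one_inverse near_one_regular divide_inverse)

lemma vanishing_sum: "(\<And>i. i \<in> I \<Longrightarrow> f i \<in> vanishing) \<Longrightarrow> sum f I \<in> vanishing"
  by (induction I rule: infinite_finite_induct) (simp_all add: vanishing_add)

lemma near_one_var: "var i - 1 \<in> vanishing"
  unfolding var_def One_fract_def by (auto intro!: vanishingI)

lemma var_nonzero [simp]: "var i \<noteq> 0"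
  by (rule near_one_nonzero [OF near_one_var])

lemma near_one_power: "x - 1 \<in> vanishing \<Longrightarrow> x ^ n - 1 \<in> vanishing"
  by (induction n) (simp_all add: near_one_mult)

lemma near_one_powi: "x - 1 \<in> vanishing \<Longrightarrow> x powi k - 1 \<in> vanishing"
  by (simp add: power_int_def near_one_power near_one_inverse)

text \<open>The substituted denominator is non-zero because its value at the base point is. Two
  admissible fractions for the same function satisfy a cross-multiplied polynomial identity, which
  the substitution preserves; so the described value is unique.\<close>

lemma change_vars_Fract:
  assumes "at_one q \<noteq> 0"
  shows "change_vars f (Fract p q) = Fract (change_vars_poly f p) (change_vars_poly f q)"
proof -
  have nz: "change_vars_poly f q \<noteq> 0" "q \<noteq> 0"
    using assms nonzero_if_at_one [of "change_vars_poly f q"] nonzero_if_at_one [of q] by simp_all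
  have "Fract (change_vars_poly f p') (change_vars_poly f q')
      = Fract (change_vars_poly f p) (change_vars_poly f q)"
    if "Fract p q = Fract p' q'" "change_vars_poly f q' \<noteq> 0" for p' q'
  proof -
    have "q' \<noteq> 0" using that(2) by auto
    then have "p * q' = p' * q" using that(1) nz by (simp add: eq_fract)
    then have "change_vars_poly f p * change_vars_poly f q' = change_vars_poly f p' * change_vars_poly f q"
      by (metis change_vars_poly_mult)
    then show ?thesis using that(2) nz by (simp add: eq_fract)
  qed
  then have "(THE v. \<exists>p' q'. Fract p q = Fract p' q' \<and> change_vars_poly f q' \<noteq> 0 \<and>
      v = Fract (change_vars_poly f p') (change_vars_poly f q'))
      = Fract (change_vars_poly f p) (change_vars_poly f q)"
    using nz by (intro the_equality) blast+
  then show ?thesis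
    unfolding change_vars_def using nz by auto
qed

lemma change_vars_add:
  assumes "x \<in> regular" "y \<in> regular"
  shows "change_vars f (x + y) = change_vars f x + change_vars f y"
  using assms
  by (auto elim!: regularE
      simp: change_vars_Fract change_vars_poly_add change_vars_poly_mult nonzero_if_at_one)

lemma change_vars_mult:
  assumes "x \<in> regular" "y \<in> regular"
  shows "change_vars f (x * y) = change_vars f x * change_vars f y"
  using assms
  by (auto elim!: regularE simp: change_vars_Fract change_vars_poly_mult)

lemma change_vars_0 [simp]: "change_vars f 0 = 0"
  unfolding Zero_fract_def by (simp add: change_vars_Fract)

lemma change_vars_1 [simp]: "change_vars f 1 = 1"
  unfolding One_fract_def by (simp add: change_vars_Fract)

lemma regular_uminus: "x \<in> regular \<Longrightarrow> - x \<in> regular"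
  by (auto elim!: regularE simp: intro!: regularI)

lemma change_vars_uminus: "x \<in> regular \<Longrightarrow> change_vars f (- x) = - change_vars f x"
  using change_vars_add [of x "- x" f] regular_uminus [of x] by (simp add: eq_neg_iff_add_eq_0 add.commute)

lemma change_vars_diff:
  assumes "x \<in> regular" "y \<in> regular"
  shows "change_vars f (x - y) = change_vars f x - change_vars f y"
  using change_vars_add [of x "- y" f] assms by (simp add: regular_uminus change_vars_uminus)

text \<open>Regularity of the partial sums is part of the induction because additivity is available
  on regular functions only.\<close>

lemma change_vars_sum:
  "(\<And>i. i \<in> I \<Longrightarrow> g i \<in> regular) \<Longrightarrow> change_vars f (sum g I) = (\<Sum>i\<in>I. change_vars f (g i)) \<and> sum g I \<in> regular"
  by (induction I rule: infinite_finite_induct) (simp_all add: change_vars_add regular_add)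

lemma change_vars_regular: "x \<in> regular \<Longrightarrow> change_vars f x \<in> regular"
  by (auto elim!: regularE simp: change_vars_Fract intro!: regularI)

lemma change_vars_vanishing: "x \<in> vanishing \<Longrightarrow> change_vars f x \<in> vanishing"
  by (auto elim!: vanishingE simp: change_vars_Fract intro!: vanishingI)

lemma change_vars_near_one: "x - 1 \<in> vanishing \<Longrightarrow> change_vars f x - 1 \<in> vanishing"
  using change_vars_vanishing [of "x - 1" f] change_vars_diff [of x 1 f] by (simp add: near_one_regular)

lemma change_vars_comp: "x \<in> regular \<Longrightarrow> change_vars f (change_vars g x) = change_vars (f \<circ> g) x"
  by (auto elim!: regularE simp: change_vars_Fract change_vars_poly_comp)

lemma change_vars_var [simp]: "change_vars f (var i) = var (f i)"
  unfolding var_def by (simp add: change_vars_Fract)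

lemma change_vars_inverse:
  assumes "x - 1 \<in> vanishing"
  shows "change_vars f (inverse x) = inverse (change_vars f x)"
proof -
  have "change_vars f (inverse x) * change_vars f x = 1"
    using change_vars_mult [of "inverse x" x f] assms
    by (simp add: near_one_inverse near_one_regular near_one_nonzero)
  then show ?thesis by (metis inverse_unique inverse_inverse_eq)
qed

lemma change_vars_divide:
  "x \<in> regular \<Longrightarrow> y - 1 \<in> vanishing \<Longrightarrow> change_vars f (x / y) = change_vars f x / change_vars f y"
  by (simp add: divide_inverse change_vars_mult change_vars_inverse near_one_inverse near_one_regular)

lemma change_vars_power: "x \<in> regular \<Longrightarrow> change_vars f (x ^ n) = change_vars f x ^ n \<and> x ^ n \<in> regular"
  by (induction n) (simp_all add: change_vars_mult regular_mult)

lemma change_vars_powi: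
  assumes "x - 1 \<in> vanishing"
  shows "change_vars f (x powi k) = change_vars f x powi k"
  using assms
  by (simp add: power_int_def change_vars_power change_vars_inverse near_one_inverse near_one_regular)

section \<open>Stitching of transfer matrices\<close>

text \<open>A scalar together with a transfer matrix: rows are outputs, columns are inputs.\<close>

type_synonym 'i network = "ratfun \<times> ('i \<Rightarrow> 'i \<Rightarrow> ratfun)"

text \<open>Output \<open>p\<close> is fed into input \<open>q\<close>: a signal goes from
  \<open>s\<close> to \<open>r\<close> directly, or through \<open>p\<close> and \<open>q\<close>
  with any number of loops from \<open>q\<close> back to \<open>p\<close>. The used row
  \<open>p\<close> and column \<open>q\<close> stay in the matrix, so that links keep their names
  and can be made in any order.\<close>

fun stitch :: "'i \<times> 'i \<Rightarrow> 'i network \<Rightarrow> 'i network" where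
  "stitch (p, q) (w, G) =
     (w * (1 - G p q), \<lambda>r s. G r s + G r q * G p s / (1 - G p q))"

definition reindex :: "('i \<Rightarrow> 'j) \<Rightarrow> ('i \<Rightarrow> 'j) \<Rightarrow> 'j network \<Rightarrow> 'i network" where
  "reindex f g S = (fst S, \<lambda>r s. snd S (f r) (g s))"

text \<open>Stitching consumes the output \<open>x\<close> and the input \<open>y\<close>; the remaining output \<open>y\<close> and input \<open>x\<close>
  become those of one strand, called \<open>x\<close>. Row and column \<open>y\<close> of the result are junk.\<close>

definition merge :: "'i \<Rightarrow> 'i \<Rightarrow> 'i network \<Rightarrow> 'i network" where
  "merge x y S = reindex (id(x := y)) id (stitch (x, y) S)"

definition links :: "'i list \<Rightarrow> ('i \<times> 'i) list" where
  "links xs = zip xs (tl xs)"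

text \<open>All links are made before any index is discarded. What remains of a strand is the output
  of its last and the input of its first element. The value 0 outside the range makes equal results
  equal as functions.\<close>

definition stitch_strands :: "'i list list \<Rightarrow> 'i network \<Rightarrow> nat network" where
  "stitch_strands ss S =
     (let T = fold stitch (concat (map links ss)) S in
      (fst T, \<lambda>i j. if i < length ss \<and> j < length ss
                  then snd T (last (ss ! i)) (hd (ss ! j)) else 0))"

section \<open>Commutation of stitchings\<close>

lemma rank_one_updates_commute:
  fixes a b c d g u v x y :: "'a::field"
  assumes "a \<noteq> 0" "b \<noteq> 0" "a * b - c * d \<noteq> 0"
  shows "g + x * u / a + (y + x * c / a) * (v + d * u / a) / (b - d * c / a) =
         g + y * v / b + (x + y * d / b) * (u + c * v / b) / (a - c * d / b)"
proof -
  have 1: "b - d * c / a = (a * b - c * d) / a" "a - c * d / b = (a * b - c * d) / b"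
    using assms by (simp_all add: field_simps)
  have 2: "y + x * c / a = (a * y + x * c) / a" "v + d * u / a = (a * v + d * u) / a"
    "x + y * d / b = (b * x + y * d) / b" "u + c * v / b = (b * u + c * v) / b"
    using assms by (simp_all add: field_simps)
  \<comment> \<open>\<open>D\<close> is the determinant of the 2-by-2 pivot matrix with rows (a, -c)
    and (-d, b). Both orders of elimination give the simultaneous elimination of the two links, that
    is, the update by the inverse of this matrix.\<close>
  define D where "D = a * b - c * d"
  have D: "D \<noteq> 0" "c * d = a * b - D" using assms by (simp_all add: D_def)
  have L: "x * u / a + (a * y + x * c) / a * ((a * v + d * u) / a) / (D / a) =
      (b * x * u + a * y * v + x * c * v + y * d * u) / D"
  proof -
    have "x * u / a + (a * y + x * c) / a * ((a * v + d * u) / a) / (D / a) =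
        (x * u * D + (a * y + x * c) * (a * v + d * u)) / (a * D)"
      using assms D by (simp add: field_simps)
    also have "x * u * D + (a * y + x * c) * (a * v + d * u) =
        a * (b * x * u + a * y * v + x * c * v + y * d * u)"
      by (simp add: D_def algebra_simps)
    finally show ?thesis using assms by simp
  qed
  have R: "y * v / b + (b * x + y * d) / b * ((b * u + c * v) / b) / (D / b) =
      (b * x * u + a * y * v + x * c * v + y * d * u) / D"
  proof -
    have "y * v / b + (b * x + y * d) / b * ((b * u + c * v) / b) / (D / b) =
        (y * v * D + (b * x + y * d) * (b * u + c * v)) / (b * D)"
      using assms D by (simp add: field_simps)
    also have "y * v * D + (b * x + y * d) * (b * u + c * v) =
        b * (b * x * u + a * y * v + x * c * v + y * d * u)"
      by (simp add: D_def algebra_simps)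
    finally show ?thesis using assms by simp
  qed
  show ?thesis
    unfolding 1 2 D_def [symmetric] add.assoc L R ..
qed

text \<open>The product of the first pivot and the second one is a 2-by-2 determinant that does not
  depend on the order. So non-vanishing in one order gives it in the other, and the scalars agree as
  well.\<close>

lemma stitch_commute:
  assumes "1 - G p q \<noteq> 0" "1 - G p' q' \<noteq> 0" "1 - snd (stitch (p, q) (w, G)) p' q' \<noteq> 0"
  shows "stitch (p', q') (stitch (p, q) (w, G)) = stitch (p, q) (stitch (p', q') (w, G))"
proof -
  have "1 - snd (stitch (p, q) (w, G)) p' q' =
      ((1 - G p q) * (1 - G p' q') - G p q' * G p' q) / (1 - G p q)"
    using assms(1) by (simp add: field_simps)
  then have D: "(1 - G p q) * (1 - G p' q') - G p q' * G p' q \<noteq> 0"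
    using assms(3) by auto
  have "w * (1 - G p q) * (1 - G p' q' - G p' q * G p q' / (1 - G p q)) =
      w * (1 - G p' q') * (1 - G p q - G p q' * G p' q / (1 - G p' q'))"
    using assms(1,2) by (simp add: field_simps)
  then show ?thesis
    unfolding stitch.simps prod.inject diff_diff_eq [symmetric]
    by (intro conjI ext rank_one_updates_commute [OF assms(1,2) D])
qed

text \<open>At the base point no signal travels to an output of smaller rank. Closeness to the
  identity would be too strong an invariant: starting from it, a stitch along (p, q) gives the entry
  in row \<open>q\<close> and column \<open>p\<close> the value 1 at the base point.\<close>

definition triangular :: "'i set \<Rightarrow> ('i \<Rightarrow> nat) \<Rightarrow> 'i network \<Rightarrow> bool" where
  "triangular V \<rho> S \<longleftrightarrow>
     (\<forall>r\<in>V. \<forall>s\<in>V. snd S r s \<in> regular \<and> (\<rho> r < \<rho> s \<longrightarrow> snd S r s \<in> vanishing))"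

definition near_identity :: "'i set \<Rightarrow> 'i network \<Rightarrow> bool" where
  "near_identity V S \<longleftrightarrow> (\<forall>r\<in>V. \<forall>s\<in>V. snd S r s - (if r = s then 1 else 0) \<in> vanishing)"

lemma near_identityD:
  assumes "near_identity V S" "r \<in> V" "s \<in> V"
  shows "r = s \<Longrightarrow> snd S r s - 1 \<in> vanishing"
    and "r \<noteq> s \<Longrightarrow> snd S r s \<in> vanishing"
    and "snd S r s \<in> regular"
proof -
  have *: "snd S r s - (if r = s then 1 else 0) \<in> vanishing"
    using assms unfolding near_identity_def by blast
  show "r = s \<Longrightarrow> snd S r s - 1 \<in> vanishing" "r \<noteq> s \<Longrightarrow> snd S r s \<in> vanishing"
    using * by simp_all
  then show "snd S r s \<in> regular"
    using near_one_regular vanishing_regular by (cases "r = s") simp_all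
qed

lemma near_identity_triangular: "near_identity V S \<Longrightarrow> triangular V \<rho> S"
  unfolding triangular_def by (auto intro: near_identityD)

lemma pivot_near_one: "x \<in> vanishing \<Longrightarrow> (1 - x) - 1 \<in> vanishing"
  using vanishing_uminus by simp

text \<open>Let the rank of \<open>r\<close> be less than that of \<open>s\<close>. Either
  \<open>r\<close> also lies below \<open>q\<close>, and \<open>G r q\<close> vanishes at the base
  point; or \<open>q\<close> is at most \<open>r\<close>, so that \<open>p\<close> lies below
  \<open>s\<close> and \<open>G p s\<close> vanishes there.\<close>

lemma stitch_triangular:
  assumes S: "triangular V \<rho> S" and pq: "p \<in> V" "q \<in> V" "\<rho> p < \<rho> q"
  shows "triangular V \<rho> (stitch (p, q) S)"
proof -
  obtain w G where [simp]: "S = (w, G)" by fastforce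
  have reg: "\<And>r s. r \<in> V \<Longrightarrow> s \<in> V \<Longrightarrow> G r s \<in> regular"
    and van: "\<And>r s. r \<in> V \<Longrightarrow> s \<in> V \<Longrightarrow> \<rho> r < \<rho> s \<Longrightarrow> G r s \<in> vanishing"
    using S by (auto simp: triangular_def)
  have piv: "(1 - G p q) - 1 \<in> vanishing"
    using van [OF pq] by (rule pivot_near_one)
  have "G r q * G p s \<in> vanishing" if "r \<in> V" "s \<in> V" "\<rho> r < \<rho> s" for r s
  proof (cases "\<rho> r < \<rho> q")
    case True
    then show ?thesis using that pq by (simp add: reg van vanishing_mult_right)
  next
    case False
    then show ?thesis using that pq by (simp add: reg van vanishing_mult_left)
  qed
  then show ?thesis
    using piv pq unfolding triangular_def
    by (simp add: reg van regular_add regular_mult regular_divide vanishing_add vanishing_divide)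
qed

lemma triangular_pivot_nonzero:
  assumes "triangular V \<rho> S" "p \<in> V" "q \<in> V" "\<rho> p < \<rho> q"
  shows "1 - snd S p q \<noteq> 0"
  using assms by (intro near_one_nonzero pivot_near_one) (auto simp: triangular_def)

text \<open>The head of \<open>xs\<close> is pulled out of its place in \<open>ys\<close> to the
  front. The invariant \<open>P\<close> is there because stitchings commute only at networks with
  invertible pivots.\<close>

lemma fold_permute:
  assumes "mset xs = mset ys" "P S"
    and "\<And>x S. x \<in> set xs \<Longrightarrow> P S \<Longrightarrow> P (f x S)"
    and "\<And>x y S. x \<in> set xs \<Longrightarrow> y \<in> set xs \<Longrightarrow> P S \<Longrightarrow> f x (f y S) = f y (f x S)"
  shows "fold f xs S = fold f ys S"
  using assms
proof (induction xs arbitrary: ys S)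
  case Nil
  then have "ys = []" by simp
  then show ?case by simp
next
  case (Cons x xs)
  note inv = Cons.prems(3) and comm = Cons.prems(4)
  have front: "fold f (us @ [x]) S = fold f us (f x S)" if "set us \<subseteq> set (x # xs)" "P S" for us S
    using that
  proof (induction us arbitrary: S)
    case (Cons u us)
    have "P (f u S)" "f x (f u S) = f u (f x S)"
      using Cons.prems by (auto intro!: inv comm)
    then show ?case using Cons.IH [of "f u S"] Cons.prems(1) by simp
  qed simp
  obtain us vs where ys: "ys = us @ x # vs"
    using Cons.prems(1) by (metis list.set_intros(1) mset_eq_setD split_list)
  have "fold f xs (f x S) = fold f (us @ vs) (f x S)"
    using Cons.prems ys by (intro Cons.IH) auto
  moreover have "set us \<subseteq> set (x # xs)"
    using mset_eq_setD [OF Cons.prems(1)] ys by auto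
  ultimately show ?case
    using front [of us S] Cons.prems(2) ys by simp
qed

lemma fold_stitch_permute:
  assumes "mset L = mset L'" "triangular V \<rho> S"
    and L: "\<And>p q. (p, q) \<in> set L \<Longrightarrow> p \<in> V \<and> q \<in> V \<and> \<rho> p < \<rho> q"
  shows "fold stitch L S = fold stitch L' S"
proof (rule fold_permute [where P = "triangular V \<rho>"])
  fix e e' S assume e: "e \<in> set L" "e' \<in> set L" and S: "triangular V \<rho> S"
  obtain p q p' q' w G where [simp]: "e = (p, q)" "e' = (p', q')" "S = (w, G)" by (metis surj_pair)
  have pq: "p \<in> V" "q \<in> V" "\<rho> p < \<rho> q" "p' \<in> V" "q' \<in> V" "\<rho> p' < \<rho> q'" using e L by auto
  have "1 - snd S p q \<noteq> 0" "1 - snd S p' q' \<noteq> 0" "1 - snd (stitch (p', q') S) p q \<noteq> 0"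
    by (rule triangular_pivot_nonzero [where \<rho> = \<rho> and V = V] stitch_triangular S pq)+
  then show "stitch e (stitch e' S) = stitch e' (stitch e S)"
    using stitch_commute [of G p' q' p q w] by simp
qed (use assms stitch_triangular in fastforce)+

section \<open>Renaming, scaling and restriction of networks\<close>

lemma fold_stitch_reindex:
  "fold stitch L (reindex f g S) = reindex f g (fold stitch (map (map_prod f g) L) S)"
proof (induction L arbitrary: S)
  case (Cons e L)
  obtain p q where e: "e = (p, q)" by fastforce
  have "stitch e (reindex f g S) = reindex f g (stitch (map_prod f g e) S)"
    by (cases S) (simp add: reindex_def e)
  then show ?case by (simp add: Cons.IH)
qed simp

lemma map_links: "map (map_prod f f) (links xs) = links (map f xs)"
  by (simp add: links_def zip_map_map map_tl [symmetric] map_prod_def)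

lemma stitch_strands_rename:
  assumes "[] \<notin> set ss"
  shows "stitch_strands (map (map f) ss) S = stitch_strands ss (reindex f f S)"
proof -
  have "map (map_prod f f) (concat (map links ss)) = concat (map links (map (map f) ss))"
    by (simp add: map_concat map_links o_def)
  moreover have "ss ! i \<noteq> []" if "i < length ss" for i
    using that assms by (metis nth_mem)
  ultimately show ?thesis
    unfolding stitch_strands_def Let_def length_map fold_stitch_reindex
    by (simp add: reindex_def fun_eq_iff last_map hd_map)
qed

lemma fold_stitch_scale: "fold stitch L (c * w, G) = apfst ((*) c) (fold stitch L (w, G))"
proof (induction L arbitrary: w G)
  case (Cons e L)
  then show ?case by (cases e) (simp add: mult.assoc)
qed simp

lemma stitch_strands_scale: "stitch_strands ss (c * w, G) = apfst ((*) c) (stitch_strands ss (w, G))"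
  by (cases "fold stitch (concat (map links ss)) (w, G)") (simp add: stitch_strands_def Let_def fold_stitch_scale fun_eq_iff)

text \<open>Merging leaves junk in the rows and columns of discarded elements, so networks can be
  compared only on the indices that still occur in the strands.\<close>

definition agree :: "'i set \<Rightarrow> 'i network \<Rightarrow> 'i network \<Rightarrow> bool" where
  "agree V S S' \<longleftrightarrow> fst S = fst S' \<and> (\<forall>r\<in>V. \<forall>s\<in>V. snd S r s = snd S' r s)"

lemma fold_stitch_agree:
  assumes "agree V S S'" "set L \<subseteq> V \<times> V"
  shows "agree V (fold stitch L S) (fold stitch L S')"
  using assms
proof (induction L arbitrary: S S')
  case (Cons e L)
  obtain p q where e: "e = (p, q)" by fastforce
  have "agree V (stitch e S) (stitch e S')"
    using Cons.prems unfolding agree_def e by (cases S; cases S') simp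
  then show ?case using Cons by simp
qed simp

lemma links_split: "links (us @ x # vs) = links (us @ [x]) @ links (x # vs)"
proof (induction us)
  case (Cons u us)
  then show ?case by (cases us) (simp_all add: links_def)
qed (simp add: links_def)

lemma links_Cons_Cons [simp]: "links (x # y # vs) = (x, y) # links (y # vs)"
  by (simp add: links_def)

lemma links_single [simp]: "links [x] = []"
  by (simp add: links_def)

lemma set_links_snoc: "set (links (us @ [x])) \<subseteq> set us \<times> set (us @ [x])"
proof (induction us)
  case (Cons u us)
  then show ?case by (cases us) auto
qed simp

lemma set_links: "set (links xs) \<subseteq> set xs \<times> set xs"
  by (cases xs) (auto simp: links_def dest: set_zip_leftD set_zip_rightD)

lemma stitch_strands_cong:
  assumes "agree (set (concat ss)) S S'" "[] \<notin> set ss"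
  shows "stitch_strands ss S = stitch_strands ss S'"
proof -
  have "set (concat (map links ss)) \<subseteq> set (concat ss) \<times> set (concat ss)"
    using set_links by fastforce
  then have "agree (set (concat ss)) (fold stitch (concat (map links ss)) S) (fold stitch (concat (map links ss)) S')"
    using assms(1) by (intro fold_stitch_agree)
  moreover have "last (ss ! i) \<in> set (concat ss) \<and> hd (ss ! i) \<in> set (concat ss)" if "i < length ss" for i
    using that assms(2) nth_mem [OF that] by (metis hd_in_set last_in_set in_set_conv_nth nth_mem UN_I set_concat)
  ultimately show ?thesis
    unfolding stitch_strands_def Let_def agree_def by (simp add: fun_eq_iff del: set_concat)
qed

section \<open>Elimination of a single link\<close>

definition adjacent :: "'i list list \<Rightarrow> 'i \<Rightarrow> 'i \<Rightarrow> bool" where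
  "adjacent ss x y \<longleftrightarrow> (\<exists>xs\<in>set ss. \<exists>us vs. xs = us @ x # y # vs)"

lemma in_set_links: "(x, y) \<in> set (links xs) \<longleftrightarrow> (\<exists>us vs. xs = us @ x # y # vs)"
proof
  assume "(x, y) \<in> set (links xs)"
  then show "\<exists>us vs. xs = us @ x # y # vs"
  proof (induction xs rule: induct_list012)
    case (3 a b xs)
    then consider "x = a" "y = b" | us vs where "b # xs = us @ x # y # vs" by auto
    then show ?case
    proof cases
      case 1
      then show ?thesis by (metis append_Nil)
    next
      case 2
      then show ?thesis by (metis append_Cons)
    qed
  qed (simp_all add: links_def)
next
  assume "\<exists>us vs. xs = us @ x # y # vs"
  then obtain us vs where "xs = us @ x # y # vs" by blast
  then show "(x, y) \<in> set (links xs)"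
    by (simp only: links_split [of us x "y # vs"]) simp
qed

text \<open>The rank of an element is its position in the concatenation of all strands.\<close>

lemma ex_rank:
  assumes "distinct (concat ss)"
  shows "\<exists>\<rho>::'i \<Rightarrow> nat. \<forall>x y. adjacent ss x y \<longrightarrow> \<rho> x < \<rho> y"
proof (intro exI allI impI)
  fix x y assume "adjacent ss x y"
  then obtain us vs xs where xs: "xs \<in> set ss" "xs = us @ x # y # vs"
    by (auto simp: adjacent_def)
  then obtain A B where ss: "ss = A @ xs # B" by (meson split_list)
  define cs where "cs = concat A @ us"
  have c: "concat ss = cs @ x # y # (vs @ concat B)" by (simp add: cs_def ss xs)
  have d: "x \<notin> set cs" "y \<notin> set cs" "x \<noteq> y" using assms by (auto simp: c)
  then have t: "takeWhile (\<lambda>z. z \<noteq> x) (cs @ x # l) = cs" "takeWhile (\<lambda>z. z \<noteq> y) (cs @ x # y # l) = cs @ [x]" for l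
    by (subst takeWhile_append2; auto)+
  show "length (takeWhile (\<lambda>z. z \<noteq> x) (concat ss)) < length (takeWhile (\<lambda>z. z \<noteq> y) (concat ss))"
    by (simp add: c t)
qed

text \<open>All links raise the rank, so the link from \<open>x\<close> to \<open>y\<close> can be
  moved to the front. Once it is made, \<open>x\<close> continues with the output of
  \<open>y\<close>: links that used to leave \<open>y\<close> now leave \<open>x\<close>. This is
  why \<open>\<tau>\<close> acts on the first components of links only.\<close>

lemma stitch_strands_merge:
  assumes adj: "adjacent ss x y" and dist: "distinct (concat ss)"
    and near: "near_identity (set (concat ss)) S" and ne: "[] \<notin> set ss"
  shows "stitch_strands ss S = stitch_strands (map (filter (\<lambda>z. z \<noteq> y)) ss) (merge x y S)"
proof -
  obtain us vs A B where ss: "ss = A @ (us @ x # y # vs) # B"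
    using adj unfolding adjacent_def by (metis split_list)
  define \<tau> where "\<tau> = id(x := y)"
  let ?F = "filter (\<lambda>z. z \<noteq> y)"
  have dis: "x \<noteq> y" "x \<notin> set us" "y \<notin> set us" "x \<notin> set vs" "y \<notin> set vs" "distinct us" "distinct vs"
    using dist by (auto simp: ss)
  have other: "x \<notin> set xs \<and> y \<notin> set xs" if "xs \<in> set A \<union> set B" for xs
    using that dist by (auto simp: ss)
  have F: "?F xs = xs" if "y \<notin> set xs" for xs
    using that by (induction xs) auto
  have F_other: "?F xs = xs" if "xs \<in> set A \<union> set B" for xs
    using other [OF that] by (simp add: F)
  have F_self: "?F (us @ x # y # vs) = us @ x # vs"
    using dis by (simp add: F)
  have mapF: "map ?F ss = A @ (us @ x # vs) # B"
    using F_other F_self by (simp add: ss map_idI)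
  have fix1: "map (map_prod \<tau> id) L = L" if "x \<notin> fst ` set L" for L
    using that by (intro map_idI) (force simp: \<tau>_def)
  have fix2: "map (map_prod \<tau> id) (links xs) = links xs" if "xs \<in> set A \<union> set B" for xs
    using other [OF that] set_links [of xs] by (intro fix1) auto
  \<comment> \<open>Here \<open>x\<close> occurs only as a target, and targets are not
    renamed.\<close>
  have fix3: "map (map_prod \<tau> id) (links (us @ [x])) = links (us @ [x])"
    using dis set_links_snoc [of us x] by (intro fix1) auto
  have fix4: "map (map_prod \<tau> id) (links (x # vs)) = links (y # vs)"
  proof (cases vs)
    case (Cons v vs')
    then show ?thesis
      using dis set_links [of vs] by (simp, intro conjI fix1) (auto simp: \<tau>_def)
  qed simp
  have "map (map_prod \<tau> id) (concat (map links (map ?F ss))) =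
      concat (map links A) @ (links (us @ [x]) @ links (y # vs)) @ concat (map links B)"
    using fix2 by (simp add: mapF map_concat links_split [of us x vs] fix3 fix4 o_def cong: map_cong)
  moreover have "concat (map links ss) =
      concat (map links A) @ (links (us @ [x]) @ (x, y) # links (y # vs)) @ concat (map links B)"
    by (simp add: ss links_split [of us x "y # vs"])
  ultimately have perm: "mset (concat (map links ss)) =
      mset ((x, y) # map (map_prod \<tau> id) (concat (map links (map ?F ss))))"
    by simp
  obtain \<rho> :: "'a \<Rightarrow> nat" where \<rho>: "\<And>p q. adjacent ss p q \<Longrightarrow> \<rho> p < \<rho> q"
    using ex_rank [OF dist] by blast
  have "fold stitch (concat (map links ss)) S =
      fold stitch ((x, y) # map (map_prod \<tau> id) (concat (map links (map ?F ss)))) S"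
  proof (rule fold_stitch_permute [OF perm near_identity_triangular [OF near]])
    fix p q assume "(p, q) \<in> set (concat (map links ss))"
    then obtain xs where xs: "xs \<in> set ss" "(p, q) \<in> set (links xs)" by auto
    then have "adjacent ss p q" by (auto simp: in_set_links adjacent_def)
    then show "p \<in> set (concat ss) \<and> q \<in> set (concat ss) \<and> \<rho> p < \<rho> q"
      using xs set_links [of xs] \<rho> by auto
  qed
  then have "fold stitch (concat (map links (map ?F ss))) (merge x y S) =
      reindex \<tau> id (fold stitch (concat (map links ss)) S)"
    by (simp only: merge_def \<tau>_def [symmetric] fold_stitch_reindex fold.simps o_apply)
  \<comment> \<open>A strand that ended in \<open>y\<close> ends in \<open>x\<close> after the
    deletion, and \<open>\<tau>\<close> turns this back into \<open>y\<close>. The first element of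
    a strand is never \<open>y\<close>.\<close>
  moreover have "\<tau> (last (?F xs)) = last xs \<and> hd (?F xs) = hd xs" if "xs \<in> set ss" for xs
  proof (cases "xs \<in> set A \<union> set B")
    case True
    then show ?thesis
      using F_other [OF True] other [OF True] that ne by (cases "xs = []") (auto simp: \<tau>_def)
  next
    case False
    then have xs: "xs = us @ x # y # vs" using that ss by auto
    show ?thesis
      using dis last_in_set [of vs] unfolding xs F_self by (cases "vs = []") (auto simp: \<tau>_def hd_append)
  qed
  ultimately show ?thesis
    by (auto simp: stitch_strands_def Let_def fun_eq_iff reindex_def)
qed

lemma merge_simps:
  "fst (merge x y (w, G)) = w * (1 - G x y)"
  "snd (merge x y (w, G)) r s =
     G (if r = x then y else r) s + G (if r = x then y else r) y * G x s / (1 - G x y)"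
  by (simp_all add: merge_def reindex_def)

text \<open>Unlike a mere stitch, a merge restores closeness to the identity: the new diagonal entry
  at \<open>x\<close> is G y x + G y y * G x x / (1 - G x y), which has the value 0 + 1 at the base
  point.\<close>

lemma merge_near_identity:
  assumes S: "near_identity V S" and xy: "x \<in> V" "y \<in> V" "x \<noteq> y"
  shows "near_identity (V - {y}) (merge x y S)"
proof -
  obtain w G where [simp]: "S = (w, G)" by fastforce
  have one: "G r r - 1 \<in> vanishing" if "r \<in> V" for r
    using near_identityD(1) [OF S that that] by simp
  have zero: "G r s \<in> vanishing" if "r \<in> V" "s \<in> V" "r \<noteq> s" for r s
    using near_identityD(2) [OF S that] by simp
  have reg: "G r s \<in> regular" if "r \<in> V" "s \<in> V" for r s
    using near_identityD(3) [OF S that] by simp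
  have piv: "(1 - G x y) - 1 \<in> vanishing"
    using zero [OF xy] by (rule pivot_near_one)
  have "snd (merge x y S) r s - (if r = s then 1 else 0) \<in> vanishing"
    if rs: "r \<in> V - {y}" "s \<in> V - {y}" for r s
  proof -
    consider "r = x" "s = x" | "r = x" "s \<noteq> x" | "r \<noteq> x" by blast
    then show ?thesis
    proof cases
      case 1
      have "G y x + (G y y * G x x / (1 - G x y) - 1) \<in> vanishing"
        by (intro vanishing_add near_one_divide near_one_mult zero one piv) (use xy in auto)
      then show ?thesis using 1 by (simp add: merge_simps add_diff_eq)
    next
      case 2
      have "G y s + G y y * G x s / (1 - G x y) \<in> vanishing"
        by (intro vanishing_add vanishing_divide vanishing_mult_left reg zero piv) (use 2 xy rs in auto)
      then show ?thesis using 2 by (simp add: merge_simps)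
    next
      case 3
      have "(G r s - (if r = s then 1 else 0)) + G r y * G x s / (1 - G x y) \<in> vanishing"
        by (intro vanishing_add vanishing_divide vanishing_mult_right reg zero piv)
          (use 3 xy rs S in \<open>auto simp: near_identity_def\<close>)
      then show ?thesis using 3 by (simp add: merge_simps algebra_simps)
    qed
  qed
  then show ?thesis by (auto simp: near_identity_def)
qed

lemma adjacentD:
  assumes "adjacent ss x y" "distinct (concat ss)"
  shows "x \<in> set (concat ss)" "y \<in> set (concat ss)" "x \<noteq> y"
proof -
  obtain us vs A B where ss: "ss = A @ (us @ x # y # vs) # B"
    using assms(1) unfolding adjacent_def by (metis split_list)
  show "x \<in> set (concat ss)" "y \<in> set (concat ss)" "x \<noteq> y"
    using assms(2) by (auto simp: ss)
qed

lemma adjacent_nonempty_filter: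
  assumes "adjacent ss x y" "distinct (concat ss)" "[] \<notin> set ss"
  shows "[] \<notin> set (map (filter (\<lambda>z. z \<noteq> y)) ss)"
proof
  obtain us vs A B where ss: "ss = A @ (us @ x # y # vs) # B"
    using assms(1) unfolding adjacent_def by (metis split_list)
  assume "[] \<in> set (map (filter (\<lambda>z. z \<noteq> y)) ss)"
  then obtain xs where xs: "xs \<in> set ss" "filter (\<lambda>z. z \<noteq> y) xs = []" by auto
  then have sub: "set xs \<subseteq> {y}" by (auto simp: filter_empty_conv)
  have "xs \<noteq> us @ x # y # vs" using sub assms(2) by (auto simp: ss)
  then have "y \<notin> set xs" using xs(1) assms(2) by (auto simp: ss)
  then have "xs = []" using sub by (cases xs) auto
  then show False using xs(1) assms(3) by simp
qed

lemma set_concat_filter: "set (concat (map (filter P) ss)) = {z \<in> set (concat ss). P z}"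
  by auto

lemma distinct_concat_filter: "distinct (concat ss) \<Longrightarrow> distinct (concat (map (filter P) ss))"
  by (metis distinct_filter filter_concat)

lemma adjacent_filter:
  assumes "adjacent ss x y" "P x" "P y"
  shows "adjacent (map (filter P) ss) x y"
proof -
  obtain xs us vs where xs: "xs \<in> set ss" "xs = us @ x # y # vs"
    using assms(1) by (auto simp: adjacent_def)
  then have "filter P xs = filter P us @ x # y # filter P vs" using assms by simp
  then show ?thesis using xs(1) unfolding adjacent_def by force
qed

definition identity_at :: "'i set \<Rightarrow> 'i \<Rightarrow> 'i network \<Rightarrow> bool" where
  "identity_at V e S \<longleftrightarrow> snd S e e = 1 \<and> (\<forall>r\<in>V - {e}. snd S r e = 0 \<and> snd S e r = 0)"

text \<open>The element \<open>e\<close> is merged into its predecessor \<open>w\<close>. The pivot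
  is 1, and the identity row of \<open>e\<close> returns the old row of \<open>w\<close>, so nothing
  changes away from \<open>e\<close>.\<close>

lemma stitch_strands_delete:
  assumes xs: "xs \<in> set ss" "e \<in> set xs" "e \<noteq> hd xs"
    and dist: "distinct (concat ss)" and near: "near_identity (set (concat ss)) S"
    and e: "identity_at (set (concat ss)) e S"
    and ne: "[] \<notin> set ss"
  shows "stitch_strands ss S = stitch_strands (map (filter (\<lambda>z. z \<noteq> e)) ss) S"
proof -
  obtain us vs where us: "xs = us @ e # vs" using xs(2) by (meson split_list)
  then obtain us' w where "us = us' @ [w]" using xs(3) by (cases us rule: rev_cases) auto
  then have adj: "adjacent ss w e" using us xs(1) by (auto simp: adjacent_def)
  note w = adjacentD [OF adj dist]
  obtain c G where [simp]: "S = (c, G)" by fastforce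
  have "agree (set (concat ss) - {e}) (merge w e S) S"
    using e w unfolding agree_def identity_at_def by (auto simp: merge_simps)
  moreover have "set (concat (map (filter (\<lambda>z. z \<noteq> e)) ss)) = set (concat ss) - {e}"
    by auto
  moreover have "[] \<notin> set (map (filter (\<lambda>z. z \<noteq> e)) ss)"
    by (rule adjacent_nonempty_filter [OF adj dist ne])
  ultimately show ?thesis
    unfolding stitch_strands_merge [OF adj dist near ne]
    by (intro stitch_strands_cong) simp_all
qed

section \<open>The multiplication of labels as a stitching\<close>

text \<open>The map \<open>f\<close> is a pending renaming. Changes of variables made by later
  multiplications are collected in it, so that the networks of all stages are compared over the same
  variables.\<close>

definition beta_network :: "(label \<Rightarrow> label) \<Rightarrow> beta \<Rightarrow> label network" where
  "beta_network f A = (change_vars f (corner A),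
     \<lambda>t h. (if t = h then 1 + change_vars f (col_sum A h) else 0) - change_vars f (entry A t h))"

definition admissible :: "label set \<Rightarrow> beta \<Rightarrow> bool" where
  "admissible V A \<longleftrightarrow> heads A = V \<and> tails A = V \<and> finite V \<and> corner A \<in> regular \<and>
     (\<forall>t\<in>V. \<forall>h\<in>V. entry A t h \<in> vanishing)"

lemma admissible_col_sum: "admissible V A \<Longrightarrow> h \<in> V \<Longrightarrow> col_sum A h \<in> vanishing"
  unfolding admissible_def col_sum_def by (auto intro: vanishing_sum)

lemma admissible_near_identity:
  assumes "admissible V A"
  shows "near_identity V (beta_network f A)"
proof -
  have "(if r = s then 1 + change_vars f (col_sum A s) else 0) - change_vars f (entry A r s)
      - (if r = s then 1 else 0) \<in> vanishing" if "r \<in> V" "s \<in> V" for r s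
  proof -
    have "change_vars f (entry A r s) \<in> vanishing" "change_vars f (col_sum A s) \<in> vanishing"
      using assms that admissible_col_sum [OF assms that(2)]
      by (auto simp: admissible_def change_vars_vanishing)
    then show ?thesis by (auto intro: vanishing_diff vanishing_uminus)
  qed
  then show ?thesis by (simp add: near_identity_def beta_network_def)
qed

text \<open>Since \<epsilon> plus the sum of the column \<open>y\<close> outside row
  \<open>x\<close> is 1 + \<open>col_sum A y\<close>, the factor in row \<open>x\<close> equals (1 +
  \<open>col_sum A y\<close>) / \<epsilon>. With this form the change in row \<open>x\<close>
  exactly compensates the changes in the other rows, and all column sums are preserved.\<close>

lemma sw_admissible:
  assumes A: "admissible V A" and xy: "x \<in> V" "y \<in> V" "x \<noteq> y"
  defines "B \<equiv> sw x y A" and "\<epsilon> \<equiv> 1 + entry A x y"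
  shows "admissible V B" "corner B = corner A * \<epsilon>" "\<epsilon> - 1 \<in> vanishing"
    and "\<And>h. entry B x h = entry A x h * (1 + col_sum A y) / \<epsilon>"
    and "\<And>t. t \<noteq> x \<Longrightarrow> entry B t y = entry A t y / \<epsilon>"
    and "\<And>t h. t \<noteq> x \<Longrightarrow> h \<noteq> y \<Longrightarrow> entry B t h = entry A t h - entry A t y * entry A x h / \<epsilon>"
    and "\<And>h. col_sum B h = col_sum A h"
proof -
  have V: "heads A = V" "tails A = V" "finite V" "corner A \<in> regular"
    and van: "\<And>t h. t \<in> V \<Longrightarrow> h \<in> V \<Longrightarrow> entry A t h \<in> vanishing"
    using A by (auto simp: admissible_def)
  show eps: "\<epsilon> - 1 \<in> vanishing"
    using van [OF xy(1,2)] by (simp add: \<epsilon>_def)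
  then have nz: "\<epsilon> \<noteq> 0" by (rule near_one_nonzero)
  have rest: "(\<Sum>t\<in>V - {x}. entry A t h) = col_sum A h - entry A x h" for h
    using V xy(1) by (simp add: col_sum_def sum_diff1)
  have "1 + (\<Sum>t\<in>tails A - {x}. entry A t y) / \<epsilon> = (1 + col_sum A y) / \<epsilon>"
    using nz by (simp add: V rest field_simps \<epsilon>_def)
  then show Bx: "entry B x h = entry A x h * (1 + col_sum A y) / \<epsilon>" for h
    by (simp add: B_def sw_def \<epsilon>_def Let_def)
  show By: "entry B t y = entry A t y / \<epsilon>" if "t \<noteq> x" for t
    using that by (simp add: B_def sw_def \<epsilon>_def Let_def)
  show Bth: "entry B t h = entry A t h - entry A t y * entry A x h / \<epsilon>" if "t \<noteq> x" "h \<noteq> y" for t h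
    using that by (simp add: B_def sw_def \<epsilon>_def Let_def)
  show corner: "corner B = corner A * \<epsilon>"
    by (simp add: B_def sw_def \<epsilon>_def Let_def)
  have tails: "heads B = V" "tails B = V"
    by (simp_all add: B_def sw_def \<epsilon>_def Let_def V)
  have c: "1 + col_sum A y \<in> regular"
    using admissible_col_sum [OF A xy(2)] by (simp add: regular_add vanishing_regular)
  have "entry B t h \<in> vanishing" if "t \<in> V" "h \<in> V" for t h
  proof -
    consider "t = x" | "t \<noteq> x" "h = y" | "t \<noteq> x" "h \<noteq> y" by blast
    then show ?thesis
    proof cases
      case 1
      then show ?thesis
        unfolding 1 Bx by (intro vanishing_divide vanishing_mult_right van c eps xy that)
    next
      case 2
      then show ?thesis using By that eps van by (simp add: vanishing_divide)
    next
      case 3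
      have "entry A t h - entry A t y * entry A x h / \<epsilon> \<in> vanishing"
        by (intro vanishing_diff vanishing_divide vanishing_mult_right vanishing_regular van eps xy that)
      then show ?thesis using Bth 3 by simp
    qed
  qed
  moreover have "\<epsilon> \<in> regular"
    using eps by (rule near_one_regular)
  ultimately show "admissible V B"
    using V by (simp add: admissible_def tails corner regular_mult)
  show "col_sum B h = col_sum A h" for h
  proof -
    have "col_sum B h = entry B x h + (\<Sum>t\<in>V - {x}. entry B t h)"
      using V xy(1) by (simp add: col_sum_def tails sum.remove)
    also have "\<dots> = col_sum A h"
    proof (cases "h = y")
      case True
      have "(\<Sum>t\<in>V - {x}. entry B t h) = (\<Sum>t\<in>V - {x}. entry A t y / \<epsilon>)"
        using By True by (intro sum.cong) auto
      also have "\<dots> = (col_sum A y - entry A x y) / \<epsilon>"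
        by (simp add: sum_divide_distrib [symmetric] rest)
      finally show ?thesis using nz True by (simp add: Bx field_simps \<epsilon>_def)
    next
      case False
      have "(\<Sum>t\<in>V - {x}. entry B t h) =
          (\<Sum>t\<in>V - {x}. entry A t h - entry A t y * (entry A x h / \<epsilon>))"
        using Bth False by (intro sum.cong) auto
      also have "\<dots> = (col_sum A h - entry A x h) - (col_sum A y - entry A x y) * (entry A x h / \<epsilon>)"
        by (simp only: sum_subtractf sum_distrib_right [symmetric] rest)
      finally have "entry B x h + (\<Sum>t\<in>V - {x}. entry B t h) =
          col_sum A h + entry A x h * ((1 + entry A x y) / \<epsilon> - 1)"
        by (simp add: Bx add_divide_distrib algebra_simps)
      then show ?thesis using nz by (simp add: \<epsilon>_def)
    qed
    finally show ?thesis .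
  qed
qed

text \<open>The substitution inside \<open>tm\<close> followed by \<open>f\<close> is
  \<open>g\<close>, so the change of variables can be carried out before the multiplication. The
  column formula of \<open>hm\<close> says that the numbers 1 + c multiply, and the pivot
  \<open>1 - G x y\<close> is the \<epsilon> of \<open>sw\<close>.\<close>

lemma gm_merge:
  fixes f :: "label \<Rightarrow> label"
  assumes A: "admissible V A" and xy: "x \<in> V" "y \<in> V" "x \<noteq> y"
  defines "A' \<equiv> gm x y x A" and "g \<equiv> f \<circ> id(y := x)"
  shows "admissible (V - {y}) A'"
    and "agree (V - {y}) (beta_network f A') (merge x y (beta_network g A))"
    and "1 + change_vars f (col_sum A' x) =
      (1 + change_vars g (col_sum A x)) * (1 + change_vars g (col_sum A y))"
    and "\<And>h. h \<in> V - {x, y} \<Longrightarrow> change_vars f (col_sum A' h) = change_vars g (col_sum A h)"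
proof -
  define \<sigma> where "\<sigma> = id(y := x)"
  have \<sigma>: "id(x := x, y := x) = \<sigma>" by (auto simp: \<sigma>_def)
  define B where "B = sw x y A"
  define \<epsilon> where "\<epsilon> = 1 + entry A x y"
  note sw = sw_admissible [OF A xy, folded B_def \<epsilon>_def]
  define C where "C = tm x y x B"
  have V: "heads A = V" "tails A = V" "finite V" "corner A \<in> regular"
    and vanA: "\<And>t h. t \<in> V \<Longrightarrow> h \<in> V \<Longrightarrow> entry A t h \<in> vanishing"
    using A by (auto simp: admissible_def)
  have B: "heads B = V" "tails B = V" "corner B \<in> regular"
    and vanB: "\<And>t h. t \<in> V \<Longrightarrow> h \<in> V \<Longrightarrow> entry B t h \<in> vanishing"
    using sw(1) by (auto simp: admissible_def)
  note regA = vanishing_regular [OF vanA] and regB = vanishing_regular [OF vanB]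
  have ins: "insert x (V - {x, y}) = V - {y}" using xy by auto
  have C: "heads C = V" "tails C = V - {y}" "corner C = change_vars \<sigma> (corner B)"
    and Cx: "\<And>h. entry C x h = change_vars \<sigma> (entry B x h + entry B y h)"
    and Ct: "\<And>t h. t \<noteq> x \<Longrightarrow> t \<noteq> y \<Longrightarrow> entry C t h = change_vars \<sigma> (entry B t h)"
    by (simp_all add: C_def tm_def Let_def \<sigma> B ins)
  have A'_eq: "A' = hm x y x C" by (simp add: A'_def gm_def C_def B_def)
  have A': "heads A' = V - {y}" "tails A' = V - {y}" "corner A' = corner C"
    and A'x: "\<And>t. entry A' t x = entry C t x + entry C t y + col_sum C x * entry C t y"
    and A'h: "\<And>t h. h \<noteq> x \<Longrightarrow> h \<noteq> y \<Longrightarrow> entry A' t h = entry C t h"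
    by (simp_all add: A'_eq hm_def C ins)
  have vanC: "entry C t h \<in> vanishing" if "t \<in> V - {y}" "h \<in> V" for t h
    using that vanB xy by (cases "t = x") (auto simp: Cx Ct intro!: change_vars_vanishing vanishing_add)
  note regC = vanishing_regular [OF vanC]
  have regcA: "col_sum A h \<in> regular" if "h \<in> V" for h
    using admissible_col_sum [OF A that] by (rule vanishing_regular)
  have sumC: "col_sum C h = change_vars \<sigma> (col_sum A h)" if "h \<in> V" for h
  proof -
    have "col_sum C h = entry C x h + (\<Sum>t\<in>V - {y} - {x}. entry C t h)"
      using V xy by (simp add: col_sum_def C sum.remove)
    also have "(\<Sum>t\<in>V - {y} - {x}. entry C t h) = (\<Sum>t\<in>V - {y} - {x}. change_vars \<sigma> (entry B t h))"
      using Ct by (intro sum.cong) auto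
    also have "entry C x h + \<dots> = change_vars \<sigma> (entry B y h)
        + (change_vars \<sigma> (entry B x h) + (\<Sum>t\<in>V - {y} - {x}. change_vars \<sigma> (entry B t h)))"
      using regB xy that by (simp add: Cx change_vars_add)
    also have "\<dots> = (\<Sum>t\<in>V. change_vars \<sigma> (entry B t h))"
      using V xy by (simp add: sum.remove [of V y] sum.remove [of "V - {y}" x])
    also have "\<dots> = change_vars \<sigma> (col_sum B h)"
      using regB that change_vars_sum [of V "\<lambda>t. entry B t h" \<sigma>] by (simp add: col_sum_def B)
    finally show ?thesis using sw(7) by simp
  qed
  have sumA': "col_sum A' h = change_vars \<sigma> (col_sum A h)" if "h \<in> V - {x, y}" for h
    using that sumC [of h] A'h by (simp add: col_sum_def A' C)
  have sumA'x: "col_sum A' x = col_sum C x + col_sum C y + col_sum C x * col_sum C y"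
    by (simp add: col_sum_def A' C A'x sum.distrib sum_distrib_left)
  have regcC: "col_sum C h \<in> regular" if "h \<in> V" for h
    using sumC regcA that by (simp add: change_vars_regular)
  have "entry A' t h \<in> vanishing" if "t \<in> V - {y}" "h \<in> V - {y}" for t h
  proof (cases "h = x")
    case True
    have "entry C t x + entry C t y + col_sum C x * entry C t y \<in> vanishing"
      by (intro vanishing_add vanishing_mult_left vanC regcC that xy)
    then show ?thesis using True A'x by simp
  next
    case False
    then show ?thesis using that vanC A'h by simp
  qed
  then show "admissible (V - {y}) A'"
    using V B by (simp add: admissible_def A' C change_vars_regular)

  have g: "change_vars f (change_vars \<sigma> z) = change_vars g z" if "z \<in> regular" for z
    using that by (simp add: change_vars_comp g_def \<sigma>_def)
  define c where "c h = change_vars g (col_sum A h)" for h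
  define a where "a t h = change_vars g (entry A t h)" for t h
  define e where "e = 1 + a x y"
  have fC: "change_vars f (col_sum C h) = c h" if "h \<in> V" for h
    using that sumC regcA g by (simp add: c_def)
  show "change_vars f (col_sum A' h) = change_vars g (col_sum A h)" if "h \<in> V - {x, y}" for h
    using that sumA' regcA g by simp
  have cx: "1 + change_vars f (col_sum A' x) = (1 + c x) * (1 + c y)"
    using xy regcC by (simp add: sumA'x change_vars_add change_vars_mult regular_add regular_mult fC algebra_simps)
  then show "1 + change_vars f (col_sum A' x) =
      (1 + change_vars g (col_sum A x)) * (1 + change_vars g (col_sum A y))"
    by (simp add: c_def)
  have e: "change_vars g \<epsilon> = e"
    using regA xy by (simp add: \<epsilon>_def e_def a_def change_vars_add)
  have "e - 1 \<in> vanishing"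
    using change_vars_near_one [OF sw(3), of g] by (simp add: e)
  then have e0: "e \<noteq> 0" by (rule near_one_nonzero)
  have bx: "change_vars g (entry B x h) = a x h * (1 + c y) / e" if "h \<in> V" for h
    using regA xy that regcA sw(3)
    by (simp add: sw(4) change_vars_divide change_vars_mult change_vars_add regular_mult regular_add a_def c_def e)
  have bty: "change_vars g (entry B t y) = a t y / e" if "t \<in> V" "t \<noteq> x" for t
    using regA xy that sw(3) by (simp add: sw(5) change_vars_divide a_def e)
  have bth: "change_vars g (entry B t h) = a t h - a t y * a x h / e"
    if "t \<in> V" "t \<noteq> x" "h \<in> V" "h \<noteq> y" for t h
    using regA xy that sw(3)
    by (simp add: sw(6) change_vars_divide change_vars_mult change_vars_diff regular_mult regular_divide a_def e)
  have fCx: "change_vars f (entry C x h) = change_vars g (entry B x h) + change_vars g (entry B y h)"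
    if "h \<in> V" for h
    using regB xy that by (simp add: Cx g change_vars_add change_vars_regular)
  have fCt: "change_vars f (entry C t h) = change_vars g (entry B t h)"
    if "t \<in> V" "t \<noteq> x" "t \<noteq> y" "h \<in> V" for t h
    using regB that by (simp add: Ct g)
  have fA'x: "change_vars f (entry A' t x) = change_vars f (entry C t x) + (1 + c x) * change_vars f (entry C t y)"
    if "t \<in> V - {y}" for t
    using that xy regC regcC
    by (simp add: A'x change_vars_add change_vars_mult regular_add regular_mult fC algebra_simps)
  have corner: "change_vars f (corner A') = change_vars g (corner A) * e"
    using V B sw(3) g [of "corner B"] by (simp add: A' C sw(2) change_vars_mult near_one_regular e)
  have "snd (beta_network f A') r s = snd (merge x y (beta_network g A)) r s"
    if rs: "r \<in> V - {y}" "s \<in> V - {y}" for r s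
  proof -
    consider "r = x" "s = x" | "r = x" "s \<noteq> x" | "r \<noteq> x" "s = x" | "r \<noteq> x" "s \<noteq> x" by blast
    then show ?thesis
    proof cases
      case 1
      \<comment> \<open>Clearing the denominator \<open>e\<close> does not finish this identity: it
        also depends on \<open>e\<close> being 1 + \<open>a x y\<close>, which is unfolded only
        afterwards.\<close>
      have "(1 + c x) * (1 + c y) - (a x x * (1 + c y) / e + (a y x - a y y * a x x / e)
          + (1 + c x) * (a x y * (1 + c y) / e + a y y / e)) =
          - a y x + (1 + c y - a y y) * (1 + c x - a x x) / e"
        using e0 by (simp add: field_simps) (simp add: e_def algebra_simps)
      then show ?thesis
        using xy 1 rs by (simp add: beta_network_def merge_simps fA'x fCx bx bty bth cx
            c_def [symmetric] a_def [symmetric] e_def)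
    next
      case 2
      have "- (a x s * (1 + c y) / e + (a y s - a y y * a x s / e)) =
          - a y s + (1 + c y - a y y) * (- a x s) / e"
        using e0 by (simp add: field_simps)
      then show ?thesis
        using xy 2 rs by (simp add: beta_network_def merge_simps A'h fCx bx bty bth
            c_def [symmetric] a_def [symmetric] e_def)
    next
      case 3
      have "- ((a r x - a r y * a x x / e) + (1 + c x) * (a r y / e)) =
          - a r x + - a r y * (1 + c x - a x x) / e"
        using e0 by (simp add: field_simps)
      then show ?thesis
        using xy 3 rs by (simp add: beta_network_def merge_simps fA'x fCt bx bty bth
            c_def [symmetric] a_def [symmetric] e_def)
    next
      case 4
      then show ?thesis
        using xy rs sumA' regcA g by (simp add: beta_network_def merge_simps A'h fCt bth
            c_def [symmetric] a_def [symmetric] e_def)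
    qed
  qed
  moreover have "fst (beta_network f A') = fst (merge x y (beta_network g A))"
    using xy by (simp add: beta_network_def merge_simps corner e_def a_def)
  ultimately show "agree (V - {y}) (beta_network f A') (merge x y (beta_network g A))"
    by (simp add: agree_def)
qed

section \<open>Sequences of multiplications\<close>

abbreviation drop_elem :: "'i \<Rightarrow> 'i list list \<Rightarrow> 'i list list" where
  "drop_elem y \<equiv> map (filter (\<lambda>z. z \<noteq> y))"

fun collapsible :: "'i list list \<Rightarrow> ('i \<times> 'i) list \<Rightarrow> bool" where
  "collapsible ss [] \<longleftrightarrow> True"
| "collapsible ss ((x, y) # ms) \<longleftrightarrow> adjacent ss x y \<and> collapsible (drop_elem y ss) ms"

abbreviation merges :: "('i \<times> 'i) list \<Rightarrow> 'i network \<Rightarrow> 'i network" where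
  "merges \<equiv> fold (\<lambda>(x, y). merge x y)"

abbreviation drop_elems :: "'i set \<Rightarrow> 'i list list \<Rightarrow> 'i list list" where
  "drop_elems Y \<equiv> map (filter (\<lambda>z. z \<notin> Y))"

lemma drop_elems_drop_elem: "drop_elems Y (drop_elem y ss) = drop_elems (insert y Y) ss"
  by (simp add: conj_commute)

lemma merge_agree:
  assumes "agree V S S'" "x \<in> V" "y \<in> V"
  shows "agree (V - {y}) (merge x y S) (merge x y S')"
proof -
  obtain w G w' G' where "S = (w, G)" "S' = (w', G')" by fastforce
  then show ?thesis using assms by (auto simp: agree_def merge_simps)
qed

lemma stitch_strands_merges:
  assumes "collapsible ss ms" "distinct (concat ss)" "near_identity (set (concat ss)) S" "[] \<notin> set ss"
  shows "stitch_strands ss S = stitch_strands (drop_elems (snd ` set ms) ss) (merges ms S) \<and>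
    near_identity (set (concat ss) - snd ` set ms) (merges ms S) \<and> [] \<notin> set (drop_elems (snd ` set ms) ss)"
  using assms
proof (induction ms arbitrary: ss S)
  case Nil
  then show ?case by (simp add: filter_True cong: map_cong)
next
  case (Cons m ms)
  obtain x y where m: "m = (x, y)" by fastforce
  have adj: "adjacent ss x y" and coll: "collapsible (drop_elem y ss) ms"
    using Cons.prems(1) by (auto simp: m)
  note xy = adjacentD [OF adj Cons.prems(2)]
  have V: "set (concat (drop_elem y ss)) = set (concat ss) - {y}" by auto
  have "near_identity (set (concat (drop_elem y ss))) (merge x y S)"
    unfolding V using Cons.prems(3) xy by (rule merge_near_identity)
  from Cons.IH [OF coll distinct_concat_filter [OF Cons.prems(2)] this
      adjacent_nonempty_filter [OF adj Cons.prems(2,4)]]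
  show ?case
    using stitch_strands_merge [OF adj Cons.prems(2-4)]
    unfolding V drop_elems_drop_elem m Diff_insert2 [symmetric] by simp
qed

lemma collapsible_append:
  "collapsible ss (ms @ ns) \<longleftrightarrow> collapsible ss ms \<and> collapsible (drop_elems (snd ` set ms) ss) ns"
proof (induction ms arbitrary: ss)
  case (Cons m ms)
  then show ?case
    by (cases m) (simp del: map_map filter_filter add: drop_elems_drop_elem)
qed (simp add: filter_True cong: map_cong)

text \<open>After \<open>k\<close> has absorbed its successor, the next label becomes the successor
  of \<open>k\<close>. So multiplying always into the first label merges neighbours at every
  stage.\<close>

lemma collapsible_strand:
  assumes "k # ls \<in> set ss" "distinct (concat ss)"
  shows "collapsible ss (map (Pair k) ls)"
  using assms
proof (induction ls arbitrary: ss)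
  case (Cons l ls)
  obtain A B where ss: "ss = A @ (k # l # ls) # B"
    using Cons.prems(1) by (meson split_list)
  have "filter (\<lambda>z. z \<noteq> l) (k # l # ls) = k # ls"
    using Cons.prems(2) by (auto simp: ss filter_id_conv)
  then have "k # ls \<in> set (drop_elem l ss)"
    by (simp add: ss)
  moreover have "adjacent ss k l"
    using Cons.prems(1) unfolding adjacent_def by (metis append_Nil)
  ultimately show ?case
    using Cons.IH distinct_concat_filter [OF Cons.prems(2)] by simp
qed simp

definition strand_merges :: "'i list \<Rightarrow> ('i \<times> 'i) list" where
  "strand_merges xs = map (Pair (hd xs)) (tl xs)"

lemma distinct_concat_unique:
  assumes "distinct (concat ss)" "i < length ss" "j < length ss" "v \<in> set (ss ! i)" "v \<in> set (ss ! j)"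
  shows "i = j"
proof -
  have "\<not> i < j" if "i < length ss" "j < length ss" "v \<in> set (ss ! i)" "v \<in> set (ss ! j)" for i j
  proof
    assume "i < j"
    have "ss = take j ss @ ss ! j # drop (Suc j) ss"
      using that by (simp add: id_take_nth_drop)
    then have "set (concat (take j ss)) \<inter> set (ss ! j) = {}"
      using assms(1) by (metis distinct_append concat_append concat.simps(2) inf_sup_distrib1 set_append sup_eq_bot_iff)
    moreover have "ss ! i \<in> set (take j ss)"
      using \<open>i < j\<close> that by (auto simp: in_set_conv_nth)
    ultimately show False using that by auto
  qed
  then show ?thesis using assms by (metis nat_neq_iff)
qed

lemma collapsible_strands:
  assumes "distinct (concat ss)" "[] \<notin> set ss" "distinct ord" "set ord \<subseteq> {..<length ss}"
  shows "collapsible ss (concat (map (\<lambda>i. strand_merges (ss ! i)) ord))"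
proof -
  \<comment> \<open>The strands treated already have lost elements, so the induction runs over all
    lists that agree with \<open>ss\<close> on the strands still to be treated.\<close>
  have "collapsible ss' (concat (map (\<lambda>i. strand_merges (ss ! i)) ord))"
    if "distinct (concat ss')" "length ss' = length ss" "\<And>i. i \<in> set ord \<Longrightarrow> ss' ! i = ss ! i" for ss'
    using that assms(3,4)
  proof (induction ord arbitrary: ss')
    case (Cons i ord)
    define Y where "Y = snd ` set (strand_merges (ss ! i))"
    have i: "i < length ss" "ss' ! i = ss ! i" using Cons.prems by auto
    then have "ss ! i \<noteq> []" using assms(2) by (metis nth_mem)
    then have cons: "ss ! i = hd (ss ! i) # tl (ss ! i)" by simp
    have "ss ! i \<in> set ss'" using i Cons.prems(2) by (metis nth_mem)
    then have "collapsible ss' (strand_merges (ss ! i))"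
      unfolding strand_merges_def using cons Cons.prems(1) by (intro collapsible_strand) simp_all
    moreover have "collapsible (drop_elems Y ss') (concat (map (\<lambda>i. strand_merges (ss ! i)) ord))"
    proof (rule Cons.IH)
      have Y: "Y \<subseteq> set (ss ! i)"
        unfolding Y_def strand_merges_def by (subst (2) cons) auto
      show "drop_elems Y ss' ! j = ss ! j" if "j \<in> set ord" for j
      proof -
        have j: "j < length ss" "ss' ! j = ss ! j" "j \<noteq> i" using that Cons.prems by auto
        then have "set (ss ! j) \<inter> Y = {}"
          using Y distinct_concat_unique [OF Cons.prems(1), of i j] i Cons.prems(2) by auto
        then have "filter (\<lambda>z. z \<notin> Y) (ss ! j) = ss ! j"
          by (intro filter_True) auto
        then show ?thesis using j Cons.prems(2) by simp
      qed
    qed (use Cons.prems distinct_concat_filter in auto)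
    ultimately show ?case by (simp add: collapsible_append Y_def)
  qed simp
  then show ?thesis using assms by simp
qed

fun substs :: "(label \<times> label) list \<Rightarrow> label \<Rightarrow> label" where
  "substs [] = id"
| "substs ((x, y) # ms) = substs ms \<circ> id(y := x)"

abbreviation gms :: "(label \<times> label) list \<Rightarrow> beta \<Rightarrow> beta" where
  "gms \<equiv> fold (\<lambda>(x, y). gm x y x)"

text \<open>The counterpart of \<open>merges\<close> for the numbers 1 + c, which the matrix does
  not record.\<close>

abbreviation products :: "(label \<times> label) list \<Rightarrow> (label \<Rightarrow> ratfun) \<Rightarrow> label \<Rightarrow> ratfun" where
  "products \<equiv> fold (\<lambda>(x, y) c. c(x := c x * c y))"

definition col_factor :: "(label \<Rightarrow> label) \<Rightarrow> beta \<Rightarrow> label \<Rightarrow> ratfun" where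
  "col_factor f A h = 1 + change_vars f (col_sum A h)"

lemma merges_agree:
  assumes "agree (set (concat ss)) S S'" "collapsible ss ms" "distinct (concat ss)"
  shows "agree (set (concat ss) - snd ` set ms) (merges ms S) (merges ms S')"
  using assms
proof (induction ms arbitrary: ss S S')
  case (Cons m ms)
  obtain x y where m: "m = (x, y)" by fastforce
  have adj: "adjacent ss x y" and coll: "collapsible (drop_elem y ss) ms"
    using Cons.prems(2) by (auto simp: m)
  note xy = adjacentD [OF adj Cons.prems(3)]
  have V: "set (concat (drop_elem y ss)) = set (concat ss) - {y}" by auto
  have "agree (set (concat (drop_elem y ss))) (merge x y S) (merge x y S')"
    unfolding V using Cons.prems(1) xy by (intro merge_agree)
  from Cons.IH [OF this coll distinct_concat_filter [OF Cons.prems(3)]]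
  show ?case unfolding V m Diff_insert2 [symmetric] by simp
qed simp

lemma products_cong:
  assumes "\<forall>v\<in>V. c v = c' v" "\<forall>(x, y)\<in>set ms. x \<in> V \<and> y \<in> V"
  shows "\<forall>v\<in>V. products ms c v = products ms c' v"
  using assms
proof (induction ms arbitrary: c c')
  case (Cons m ms)
  obtain x y where m: "m = (x, y)" by fastforce
  show ?case
    using Cons.IH [of "c(x := c x * c y)" "c'(x := c' x * c' y)"] Cons.prems by (auto simp: m)
qed simp

lemma collapsible_subset:
  assumes "collapsible ss ms" "distinct (concat ss)" "(x, y) \<in> set ms"
  shows "x \<in> set (concat ss) \<and> y \<in> set (concat ss) \<and> (\<exists>xs\<in>set ss. x \<in> set xs \<and> y \<in> set xs)"
  using assms
proof (induction ms arbitrary: ss)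
  case (Cons m ms)
  obtain x' y' where m: "m = (x', y')" by fastforce
  show ?case
  proof (cases "m = (x, y)")
    case True
    then obtain xs where "xs \<in> set ss" "x \<in> set xs" "y \<in> set xs"
      using Cons.prems(1) by (auto simp: adjacent_def)
    then show ?thesis by auto
  next
    case False
    then show ?thesis
      using Cons.prems Cons.IH [of "drop_elem y' ss"] distinct_concat_filter [OF Cons.prems(2)] m by auto
  qed
qed simp

text \<open>The first multiplication is peeled off while the substitutions of the remaining ones are
  part of the pending renaming. Each step moves one more substitution to the beginning, until all
  variables are renamed in the initial array.\<close>

lemma gms_merges:
  assumes "collapsible ss ms" "distinct (concat ss)" "admissible (set (concat ss)) A"
  shows "admissible (set (concat ss) - snd ` set ms) (gms ms A) \<and>
    agree (set (concat ss) - snd ` set ms)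
      (beta_network f (gms ms A)) (merges ms (beta_network (f \<circ> substs ms) A)) \<and>
    (\<forall>h\<in>set (concat ss) - snd ` set ms.
      col_factor f (gms ms A) h = products ms (col_factor (f \<circ> substs ms) A) h)"
  using assms
proof (induction ms arbitrary: ss A)
  case Nil
  then show ?case by (simp add: agree_def)
next
  case (Cons m ms)
  obtain x y where m: "m = (x, y)" by fastforce
  have adj: "adjacent ss x y" and coll: "collapsible (drop_elem y ss) ms"
    using Cons.prems(1) by (auto simp: m)
  note xy = adjacentD [OF adj Cons.prems(2)]
  note dist = distinct_concat_filter [OF Cons.prems(2), of "\<lambda>z. z \<noteq> y"]
  define V where "V = set (concat ss)"
  have V: "set (concat (drop_elem y ss)) = V - {y}" by (auto simp: V_def)
  define g where "g = f \<circ> substs ms"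
  define A' where "A' = gm x y x A"
  have A: "admissible V A" using Cons.prems(3) by (simp add: V_def)
  note gm = gm_merge(1) [OF A xy [folded V_def], folded A'_def]
    gm_merge(2-4) [OF A xy [folded V_def], where f = g, folded A'_def]
  have g: "g \<circ> id(y := x) = f \<circ> substs (m # ms)" by (simp add: g_def m o_assoc)
  have VV: "V - {y} - snd ` set ms = V - snd ` set (m # ms)" by (auto simp: m)
  have IH: "admissible (V - {y} - snd ` set ms) (gms ms A')"
    "agree (V - {y} - snd ` set ms) (beta_network f (gms ms A')) (merges ms (beta_network g A'))"
    "\<forall>h\<in>V - {y} - snd ` set ms. col_factor f (gms ms A') h = products ms (col_factor g A') h"
    using Cons.IH [OF coll dist, unfolded V, OF gm(1)] unfolding g_def by blast+
  have "agree (V - {y} - snd ` set ms) (merges ms (beta_network g A'))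
      (merges ms (merge x y (beta_network (g \<circ> id(y := x)) A)))"
    using merges_agree [OF _ coll dist] gm(2) by (simp only: V)
  then have ag: "agree (V - {y} - snd ` set ms) (beta_network f (gms ms A'))
      (merges ms (merge x y (beta_network (g \<circ> id(y := x)) A)))"
    using IH(2) by (auto simp: agree_def)
  let ?c = "col_factor (g \<circ> id(y := x)) A"
  have prods: "\<forall>v\<in>V - {y}. products ms (col_factor g A') v = products ms (?c(x := ?c x * ?c y)) v"
  proof (rule products_cong)
    show "\<forall>v\<in>V - {y}. col_factor g A' v = (?c(x := ?c x * ?c y)) v"
      using gm(3,4) by (auto simp: col_factor_def)
    show "\<forall>(u, v)\<in>set ms. u \<in> V - {y} \<and> v \<in> V - {y}"
      using collapsible_subset [OF coll dist] unfolding V by blast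
  qed
  have unf: "gms (m # ms) A = gms ms A'" "\<And>S. merges (m # ms) S = merges ms (merge x y S)"
    "\<And>c. products (m # ms) c = products ms (c(x := c x * c y))"
    by (simp_all add: m A'_def)
  show ?case
    unfolding V_def [symmetric] VV [symmetric] g [symmetric] unf
  proof (intro conjI ballI)
    fix h assume h: "h \<in> V - {y} - snd ` set ms"
    then show "col_factor f (gms ms A') h = products ms (?c(x := ?c x * ?c y)) h"
      using trans [OF bspec [OF IH(3) h] bspec [OF prods, of h]] by blast
  qed (rule IH(1) ag)+
qed

text \<open>Meant for the function that assigns to each label its strand: multiplications take place
  within a strand, so the substitutions do not leave it.\<close>

lemma substs_invariant:
  "(\<And>x y. (x, y) \<in> set ms \<Longrightarrow> f x = f y) \<Longrightarrow> f (substs ms v) = f v"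
proof (induction ms arbitrary: v)
  case (Cons m ms)
  then show ?case by (cases m) (auto simp: fun_upd_def)
qed simp

lemma substs_range:
  assumes "collapsible ss ms" "distinct (concat ss)" "v \<in> set (concat ss)"
  shows "substs ms v \<in> set (concat ss) - snd ` set ms"
  using assms
proof (induction ms arbitrary: ss v)
  case (Cons m ms)
  obtain x y where m: "m = (x, y)" by fastforce
  have adj: "adjacent ss x y" and coll: "collapsible (drop_elem y ss) ms"
    using Cons.prems(1) by (auto simp: m)
  note xy = adjacentD [OF adj Cons.prems(2)]
  have V: "set (concat (drop_elem y ss)) = set (concat ss) - {y}" by auto
  have "(id(y := x)) v \<in> set (concat ss) - {y}" using xy Cons.prems(3) by auto
  from Cons.IH [OF coll distinct_concat_filter [OF Cons.prems(2)], unfolded V, OF this]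
  show ?case by (auto simp: m)
qed simp

section \<open>The Burau matrix of a diagram\<close>

lemma products_other: "v \<notin> fst ` set ms \<Longrightarrow> products ms c v = c v"
proof (induction ms arbitrary: c)
  case (Cons m ms)
  then show ?case by (cases m) simp
qed simp

lemma products_single:
  "k \<notin> set ls \<Longrightarrow> products (map (Pair k) ls) c = c(k := c k * prod_list (map c ls))"
proof (induction ls arbitrary: c)
  case (Cons l ls)
  let ?c = "c(k := c k * c l)"
  have m: "map ?c ls = map c ls" using Cons.prems by auto
  have "products (map (Pair k) (l # ls)) c = products (map (Pair k) ls) ?c" by simp
  also have "\<dots> = ?c(k := ?c k * prod_list (map ?c ls))"
    using Cons.prems by (intro Cons.IH) simp
  also have "\<dots> = c(k := c k * prod_list (map c (l # ls)))"
    unfolding m by (simp add: mult.assoc)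
  finally show ?case .
qed simp

text \<open>The merges of a strand change only the factor of its first label, and different strands
  have no labels in common, so the strands do not interfere.\<close>

lemma products_strands:
  assumes "distinct (concat ss)" "[] \<notin> set ss" "distinct ord" "set ord \<subseteq> {..<length ss}" "i \<in> set ord"
  shows "products (concat (map (\<lambda>i. strand_merges (ss ! i)) ord)) c (hd (ss ! i)) = prod_list (map c (ss ! i))"
  using assms(3-5)
proof (induction ord arbitrary: c)
  case (Cons j ord)
  have ne: "ss ! k \<noteq> []" if "k \<in> set (j # ord)" for k
  proof -
    have "ss ! k \<in> set ss" using that Cons.prems(2) by (intro nth_mem) auto
    then show ?thesis using assms(2) by metis
  qed
  have disj: "hd (ss ! k) \<notin> set (ss ! l)" if "k \<in> set (j # ord)" "l \<in> set (j # ord)" "k \<noteq> l" for k l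
    using distinct_concat_unique [OF assms(1), of k l "hd (ss ! k)"] that Cons.prems(2) ne
    by auto
  have "distinct (ss ! j)"
    using assms(1) Cons.prems(2) by (auto simp: distinct_concat_iff)
  then obtain k ls where kls: "ss ! j = k # ls" "k \<notin> set ls"
    using ne [of j] by (cases "ss ! j") auto
  define c' where "c' = products (strand_merges (ss ! j)) c"
  have c': "c' = c(k := prod_list (map c (ss ! j)))"
    unfolding c'_def using kls by (simp add: strand_merges_def products_single)
  have split: "products (concat (map (\<lambda>i. strand_merges (ss ! i)) (j # ord))) c =
      products (concat (map (\<lambda>i. strand_merges (ss ! i)) ord)) c'"
    by (simp add: c'_def)
  show ?case
  proof (cases "i = j")
    case True
    have "k \<notin> fst ` set (concat (map (\<lambda>i. strand_merges (ss ! i)) ord))"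
    proof
      assume "k \<in> fst ` set (concat (map (\<lambda>i. strand_merges (ss ! i)) ord))"
      then obtain l where l: "l \<in> set ord" "k = hd (ss ! l)"
        by (auto simp: strand_merges_def)
      then show False using disj [of l j] Cons.prems(1) kls by auto
    qed
    then have "products (concat (map (\<lambda>i. strand_merges (ss ! i)) ord)) c' k = c' k"
      by (rule products_other)
    also have "c' k = prod_list (map c (ss ! j))" by (simp add: c')
    finally show ?thesis unfolding split True by (simp only: kls list.sel)
  next
    case False
    then have i: "i \<in> set ord" using Cons.prems(3) by simp
    have "k \<notin> set (ss ! i)"
      using disj [of j i] False i kls by auto
    then have "map c' (ss ! i) = map c (ss ! i)" by (auto simp: c')
    moreover have "distinct ord" "set ord \<subseteq> {..<length ss}" using Cons.prems by auto
    ultimately show ?thesis unfolding split using Cons.IH [of c'] i by (simp only:)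
  qed
qed simp

text \<open>These are the numbers 1 + c of the initial array: in an R-matrix only the column of the
  lower label has a non-zero entry, namely t - 1.\<close>

fun col_weight :: "(nat \<Rightarrow> ratfun) \<Rightarrow> slot \<Rightarrow> ratfun" where
  "col_weight t (Passage (c, Lower)) = t c"
| "col_weight t s = 1"

fun crossing_entry :: "(nat \<Rightarrow> ratfun) \<Rightarrow> slot \<Rightarrow> slot \<Rightarrow> ratfun" where
  "crossing_entry t (Passage (c, Upper)) (Passage (d, Lower)) = (if c = d then t c - 1 else 0)"
| "crossing_entry t r s = 0"

text \<open>On the upper and the lower passage of one crossing this is the Burau block with rows (1,
  1 - t) and (0, t); different crossings do not interact, and bare slots carry the identity.\<close>

definition burau :: "(nat \<Rightarrow> ratfun) \<Rightarrow> slot \<Rightarrow> slot \<Rightarrow> ratfun" where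
  "burau t r s = (if r = s then col_weight t s else 0) - crossing_entry t r s"

lemma crossing_entry_change_vars:
  assumes "\<And>c. t c - 1 \<in> vanishing"
  shows "change_vars f (crossing_entry t r s) = crossing_entry (\<lambda>c. change_vars f (t c)) r s"
  using near_one_regular [OF assms]
  by (induction t r s rule: crossing_entry.induct) (auto simp: change_vars_diff)

lemma col_weight_change_vars: "change_vars f (col_weight t s) = col_weight (\<lambda>c. change_vars f (t c)) s"
  by (induction t s rule: col_weight.induct) simp_all

lemma burau_near_identity:
  assumes "\<And>c. t c - 1 \<in> vanishing"
  shows "near_identity V (w, burau t)"
proof -
  have 1: "col_weight t s - 1 \<in> vanishing" for s
    using assms by (induction t s rule: col_weight.induct) simp_all
  have 2: "crossing_entry t r s \<in> vanishing" for r s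
    using assms by (induction t r s rule: crossing_entry.induct) simp_all
  have "burau t r s - (if r = s then 1 else 0) \<in> vanishing" for r s
    using vanishing_diff [OF 1 [of s] 2 [of r s]] vanishing_uminus [OF 2 [of r s]]
    by (auto simp: burau_def algebra_simps)
  then show ?thesis by (simp add: near_identity_def)
qed

section \<open>Slots and the initial array\<close>

definition slot_strands :: "tangle \<Rightarrow> slot list list" where
  "slot_strands D = map (strand_slots D) [0..<length (strands D)]"

lemma distinct_concat_upt:
  assumes "\<And>i. i < n \<Longrightarrow> distinct (f i)"
    and "\<And>i j. i < j \<Longrightarrow> j < n \<Longrightarrow> set (f i) \<inter> set (f j) = {}"
  shows "distinct (concat (map f [0..<n]))"
  using assms
proof (induction n)
  case (Suc n)
  have "distinct (concat (map f [0..<n]))"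
    using Suc.prems less_SucI by (intro Suc.IH) blast+
  then show ?case using Suc.prems by fastforce
qed simp

lemma distinct_strand:
  assumes "distinct (concat ss)" "i < length ss"
  shows "distinct (ss ! i)"
  using assms by (auto simp: distinct_concat_iff)

lemma length_slot_strands [simp]: "length (slot_strands D) = length (strands D)"
  by (simp add: slot_strands_def)

lemma nth_slot_strands [simp]: "i < length (strands D) \<Longrightarrow> slot_strands D ! i = strand_slots D i"
  by (simp add: slot_strands_def)

lemma strand_slots_nonempty: "strand_slots D i \<noteq> []"
  by (simp add: strand_slots_def)

lemma slot_strands_nonempty: "[] \<notin> set (slot_strands D)"
  by (auto simp: slot_strands_def strand_slots_def)

lemma passages_nth: "p \<in> passages D \<longleftrightarrow> (\<exists>i<length (strands D). p \<in> set (strands D ! i))"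
proof
  assume "p \<in> passages D"
  then obtain s where "s \<in> set (strands D)" "p \<in> set s" by (auto simp: passages_def)
  then show "\<exists>i<length (strands D). p \<in> set (strands D ! i)"
    unfolding in_set_conv_nth [of s] by blast
qed (auto simp: passages_def)

lemma set_slot_strands: "set (concat (slot_strands D)) = slots D"
proof
  show "set (concat (slot_strands D)) \<subseteq> slots D"
    by (auto simp: slot_strands_def strand_slots_def slots_def bare_strands_def passages_nth
        split: if_splits intro!: imageI)
  show "slots D \<subseteq> set (concat (slot_strands D))"
    by (fastforce simp: slot_strands_def strand_slots_def slots_def bare_strands_def passages_nth)
qed

lemma distinct_slot_strands:
  assumes "distinct (concat (strands D))"
  shows "distinct (concat (slot_strands D))"
  unfolding slot_strands_def
proof (rule distinct_concat_upt)
  show "distinct (strand_slots D i)" if "i < length (strands D)" for i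
    using distinct_strand [OF assms that] by (auto simp: strand_slots_def distinct_map inj_on_def)
  show "set (strand_slots D i) \<inter> set (strand_slots D j) = {}" if "i < j" "j < length (strands D)" for i j
    using that distinct_concat_unique [OF assms, of i j] by (auto simp: strand_slots_def)
qed

lemma finite_passages [simp]: "finite (passages D)"
  by (simp add: passages_def)

lemma finite_slots [simp]: "finite (slots D)"
  by (simp add: slots_def bare_strands_def)

lemma crossing_passages:
  assumes "tangle_diagram D" "c \<in> crossings D"
  shows "(c, l) \<in> passages D"
proof -
  obtain l' where "(c, l') \<in> passages D" using assms(2) by (auto simp: crossings_def)
  then show ?thesis using assms(1) unfolding tangle_diagram_def by (cases l; cases l') auto
qed

text \<open>As the labels are injective on slots, at most one block of the union contributes to an
  entry, and each column meets at most one non-zero entry.\<close>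

lemma crossing_array_props:
  assumes D: "tangle_diagram D" and lab: "labelling D lab"
  defines "A \<equiv> crossing_array D lab"
    and "t \<equiv> \<lambda>c. var (lab (Passage (c, Upper))) powi crossing_sign D c"
  shows "heads A = lab ` slots D" "tails A = lab ` slots D" "corner A = 1"
    and "\<And>r s. r \<in> slots D \<Longrightarrow> s \<in> slots D \<Longrightarrow> entry A (lab r) (lab s) = crossing_entry t r s"
    and "\<And>s. s \<in> slots D \<Longrightarrow> 1 + col_sum A (lab s) = col_weight t s"
proof -
  have pass: "(c, l) \<in> passages D \<longleftrightarrow> c \<in> crossings D" for c l
    using crossing_passages [OF D] by (force simp: crossings_def)
  have slots: "slots D = (\<Union>c\<in>crossings D. {Passage (c, Upper), Passage (c, Lower)}) \<union> Bare_strand ` bare_strands D"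
  proof -
    have "passages D = (\<Union>c\<in>crossings D. {(c, Upper), (c, Lower)})"
    proof (rule set_eqI)
      fix p :: passage
      obtain c l where "p = (c, l)" by fastforce
      then show "p \<in> passages D \<longleftrightarrow> p \<in> (\<Union>c\<in>crossings D. {(c, Upper), (c, Lower)})"
        by (cases l) (simp_all add: pass)
    qed
    then show ?thesis unfolding slots_def by (simp add: image_UN)
  qed
  show heads: "heads A = lab ` slots D" and tails: "tails A = lab ` slots D"
    unfolding A_def slots
    by (auto simp: crossing_array_def disjoint_union_def R_matrix_def trivial_array_def Plus_def)
  show "corner A = 1"
    by (auto simp: A_def crossing_array_def disjoint_union_def R_matrix_def trivial_array_def Plus_def
        intro!: prod.neutral)
  have fin: "finite (crossings D)" "finite (bare_strands D)"
    by (simp_all add: crossings_def bare_strands_def)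
  have inj: "lab r = lab s \<longleftrightarrow> r = s" if "r \<in> slots D" "s \<in> slots D" for r s
    using lab that by (auto simp: labelling_def inj_on_def)
  show entry: "entry A (lab r) (lab s) = crossing_entry t r s" if rs: "r \<in> slots D" "s \<in> slots D" for r s
  proof -
    have "entry A (lab r) (lab s) = (\<Sum>c\<in>crossings D.
        if lab r = lab (Passage (c, Upper)) \<and> lab s = lab (Passage (c, Lower)) then t c - 1 else 0)"
      unfolding t_def using fin
      by (simp add: A_def crossing_array_def disjoint_union_def sum.Plus R_matrix_def
          trivial_array_def o_def)
    also have "\<dots> = (\<Sum>c\<in>crossings D.
        if r = Passage (c, Upper) \<and> s = Passage (c, Lower) then t c - 1 else 0)"
      using rs by (intro sum.cong refl if_cong) (auto simp: inj slots)
    also have "\<dots> = crossing_entry t r s"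
    proof (cases "\<exists>c. r = Passage (c, Upper) \<and> s = Passage (c, Lower)")
      case True
      then obtain c where c: "r = Passage (c, Upper)" "s = Passage (c, Lower)" by blast
      then have "c \<in> crossings D" using rs(1) by (auto simp: slots)
      then show ?thesis using c fin(1) by (simp add: sum.delta')
    next
      case False
      then have "crossing_entry t r s = 0"
        by (induction t r s rule: crossing_entry.induct) auto
      then show ?thesis using False by (intro trans [OF sum.neutral]) auto
    qed
    finally show ?thesis .
  qed
  show "1 + col_sum A (lab s) = col_weight t s" if s: "s \<in> slots D" for s
  proof -
    have "col_sum A (lab s) = (\<Sum>r\<in>slots D. crossing_entry t r s)"
      using lab s entry unfolding col_sum_def tails labelling_def by (simp add: sum.reindex)
    also have "\<dots> = col_weight t s - 1"
    proof (cases "\<exists>c. s = Passage (c, Lower)")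
      case True
      then obtain c where c: "s = Passage (c, Lower)" by blast
      then have "Passage (c, Upper) \<in> slots D" using s by (auto simp: slots)
      moreover have "crossing_entry t r s = (if r = Passage (c, Upper) then t c - 1 else 0)" for r
        unfolding c by (cases "(t, r, Passage (c, Lower))" rule: crossing_entry.cases) auto
      ultimately show ?thesis using c by simp
    next
      case False
      then have "crossing_entry t r s = 0" for r
        by (induction t r s rule: crossing_entry.induct) auto
      moreover have "col_weight t s = 1"
        using False by (induction t s rule: col_weight.induct) auto
      ultimately show ?thesis by simp
    qed
    finally show ?thesis by simp
  qed
qed

section \<open>The normal form of the invariant\<close>

definition strand_of :: "tangle \<Rightarrow> passage \<Rightarrow> nat" where
  "strand_of D p = (THE i. i < length (strands D) \<and> p \<in> set (strands D ! i))"

text \<open>The changes of variables turn the variable of an upper label into that of its strand,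
  and strands are named by their positions in the end.\<close>

definition weight :: "tangle \<Rightarrow> nat \<Rightarrow> ratfun" where
  "weight D c = var (strand_of D (c, Upper)) powi crossing_sign D c"

lemma weight_near_one: "weight D c - 1 \<in> vanishing"
  unfolding weight_def by (rule near_one_powi [OF near_one_var])

lemma strand_of_eq:
  assumes "distinct (concat (strands D))" "i < length (strands D)" "p \<in> set (strands D ! i)"
  shows "strand_of D p = i"
  unfolding strand_of_def using assms distinct_concat_unique [OF assms(1)] by (intro the_equality) blast+

text \<open>The way back from \<open>G\<close> to the array. The diagonal \<sigma> of numbers 1 + c
  has to be supplied from outside.\<close>

definition strand_array :: "nat \<Rightarrow> (nat \<Rightarrow> ratfun) \<Rightarrow> nat network \<Rightarrow> beta" where
  "strand_array n \<sigma> S = \<lparr> heads = {..<n}, tails = {..<n}, corner = fst S,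
     entry = (\<lambda>i j. if i < n \<and> j < n then (if i = j then \<sigma> j else 0) - snd S i j else 0) \<rparr>"

definition strand_weight :: "tangle \<Rightarrow> nat \<Rightarrow> ratfun" where
  "strand_weight D i = prod_list (map (col_weight (weight D)) (strand_slots D i))"

lemma multiply_labels_gms: "xs \<noteq> [] \<Longrightarrow> multiply_labels xs A = gms (strand_merges xs) A"
  by (cases xs) (simp_all add: strand_merges_def fold_map o_def)

lemma fold_multiply_labels_gms:
  assumes "\<And>i. i \<in> set ord \<Longrightarrow> f i \<noteq> []"
  shows "fold (\<lambda>i. multiply_labels (f i)) ord A = gms (concat (map (\<lambda>i. strand_merges (f i)) ord)) A"
  using assms by (induction ord arbitrary: A) (simp_all add: multiply_labels_gms)

lemma burau_cong:
  assumes "\<And>c. c \<in> crossings D \<Longrightarrow> t c = t' c" "r \<in> slots D" "s \<in> slots D"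
  shows "burau t r s = burau t' r s" "col_weight t s = col_weight t' s"
    "crossing_entry t r s = crossing_entry t' r s"
proof -
  have c: "t c = t' c" if "Passage (c, l) \<in> slots D" for c l
    using that assms(1) by (force simp: slots_def crossings_def)
  show 1: "col_weight t s = col_weight t' s"
    using assms(3) c by (induction t s rule: col_weight.induct) auto
  show 2: "crossing_entry t r s = crossing_entry t' r s"
    using assms(2) c by (induction t r s rule: crossing_entry.induct) auto
  show "burau t r s = burau t' r s"
    using 1 2 by (simp add: burau_def)
qed

lemma stitch_strands_singletons:
  "stitch_strands (map (\<lambda>i. [f i]) [0..<n]) S =
     (fst S, \<lambda>i j. if i < n \<and> j < n then snd S (f i) (f j) else 0)"
proof -
  have "concat (map links (map (\<lambda>i. [f i]) [0..<n])) = []" by simp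
  then have "fold stitch (concat (map links (map (\<lambda>i. [f i]) [0..<n]))) S = S" by (simp only: fold.simps id_apply)
  then show ?thesis
    unfolding stitch_strands_def Let_def by (auto simp del: map_map simp: fun_eq_iff)
qed

lemma drop_tails:
  assumes "distinct (concat ss)" "[] \<notin> set ss" "set ord = {..<length ss}"
  shows "drop_elems (snd ` set (concat (map (\<lambda>i. strand_merges (ss ! i)) ord))) ss =
    map (\<lambda>i. [hd (ss ! i)]) [0..<length ss]"
proof -
  define Y where "Y = snd ` set (concat (map (\<lambda>i. strand_merges (ss ! i)) ord))"
  have Y: "Y = (\<Union>i<length ss. set (tl (ss ! i)))"
    unfolding Y_def using assms(3) by (auto simp: strand_merges_def image_iff)
  have "filter (\<lambda>z. z \<notin> Y) (ss ! i) = [hd (ss ! i)]" if i: "i < length ss" for i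
  proof -
    have "ss ! i \<noteq> []" using assms(2) i by (metis nth_mem)
    then obtain k ls where kls: "ss ! i = k # ls" by (cases "ss ! i") auto
    have "k \<notin> set ls" using distinct_strand [OF assms(1) i] kls by simp
    have "k \<notin> Y"
    proof
      assume "k \<in> Y"
      then obtain j where j: "j < length ss" "k \<in> set (tl (ss ! j))" by (auto simp: Y)
      then have "k \<in> set (ss ! j)" by (cases "ss ! j") auto
      then have "j = i" using distinct_concat_unique [OF assms(1) j(1) i, of k] kls by simp
      then show False using j \<open>k \<notin> set ls\<close> kls by simp
    qed
    moreover have "set ls \<subseteq> Y" using i kls by (force simp: Y)
    then have "filter (\<lambda>z. z \<notin> Y) ls = []" by (auto simp: filter_empty_conv)
    ultimately show ?thesis by (simp add: kls)
  qed
  then show ?thesis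
    unfolding Y_def [symmetric] by (intro nth_equalityI) auto
qed

text \<open>Labels and the order of the strands occur on the left-hand side only, so independence of
  these choices is contained here. The column sums are included because the correction term of a
  kink refers to them.\<close>

lemma Z_beta_normal_form:
  assumes D: "tangle_diagram D" and lab: "labelling D lab" and ord: "strand_order D ord"
  shows "Z_beta D lab ord = strand_array (length (strands D)) (strand_weight D)
      (stitch_strands (slot_strands D) (1, burau (weight D)))" (is ?thesis1)
    and "\<And>i. i < length (strands D) \<Longrightarrow> 1 + col_sum (Z_beta D lab ord) i = strand_weight D i"
proof -
  define n where "n = length (strands D)"
  define ss where "ss = map (map lab) (slot_strands D)"
  define ms where "ms = concat (map (\<lambda>i. strand_merges (ss ! i)) ord)"
  define A where "A = crossing_array D lab"
  define A' where "A' = gms ms A"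
  define first where "first = first_label D lab"
  define g where "g = inv_into {..<n} first"
  \<comment> \<open>\<open>f\<close> combines the substitutions of all multiplications with the
    final relabelling. It sends the label of every passage to the strand of that passage, as shown
    below.\<close>
  define f where "f = g \<circ> substs ms"
  define V where "V = set (concat ss)"
  have dD: "distinct (concat (strands D))"
    using D by (simp add: tangle_diagram_def)
  have inj: "inj_on lab (slots D)" using lab by (simp add: labelling_def)
  have V: "V = lab ` slots D"
    by (simp only: V_def ss_def map_concat [symmetric] set_map set_slot_strands)
  have dist: "distinct (concat ss)"
    using distinct_slot_strands [OF dD] inj unfolding ss_def map_concat [symmetric]
    by (simp add: distinct_map set_slot_strands del: set_concat)
  have ne: "[] \<notin> set ss" using slot_strands_nonempty by (auto simp: ss_def)
  have len: "length ss = n" by (simp add: ss_def n_def)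
  have ss: "ss ! i = map lab (strand_slots D i)" if "i < n" for i
    using that by (simp add: ss_def n_def)
  have ord': "distinct ord" "set ord = {..<length ss}"
    using ord by (simp_all add: strand_order_def len n_def)
  have first: "first i = hd (ss ! i)" if "i < n" for i
    using that by (simp add: first_def first_label_def ss hd_map strand_slots_nonempty)
  have first_in: "first i \<in> set (ss ! i)" if "i < n" for i
    using that strand_slots_nonempty [of D i] by (simp add: first ss hd_map)
  have inj_first: "inj_on first {..<n}"
  proof (rule inj_onI)
    fix i j assume ij: "i \<in> {..<n}" "j \<in> {..<n}" "first i = first j"
    then show "i = j"
      using distinct_concat_unique [OF dist, of i j "first i"] first_in [of i] first_in [of j] len by simp
  qed
  then have g_first: "g (first i) = i" if "i < n" for i
    using that by (simp add: g_def)
  have coll: "collapsible ss ms"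
    unfolding ms_def using ord' by (intro collapsible_strands dist ne) auto
  have drop: "drop_elems (snd ` set ms) ss = map (\<lambda>i. [first i]) [0..<n]"
    using drop_tails [OF dist ne ord'(2)] first by (simp add: ms_def len cong: map_cong)
  have V': "V - snd ` set ms = first ` {..<n}"
  proof -
    have "V - snd ` set ms = set (concat (drop_elems (snd ` set ms) ss))"
      unfolding V_def by auto
    then show ?thesis unfolding drop by auto
  qed
  have Z: "Z_beta D lab ord = relabel g A'"
  proof -
    have "fold (\<lambda>i. multiply_labels (map lab (strand_slots D i))) ord A =
        gms (concat (map (\<lambda>i. strand_merges (map lab (strand_slots D i))) ord)) A"
      by (rule fold_multiply_labels_gms) (simp add: strand_slots_nonempty)
    also have "map (\<lambda>i. strand_merges (map lab (strand_slots D i))) ord = map (\<lambda>i. strand_merges (ss ! i)) ord"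
      using ord'(2) ss len by (intro map_cong) auto
    finally show ?thesis
      by (simp add: Z_beta_def A'_def A_def g_def n_def first_def ms_def)
  qed
  define t where "t = (\<lambda>c. var (lab (Passage (c, Upper))) powi crossing_sign D c)"
  note A = crossing_array_props [OF D lab, folded A_def t_def]
  have t: "t c - 1 \<in> vanishing" for c
    unfolding t_def by (rule near_one_powi [OF near_one_var])
  have adm: "admissible V A"
    unfolding admissible_def
  proof (intro conjI ballI)
    fix t' h assume "t' \<in> V" "h \<in> V"
    then obtain r s where rs: "r \<in> slots D" "t' = lab r" "s \<in> slots D" "h = lab s" by (auto simp: V)
    have "crossing_entry t r s \<in> vanishing"
      using t by (induction t r s rule: crossing_entry.induct) simp_all
    then show "entry A t' h \<in> vanishing" using rs A(4) by simp
  qed (use A V in simp_all)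
  have sim: "admissible (first ` {..<n}) A'"
    "agree (first ` {..<n}) (beta_network g A') (merges ms (beta_network f A))"
    "\<And>h. h \<in> first ` {..<n} \<Longrightarrow> col_factor g A' h = products ms (col_factor f A) h"
    using gms_merges [OF coll dist adm [unfolded V_def], of g, folded V_def]
    unfolding V' A'_def f_def by blast+
  have f: "f (lab (Passage p)) = strand_of D p" if p: "p \<in> passages D" for p
  proof -
    obtain i where i: "i < n" "p \<in> set (strands D ! i)"
      using p by (auto simp: passages_nth n_def)
    \<comment> \<open>\<open>H\<close> is the strand of a label. Both labels of every merge lie on
      one strand, so \<open>substs ms\<close> ends at the first label of the same strand.\<close>
    define H where "H v = (THE i. i < n \<and> v \<in> set (ss ! i))" for v
    have H: "H v = j" if "j < n" "v \<in> set (ss ! j)" for v j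
      unfolding H_def using that distinct_concat_unique [OF dist] len by (intro the_equality) blast+
    have "lab (Passage p) \<in> set (ss ! i)"
      using i by (auto simp: ss strand_slots_def)
    then have 1: "H (lab (Passage p)) = i" using H i by blast
    have "H (substs ms (lab (Passage p))) = H (lab (Passage p))"
    proof (rule substs_invariant)
      fix x y assume "(x, y) \<in> set ms"
      then obtain xs where "xs \<in> set ss" "x \<in> set xs" "y \<in> set xs"
        using collapsible_subset [OF coll dist] by blast
      then show "H x = H y" using H len by (metis in_set_conv_nth)
    qed
    moreover have "substs ms (lab (Passage p)) \<in> first ` {..<n}"
      unfolding V' [symmetric] V_def
    proof (rule substs_range [OF coll dist])
      show "lab (Passage p) \<in> set (concat ss)"
        unfolding V_def [symmetric] V using p by (simp add: slots_def)
    qed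
    then obtain j where j: "j < n" "substs ms (lab (Passage p)) = first j" by auto
    moreover have "H (first j) = j" using j H first_in by blast
    ultimately have "f (lab (Passage p)) = i" using 1 g_first by (simp add: f_def)
    then show ?thesis using strand_of_eq [OF dD, of i p] i by (simp add: n_def)
  qed
  have ft: "change_vars f (t c) = weight D c" if "c \<in> crossings D" for c
    using f [of "(c, Upper)"] crossing_passages [OF D that]
    by (simp add: t_def weight_def change_vars_powi near_one_var)
  have cf: "col_factor f A (lab s) = col_weight (weight D) s" if "s \<in> slots D" for s
  proof -
    have "col_sum A (lab s) \<in> vanishing"
      using adm that V by (intro admissible_col_sum) auto
    then have "col_factor f A (lab s) = change_vars f (1 + col_sum A (lab s))"
      by (simp add: col_factor_def change_vars_add vanishing_regular)
    also have "\<dots> = col_weight (\<lambda>c. change_vars f (t c)) s"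
      using A(5) [OF that] by (simp add: col_weight_change_vars)
    also have "\<dots> = col_weight (weight D) s"
      using ft that by (intro burau_cong(2) [of D]) auto
    finally show ?thesis .
  qed
  have "agree (slots D) (reindex lab lab (beta_network f A)) (1, burau (weight D))"
  proof -
    have "snd (reindex lab lab (beta_network f A)) r s = burau (weight D) r s"
      if rs: "r \<in> slots D" "s \<in> slots D" for r s
    proof -
      have "change_vars f (entry A (lab r) (lab s)) = crossing_entry (\<lambda>c. change_vars f (t c)) r s"
        using A(4) [OF rs] crossing_entry_change_vars [of t, OF t] by simp
      also have "\<dots> = crossing_entry (weight D) r s"
        using ft rs by (intro burau_cong(3) [of D]) auto
      finally have "change_vars f (entry A (lab r) (lab s)) = crossing_entry (weight D) r s" .
      moreover have "lab r = lab s \<longleftrightarrow> r = s"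
        using inj rs by (auto dest: inj_onD)
      ultimately show ?thesis
        using cf [OF rs(2)] by (simp add: reindex_def beta_network_def burau_def col_factor_def)
    qed
    then show ?thesis
      by (simp add: agree_def reindex_def beta_network_def A(3))
  qed
  then have "stitch_strands (slot_strands D) (reindex lab lab (beta_network f A)) =
      stitch_strands (slot_strands D) (1, burau (weight D))"
    by (intro stitch_strands_cong slot_strands_nonempty) (simp only: set_slot_strands)
  then have "stitch_strands ss (beta_network f A) = stitch_strands (slot_strands D) (1, burau (weight D))"
    unfolding ss_def using stitch_strands_rename [OF slot_strands_nonempty] by metis
  \<comment> \<open>After all merges every strand consists of its first label alone, so no links
    remain and the matrix can be read off directly.\<close>
  moreover have "stitch_strands ss (beta_network f A) =
      stitch_strands (map (\<lambda>i. [first i]) [0..<n]) (merges ms (beta_network f A))"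
    using stitch_strands_merges [OF coll dist _ ne] admissible_near_identity [OF adm]
    unfolding V_def drop by blast
  moreover have "stitch_strands (map (\<lambda>i. [first i]) [0..<n]) (merges ms (beta_network f A)) =
      (fst (beta_network g A'), \<lambda>i j. if i < n \<and> j < n then snd (beta_network g A') (first i) (first j) else 0)"
    using sim(2) unfolding stitch_strands_singletons by (auto simp: agree_def fun_eq_iff)
  ultimately have S: "stitch_strands (slot_strands D) (1, burau (weight D)) = (fst (beta_network g A'),
      \<lambda>i j. if i < n \<and> j < n then snd (beta_network g A') (first i) (first j) else 0)"
    by (simp only:)
  have cw: "col_factor g A' (first i) = strand_weight D i" if i: "i < n" for i
  proof -
    have "col_factor g A' (first i) = prod_list (map (col_factor f A) (ss ! i))"
      using sim(3) i ord' len first products_strands [OF dist ne ord'(1), of i "col_factor f A"]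
      by (simp add: ms_def)
    also have "map (col_factor f A) (ss ! i) = map (col_weight (weight D)) (strand_slots D i)"
    proof -
      have "set (strand_slots D i) \<subseteq> slots D"
        unfolding set_slot_strands [symmetric] using i by (force simp: slot_strands_def n_def)
      then show ?thesis using i cf by (auto simp: ss)
    qed
    finally show ?thesis by (simp add: strand_weight_def)
  qed
  have A': "heads A' = first ` {..<n}" "tails A' = first ` {..<n}"
    and vanA': "\<And>r s. r \<in> first ` {..<n} \<Longrightarrow> s \<in> first ` {..<n} \<Longrightarrow> entry A' r s \<in> vanishing"
    using sim(1) by (auto simp: admissible_def)
  have im: "g ` first ` {..<n} = {..<n}"
    using g_first by (force simp: image_image)
  have inv: "inv_into (first ` {..<n}) g i = first i" if "i < n" for i
    using that g_first by (intro inv_into_f_eq) (auto intro!: inj_onI)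
  have eqi: "first i = first j \<longleftrightarrow> i = j" if "i < n" "j < n" for i j
    using inj_first that by (auto simp: inj_on_def)
  have R: "heads (relabel g A') = {..<n}" "tails (relabel g A') = {..<n}"
    "corner (relabel g A') = change_vars g (corner A')"
    "\<And>i j. entry (relabel g A') i j =
      (if i < n \<and> j < n then change_vars g (entry A' (first i) (first j)) else 0)"
    by (auto simp: relabel_def A' im inv)
  have E: "entry (relabel g A') = (\<lambda>i j. if i < n \<and> j < n then (if i = j then strand_weight D j else 0)
      - (if i < n \<and> j < n then snd (beta_network g A') (first i) (first j) else 0) else 0)"
    using cw eqi by (auto simp: R fun_eq_iff beta_network_def col_factor_def)
  have "corner (relabel g A') = fst (beta_network g A')"
    by (simp add: R(3) beta_network_def)
  then show ?thesis1
    unfolding Z S strand_array_def n_def [symmetric] fst_conv snd_conv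
    by (intro beta.equality) (simp_all only: R(1,2) E beta.select_convs unit_eq)
  show "1 + col_sum (Z_beta D lab ord) i = strand_weight D i" if "i < length (strands D)" for i
  proof -
    have i: "i < n" using that by (simp add: n_def)
    have "col_sum (relabel g A') i = (\<Sum>j<n. change_vars g (entry A' (first j) (first i)))"
      using i by (simp add: col_sum_def R)
    also have "\<dots> = (\<Sum>r\<in>first ` {..<n}. change_vars g (entry A' r (first i)))"
      using inj_first by (simp add: sum.reindex)
    \<comment> \<open>The substitution passes through the sum because the entries of the final array
      are regular.\<close>
    also have "\<dots> = change_vars g (col_sum A' (first i))"
      unfolding col_sum_def A' using vanA' i
      by (intro conjunct1 [OF change_vars_sum, symmetric] vanishing_regular) auto
    finally show ?thesis using cw [OF i] by (simp add: Z col_factor_def)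
  qed
qed

section \<open>Reidemeister moves\<close>

lemma burau_simps [simp]:
  "burau t r (Passage (c, Upper)) = (if r = Passage (c, Upper) then 1 else 0)"
  "burau t r (Passage (c, Lower)) =
     (if r = Passage (c, Lower) then t c else if r = Passage (c, Upper) then 1 - t c else 0)"
  "burau t r (Bare_strand i) = (if r = Bare_strand i then 1 else 0)"
  "burau t (Passage (c, Upper)) s =
     (if s = Passage (c, Upper) then 1 else if s = Passage (c, Lower) then 1 - t c else 0)"
  "burau t (Passage (c, Lower)) s = (if s = Passage (c, Lower) then t c else 0)"
  "burau t (Bare_strand i) s = (if s = Bare_strand i then 1 else 0)"
proof -
  show "burau t r (Passage (c, Upper)) = (if r = Passage (c, Upper) then 1 else 0)"
    by (cases "(t, r, Passage (c, Upper))" rule: crossing_entry.cases) (auto simp: burau_def)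
  show "burau t r (Passage (c, Lower)) =
     (if r = Passage (c, Lower) then t c else if r = Passage (c, Upper) then 1 - t c else 0)"
    by (cases "(t, r, Passage (c, Lower))" rule: crossing_entry.cases) (auto simp: burau_def)
  show "burau t r (Bare_strand i) = (if r = Bare_strand i then 1 else 0)"
    by (cases "(t, r, Bare_strand i)" rule: crossing_entry.cases) (auto simp: burau_def)
  show "burau t (Passage (c, Upper)) s =
     (if s = Passage (c, Upper) then 1 else if s = Passage (c, Lower) then 1 - t c else 0)"
    by (cases "(t, Passage (c, Upper), s)" rule: crossing_entry.cases) (auto simp: burau_def)
  show "burau t (Passage (c, Lower)) s = (if s = Passage (c, Lower) then t c else 0)"
    by (cases "(t, Passage (c, Lower), s)" rule: crossing_entry.cases) (auto simp: burau_def)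
  show "burau t (Bare_strand i) s = (if s = Bare_strand i then 1 else 0)"
    by (cases "(t, Bare_strand i, s)" rule: crossing_entry.cases) (auto simp: burau_def)
qed

lemma burau_cong_col:
  assumes "\<And>c. s = Passage (c, Lower) \<Longrightarrow> t c = t' c"
  shows "burau t r s = burau t' r s"
proof -
  consider c where "s = Passage (c, Upper)" | c where "s = Passage (c, Lower)" | i where "s = Bare_strand i"
    by (metis level.exhaust slot.exhaust surj_pair)
  then show ?thesis using assms by cases auto
qed

text \<open>The element \<open>b\<close> has no predecessor, so its successor \<open>x\<close> is
  merged into it. As \<open>b\<close> carries the identity, it merely takes over the row and column
  of \<open>x\<close>; renaming it back to \<open>x\<close> restores the old network.\<close>

lemma stitch_strands_insert_front:
  assumes ss: "ss = A @ (b # x # xs) # B" and dist: "distinct (concat ss)" and ne: "[] \<notin> set ss"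
    and near: "near_identity (set (concat ss)) S" and b: "identity_at (set (concat ss)) b S"
  shows "stitch_strands ss S = stitch_strands (A @ (x # xs) # B) S"
proof -
  have adj: "adjacent ss b x" unfolding adjacent_def ss by (auto intro: exI [of _ "[]"])
  note bx = adjacentD [OF adj dist]
  define \<tau> where "\<tau> = id(b := x)"
  obtain w G where S [simp]: "S = (w, G)" by fastforce
  have "agree (set (concat ss) - {x}) (merge b x S) (reindex \<tau> \<tau> S)"
    using b bx unfolding agree_def identity_at_def
    by (auto simp: merge_simps reindex_def \<tau>_def)
  then have "agree (set (concat (drop_elem x ss))) (merge b x S) (reindex \<tau> \<tau> S)"
    by (auto simp: agree_def)
  then have "stitch_strands ss S = stitch_strands (drop_elem x ss) (reindex \<tau> \<tau> S)"
    unfolding stitch_strands_merge [OF adj dist near ne]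
    by (intro stitch_strands_cong adjacent_nonempty_filter [OF adj dist ne])
  also have "\<dots> = stitch_strands (map (map \<tau>) (drop_elem x ss)) S"
    by (rule stitch_strands_rename [symmetric]) (rule adjacent_nonempty_filter [OF adj dist ne])
  also have "map (map \<tau>) (drop_elem x ss) = A @ (x # xs) # B"
  proof -
    have keep: "map \<tau> (filter (\<lambda>z. z \<noteq> x) ys) = ys" if "b \<notin> set ys" "x \<notin> set ys" for ys
      using that by (induction ys) (auto simp: \<tau>_def)
    have "map (\<lambda>ys. map \<tau> (filter (\<lambda>z. z \<noteq> x) ys)) C = C" if "set C \<subseteq> set A \<union> set B" for C
      using that dist by (intro map_idI keep) (auto simp: ss)
    moreover have "map \<tau> (filter (\<lambda>z. z \<noteq> x) (b # x # xs)) = x # xs"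
      using keep [of xs] dist by (simp add: ss \<tau>_def)
    ultimately show ?thesis by (simp add: ss o_def)
  qed
  finally show ?thesis .
qed

text \<open>The additional first element gives every passage a predecessor into which it can be merged.\<close>

definition based_strands :: "tangle \<Rightarrow> slot list list" where
  "based_strands D = map (\<lambda>i. Bare_strand i # map Passage (strands D ! i)) [0..<length (strands D)]"

lemma set_based_strands:
  "set (concat (based_strands D)) = Bare_strand ` {..<length (strands D)} \<union> Passage ` passages D"
proof -
  have "passages D = (\<Union>i<length (strands D). set (strands D ! i))"
    by (auto simp: passages_nth)
  then show ?thesis by (auto simp: based_strands_def image_UN)
qed

lemma distinct_based_strands:
  assumes "distinct (concat (strands D))"
  shows "distinct (concat (based_strands D))"
  unfolding based_strands_def
proof (rule distinct_concat_upt)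
  show "distinct (Bare_strand i # map Passage (strands D ! i))" if "i < length (strands D)" for i
    using distinct_strand [OF assms that] by (auto simp: distinct_map inj_on_def)
  show "set (Bare_strand i # map Passage (strands D ! i)) \<inter> set (Bare_strand j # map Passage (strands D ! j)) = {}"
    if "i < j" "j < length (strands D)" for i j
    using that distinct_concat_unique [OF assms, of i j] by auto
qed

lemma based_strands_nonempty: "[] \<notin> set (based_strands D)"
  by (auto simp: based_strands_def)

lemma identity_at_bare: "identity_at V (Bare_strand i) (w, burau t)"
  by (auto simp: identity_at_def)

lemma stitch_slot_strands:
  assumes dist: "distinct (concat (strands D))" and t: "\<And>c. t c - 1 \<in> vanishing"
  shows "stitch_strands (slot_strands D) (1, burau t) = stitch_strands (based_strands D) (1, burau t)"
proof -
  define n where "n = length (strands D)"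
  \<comment> \<open>In \<open>F k\<close> the first \<open>k\<close> strands have received their
    base point. An empty strand is represented by its bare slot anyway and does not change.\<close>
  define F where "F k i = (if i < k then Bare_strand i # map Passage (strands D ! i) else strand_slots D i)" for k i
  have "stitch_strands (map (F k) [0..<n]) (1, burau t) = stitch_strands (slot_strands D) (1, burau t)"
    if "k \<le> n" for k
    using that
  proof (induction k)
    case 0
    show ?case by (simp add: F_def slot_strands_def n_def)
  next
    case (Suc k)
    have "stitch_strands (map (F (Suc k)) [0..<n]) (1, burau t) = stitch_strands (map (F k) [0..<n]) (1, burau t)"
    proof (cases "strands D ! k")
      case Nil
      then have "F (Suc k) = F k" by (auto simp: F_def fun_eq_iff strand_slots_def less_Suc_eq)
      then show ?thesis by simp
    next
      case (Cons p ps)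
      have split: "[0..<n] = [0..<k] @ k # [Suc k..<n]"
        using Suc.prems by (metis upt_conv_Cons upt_add_eq_append le_add_diff_inverse Suc_le_lessD less_imp_le zero_le)
      have "map (F (Suc k)) [0..<k] = map (F k) [0..<k]" "map (F (Suc k)) [Suc k..<n] = map (F k) [Suc k..<n]"
        by (auto simp: F_def)
      then have Suc_k: "map (F (Suc k)) [0..<n] = map (F k) [0..<k] @
          (Bare_strand k # Passage p # map Passage ps) # map (F k) [Suc k..<n]"
        unfolding split by (simp add: F_def Cons)
      have k: "map (F k) [0..<n] = map (F k) [0..<k] @ (Passage p # map Passage ps) # map (F k) [Suc k..<n]"
        unfolding split by (simp add: F_def Cons strand_slots_def)
      have "distinct (concat (map (F (Suc k)) [0..<n]))"
      proof (rule distinct_concat_upt)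
        show "distinct (F (Suc k) i)" if "i < n" for i
          using distinct_strand [OF dist, of i] that
          by (auto simp: F_def strand_slots_def distinct_map inj_on_def n_def)
        show "set (F (Suc k) i) \<inter> set (F (Suc k) j) = {}" if "i < j" "j < n" for i j
          using that distinct_concat_unique [OF dist, of i j] by (auto simp: F_def strand_slots_def n_def)
      qed
      moreover have "[] \<notin> set (map (F (Suc k)) [0..<n])"
        by (auto simp: F_def strand_slots_nonempty [symmetric])
      ultimately show ?thesis
        unfolding k by (intro stitch_strands_insert_front [OF Suc_k] burau_near_identity t identity_at_bare)
    qed
    then show ?case using Suc by simp
  qed
  moreover have "map (F n) [0..<n] = based_strands D"
    by (auto simp: F_def based_strands_def n_def)
  ultimately show ?thesis by (metis order_refl)
qed

lemma strand_weight_prod: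
  assumes "distinct (concat (strands D))" "i < length (strands D)"
  shows "strand_weight D i = (\<Prod>p\<in>set (strands D ! i). col_weight (weight D) (Passage p))"
  using distinct_strand [OF assms]
  by (simp add: strand_weight_def strand_slots_def prod.distinct_set_conv_list o_def)

lemma strand_array_cong:
  "(\<And>i. i < n \<Longrightarrow> \<sigma> i = \<sigma>' i) \<Longrightarrow> strand_array n \<sigma> S = strand_array n \<sigma>' S"
  by (auto simp: strand_array_def fun_eq_iff)

definition invariant :: "tangle \<Rightarrow> nat network" where
  "invariant D = stitch_strands (based_strands D) (1, burau (weight D))"

lemma Z_beta_eq:
  assumes "tangle_diagram D" "labelling D lab" "strand_order D ord"
  shows "Z_beta D lab ord = strand_array (length (strands D)) (strand_weight D) (invariant D)"
    and "\<And>i. i < length (strands D) \<Longrightarrow> 1 + col_sum (Z_beta D lab ord) i = strand_weight D i"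
  using Z_beta_normal_form [OF assms] stitch_slot_strands [of D "weight D"] assms(1)
  by (simp_all add: invariant_def tangle_diagram_def weight_near_one)

text \<open>With a bare slot at the head, no passage comes first on a strand. The property survives
  the removal of passages, so several of them can be deleted in succession.\<close>

definition bare_headed :: "slot list list \<Rightarrow> bool" where
  "bare_headed ss \<longleftrightarrow> (\<forall>xs\<in>set ss. \<exists>i ys. xs = Bare_strand i # ys)"

lemma bare_headed_based: "bare_headed (based_strands D)"
  by (auto simp: bare_headed_def based_strands_def)

lemma bare_headed_drop: "bare_headed ss \<Longrightarrow> bare_headed (drop_elem (Passage p) ss)"
  by (force simp: bare_headed_def)

lemma bare_headed_nonempty: "bare_headed ss \<Longrightarrow> [] \<notin> set ss"
  by (auto simp: bare_headed_def)

lemma stitch_strands_delete_passage: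
  assumes "bare_headed ss" "Passage p \<in> set (concat ss)" "distinct (concat ss)"
    "near_identity (set (concat ss)) S" "identity_at (set (concat ss)) (Passage p) S"
  shows "stitch_strands ss S = stitch_strands (drop_elem (Passage p) ss) S"
proof -
  obtain xs where xs: "xs \<in> set ss" "Passage p \<in> set xs" using assms(2) by auto
  moreover have "Passage p \<noteq> hd xs" using assms(1) xs by (auto simp: bare_headed_def)
  ultimately show ?thesis
    using assms bare_headed_nonempty by (intro stitch_strands_delete)
qed

lemma adjacent_based_strands:
  assumes "consecutive D p q"
  shows "adjacent (based_strands D) (Passage p) (Passage q)"
proof -
  obtain s u v where s: "s \<in> set (strands D)" "s = u @ [p, q] @ v"
    using assms by (auto simp: consecutive_def)
  then obtain i where i: "i < length (strands D)" "strands D ! i = s" by (auto simp: in_set_conv_nth)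
  have "Bare_strand i # map Passage s \<in> set (based_strands D)"
    using i by (auto simp: based_strands_def)
  moreover have "Bare_strand i # map Passage s =
      (Bare_strand i # map Passage u) @ Passage p # Passage q # map Passage v"
    using s by simp
  ultimately show ?thesis unfolding adjacent_def by blast
qed

lemma consecutive_strand_of:
  assumes "consecutive D p q" "distinct (concat (strands D))"
  obtains i where "i < length (strands D)" "p \<in> set (strands D ! i)" "q \<in> set (strands D ! i)"
    "strand_of D p = i" "strand_of D q = i"
proof -
  obtain s u v where s: "s \<in> set (strands D)" "s = u @ [p, q] @ v"
    using assms by (auto simp: consecutive_def)
  then obtain i where i: "i < length (strands D)" "strands D ! i = s" by (auto simp: in_set_conv_nth)
  then show ?thesis using that [of i] strand_of_eq [OF assms(2) i(1)] s by simp
qed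

section \<open>Omission of crossings\<close>

context
  fixes D D' :: tangle and C :: "nat set"
  assumes D: "tangle_diagram D" and D': "tangle_diagram D'" and erases: "erases D' C D"
begin

lemma erases_strands: "strands D = map (filter (\<lambda>p. fst p \<notin> C)) (strands D')"
  using erases by (simp add: erases_def)

lemma erases_distinct: "distinct (concat (strands D))" "distinct (concat (strands D'))"
  using D D' by (simp_all add: tangle_diagram_def)

text \<open>Omitting crossings keeps the positions of the strands, hence the variables, and it keeps
  the signs of the remaining crossings.\<close>

lemma erases_weight:
  assumes "(c, l) \<in> passages D"
  shows "weight D c = weight D' c"
proof -
  have c: "c \<in> crossings D" using assms by (force simp: crossings_def)
  then have "(c, Upper) \<in> passages D" by (rule crossing_passages [OF D])
  then obtain i where i: "i < length (strands D)" "(c, Upper) \<in> set (strands D ! i)"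
    by (auto simp: passages_nth)
  then have "i < length (strands D')" "(c, Upper) \<in> set (strands D' ! i)"
    by (auto simp: erases_strands)
  then have "strand_of D (c, Upper) = strand_of D' (c, Upper)"
    using i strand_of_eq erases_distinct by metis
  moreover have "crossing_sign D c = crossing_sign D' c"
    using c erases by (simp add: erases_def crossing_sign_def)
  ultimately show ?thesis by (simp add: weight_def)
qed

lemma erases_based_strands:
  "based_strands D = drop_elems (Passage ` {p. fst p \<in> C}) (based_strands D')"
  by (auto simp: based_strands_def erases_strands filter_map o_def image_iff intro!: arg_cong [of _ _ "map Passage"] filter_cong)

text \<open>For use after the crossings in \<open>C\<close> have been collapsed: the scalar left
  over from them is their contribution to the corner element.\<close>

lemma erases_agree:
  assumes "\<And>r s. r \<notin> Passage ` {p. fst p \<in> C} \<Longrightarrow> s \<notin> Passage ` {p. fst p \<in> C} \<Longrightarrow>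
      snd S r s = burau (weight D') r s"
  shows "stitch_strands (based_strands D) S = apfst ((*) (fst S)) (invariant D)"
proof -
  have "agree (set (concat (based_strands D))) S (fst S * 1, burau (weight D))"
    unfolding agree_def
  proof (intro conjI ballI)
    fix r s assume rs: "r \<in> set (concat (based_strands D))" "s \<in> set (concat (based_strands D))"
    have notin: "v \<notin> Passage ` {p. fst p \<in> C}" if "v \<in> set (concat (based_strands D))" for v
      using that unfolding erases_based_strands by auto
    have "burau (weight D') r s = burau (weight D) r s"
      using rs(2) erases_weight unfolding set_based_strands by (intro burau_cong_col) force
    then show "snd S r s = snd (fst S * 1, burau (weight D)) r s"
      using assms [OF notin notin] rs by simp
  qed simp
  then show ?thesis
    unfolding invariant_def stitch_strands_scale [symmetric]
    by (intro stitch_strands_cong based_strands_nonempty)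
qed

lemma erases_strand_weight:
  assumes "i < length (strands D)"
  shows "strand_weight D' i = strand_weight D i *
    (\<Prod>p\<in>{p \<in> set (strands D' ! i). fst p \<in> C}. col_weight (weight D') (Passage p))"
proof -
  let ?X = "set (strands D' ! i)"
  have set_i: "set (strands D ! i) = {p \<in> ?X. fst p \<notin> C}"
    using assms by (auto simp: erases_strands)
  have "strand_weight D i = (\<Prod>p\<in>{p \<in> ?X. fst p \<notin> C}. col_weight (weight D') (Passage p))"
    unfolding strand_weight_prod [OF erases_distinct(1) assms] set_i
  proof (rule prod.cong)
    fix p assume "p \<in> {p \<in> ?X. fst p \<notin> C}"
    then have "p \<in> passages D" using assms set_i by (auto simp: passages_nth)
    then show "col_weight (weight D) (Passage p) = col_weight (weight D') (Passage p)"
      using erases_weight by (cases p; cases "snd p") auto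
  qed simp
  moreover have "?X = {p \<in> ?X. fst p \<notin> C} \<union> {p \<in> ?X. fst p \<in> C}" by blast
  moreover have "strand_weight D' i = (\<Prod>p\<in>?X. col_weight (weight D') (Passage p))"
    using assms by (intro strand_weight_prod erases_distinct) (simp add: erases_strands)
  ultimately show ?thesis
    by (simp add: prod.union_disjoint [symmetric] disjoint_iff)
qed

end

section \<open>The first move\<close>

lemma invariant_kink:
  assumes D: "tangle_diagram D" and D': "tangle_diagram D'" and R: "reidemeister_I i c l D D'"
  shows "invariant D' = apfst ((*) (if l = Upper then weight D' c else 1)) (invariant D)"
proof -
  have er: "erases D' {c} D" using R by (simp add: reidemeister_I_def)
  note dist = erases_distinct [OF D D' er]
  define l' where "l' = (if l = Upper then Lower else Upper)"
  have ll': "l \<noteq> l'" by (cases l) (auto simp: l'_def)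
  let ?x = "Passage (c, l)" and ?y = "Passage (c, l')"
  define ss where "ss = based_strands D'"
  define S where "S = (1 :: ratfun, burau (weight D'))"
  obtain u v where i: "i < length (strands D')" "strands D' ! i = u @ [(c, l), (c, l')] @ v"
    using R by (cases l) (auto simp: reidemeister_I_def l'_def)
  then have "consecutive D' (c, l) (c, l')"
    unfolding consecutive_def by (metis nth_mem)
  then have adj: "adjacent ss ?x ?y"
    unfolding ss_def by (rule adjacent_based_strands)
  have dss: "distinct (concat ss)"
    unfolding ss_def by (rule distinct_based_strands [OF dist(2)])
  have near: "near_identity (set (concat ss)) S"
    unfolding S_def by (rule burau_near_identity [OF weight_near_one])
  note xy = adjacentD [OF adj dss]
  have nz: "weight D' c \<noteq> 0" by (rule near_one_nonzero [OF weight_near_one])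
  define ss1 where "ss1 = drop_elem ?y ss"
  define S1 where "S1 = merge ?x ?y S"
  have V1: "set (concat ss1) = set (concat ss) - {?y}" by (auto simp: ss1_def)
  have "invariant D' = stitch_strands ss1 S1"
    unfolding invariant_def ss1_def S1_def S_def [symmetric] ss_def [symmetric]
    by (rule stitch_strands_merge [OF adj dss near]) (simp add: ss_def based_strands_nonempty)
  also have "\<dots> = stitch_strands (drop_elem ?x ss1) S1"
  proof (rule stitch_strands_delete_passage)
    show "bare_headed ss1"
      unfolding ss1_def ss_def by (intro bare_headed_drop bare_headed_based)
    show "?x \<in> set (concat ss1)" unfolding V1 using xy by simp
    show "distinct (concat ss1)" unfolding ss1_def by (rule distinct_concat_filter [OF dss])
    show "near_identity (set (concat ss1)) S1"
      unfolding V1 S1_def by (rule merge_near_identity [OF near xy])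
    \<comment> \<open>Let t be the weight of \<open>c\<close>. If the upper passage comes first, the
      pivot is t and the diagonal entry is t / t = 1. If the lower passage comes first, the pivot is
      1 and the entry is (1 - t) + t = 1.\<close>
    show "identity_at (set (concat ss1)) ?x S1"
      unfolding V1 S1_def S_def
      using nz by (cases l) (auto simp: identity_at_def merge_simps l'_def)
  qed
  also have "drop_elem ?x ss1 = based_strands D"
  proof -
    have "drop_elem ?x ss1 = drop_elems {?x, ?y} ss"
      by (simp add: ss1_def conj_commute)
    also have "{?x, ?y} = Passage ` {p. fst p \<in> {c}}"
      by (cases l) (auto simp: l'_def image_iff, (metis level.exhaust)+)
    finally show ?thesis
      unfolding erases_based_strands [OF D D' er] ss_def .
  qed
  also have "stitch_strands (based_strands D) S1 = apfst ((*) (fst S1)) (invariant D)"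
  proof (rule erases_agree [OF D D' er])
    fix r s assume "r \<notin> Passage ` {p. fst p \<in> {c}}" "s \<notin> Passage ` {p. fst p \<in> {c}}"
    then have "r \<noteq> ?x" "r \<noteq> ?y" "s \<noteq> ?x" "s \<noteq> ?y" by auto
    then show "snd S1 r s = burau (weight D') r s"
      unfolding S1_def S_def by (cases l) (simp_all add: merge_simps l'_def)
  qed
  also have "fst S1 = (if l = Upper then weight D' c else 1)"
    unfolding S1_def S_def by (cases l) (simp_all add: merge_simps l'_def)
  finally show ?thesis .
qed

text \<open>The kink leaves the matrix \<open>G\<close> alone but multiplies the weight \<sigma> of
  strand \<open>i\<close> by the weight t of the crossing. Hence diag(\<sigma>) - G grows by
  \<sigma>(t - 1) at the diagonal place of \<open>i\<close>, which is the correction term in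
  \<open>multiply_kink\<close>.\<close>

lemma Z_beta_kink:
  assumes D: "tangle_diagram D" "labelling D lab" "strand_order D ord"
    and D': "tangle_diagram D'" "labelling D' lab'" "strand_order D' ord'"
    and R: "reidemeister_I i c l D D'"
  shows "Z_beta D' lab' ord' = multiply_kink i (crossing_sign D' c) l (Z_beta D lab ord)"
proof -
  have er: "erases D' {c} D" using R by (simp add: reidemeister_I_def)
  note dist = erases_distinct [OF D(1) D'(1) er]
  note Z = Z_beta_eq [OF D] and Z' = Z_beta_eq [OF D']
  have len: "length (strands D') = length (strands D)"
    by (simp add: erases_strands [OF D(1) D'(1) er])
  obtain u v where i: "i < length (strands D')"
    "strands D' ! i = u @ (if l = Upper then [(c, Upper), (c, Lower)] else [(c, Lower), (c, Upper)]) @ v"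
    using R by (auto simp: reidemeister_I_def)
  then have in_i: "(c, l') \<in> set (strands D' ! i)" for l'
    by (cases l') auto
  have w: "weight D' c = var i powi crossing_sign D' c"
    unfolding weight_def by (simp add: strand_of_eq [OF dist(2) i(1) in_i])
  have sw: "strand_weight D' j = strand_weight D j * (if j = i then weight D' c else 1)"
    if j: "j < length (strands D)" for j
  proof -
    have "{p \<in> set (strands D' ! j). fst p \<in> {c}} = (if j = i then {(c, Upper), (c, Lower)} else {})"
    proof (cases "j = i")
      case True
      have "p \<in> {(c, Upper), (c, Lower)}" if "fst p = c" for p
        using that by (cases p; cases "snd p") auto
      then show ?thesis using True in_i by auto
    next
      case False
      have "(c, l') \<notin> set (strands D' ! j)" for l'
        using distinct_concat_unique [OF dist(2) i(1) _ in_i] j False len by auto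
      then show ?thesis using False by auto
    qed
    then show ?thesis
      using erases_strand_weight [OF D(1) D'(1) er j] by simp
  qed
  have inv: "invariant D' = apfst ((*) (if l = Upper then weight D' c else 1)) (invariant D)"
    by (rule invariant_kink [OF D(1) D'(1) R])
  have cs: "1 + col_sum (Z_beta D lab ord) i = strand_weight D i"
    using Z(2) i(1) len by simp
  show ?thesis
    unfolding multiply_kink_def cs unfolding Z(1) Z'(1) inv len w [symmetric]
    using sw i(1) len by (auto simp: strand_array_def fun_eq_iff algebra_simps)
qed

section \<open>The second move\<close>

lemma merge_apply:
  "fst (merge x y S) = fst S * (1 - snd S x y)"
  "snd (merge x y S) r s =
     snd S (if r = x then y else r) s + snd S (if r = x then y else r) y * snd S x s / (1 - snd S x y)"
  by (cases S; simp add: merge_simps)+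

lemma invariant_bigon:
  assumes D: "tangle_diagram D" and D': "tangle_diagram D'" and R: "reidemeister_II D D'"
  shows "invariant D' = invariant D"
    and "\<And>j. j < length (strands D) \<Longrightarrow> strand_weight D' j = strand_weight D j"
proof -
  obtain c d where cd: "c \<noteq> d" "from_right D' c \<noteq> from_right D' d"
    and er: "erases D' {c, d} D" and upper: "consecutive D' (c, Upper) (d, Upper)"
    and lower: "consecutive D' (c, Lower) (d, Lower) \<or> consecutive D' (d, Lower) (c, Lower)"
    using R unfolding reidemeister_II_def by blast
  \<comment> \<open>The names \<open>x\<close> and \<open>y\<close> follow the lower arc in its own
    direction, so parallel and antiparallel arcs are treated together.\<close>
  obtain x y where xy: "(x = c \<and> y = d) \<or> (x = d \<and> y = c)" and lower': "consecutive D' (x, Lower) (y, Lower)"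
    using lower by blast
  note dist = erases_distinct [OF D D' er]
  define t where "t = weight D'"
  \<comment> \<open>Both upper passages lie on one strand and the signs are opposite, so the weights
    are inverse powers of one variable.\<close>
  have t: "t c * t d = 1" "t d * t c = 1"
  proof -
    obtain k where "strand_of D' (c, Upper) = k" "strand_of D' (d, Upper) = k"
      using consecutive_strand_of [OF upper dist(2)] by metis
    then show "t c * t d = 1"
      using cd(2) by (auto simp: t_def weight_def crossing_sign_def power_int_minus)
    then show "t d * t c = 1" by (simp add: mult.commute)
  qed
  let ?cU = "Passage (c, Upper)" and ?dU = "Passage (d, Upper)"
  let ?x = "Passage (x, Lower)" and ?y = "Passage (y, Lower)"
  define ss where "ss = based_strands D'"
  define S where "S = (1 :: ratfun, burau t)"
  have dss: "distinct (concat ss)"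
    unfolding ss_def by (rule distinct_based_strands [OF dist(2)])
  have near: "near_identity (set (concat ss)) S"
    unfolding S_def t_def by (rule burau_near_identity [OF weight_near_one])
  have bare: "bare_headed ss" unfolding ss_def by (rule bare_headed_based)
  have adj: "adjacent ss ?cU ?dU" "adjacent ss ?x ?y"
    unfolding ss_def using upper lower' by (simp_all add: adjacent_based_strands)
  note cd_in = adjacentD [OF adj(1) dss] and xy_in = adjacentD [OF adj(2) dss]
  define ss1 where "ss1 = drop_elem ?dU ss"
  define S1 where "S1 = merge ?cU ?dU S"
  have V1: "set (concat ss1) = set (concat ss) - {?dU}" by (auto simp: ss1_def)
  have dss1: "distinct (concat ss1)" unfolding ss1_def by (rule distinct_concat_filter [OF dss])
  have near1: "near_identity (set (concat ss1)) S1"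
    unfolding V1 S1_def by (rule merge_near_identity [OF near cd_in])
  have bare1: "bare_headed ss1" unfolding ss1_def by (rule bare_headed_drop [OF bare])
  have adj1: "adjacent ss1 ?x ?y" unfolding ss1_def by (rule adjacent_filter [OF adj(2)]) simp_all
  note xy_in1 = adjacentD [OF adj1 dss1]
  define ss2 where "ss2 = drop_elem ?y ss1"
  define S2 where "S2 = merge ?x ?y S1"
  have V2: "set (concat ss2) = set (concat ss1) - {?y}" by (auto simp: ss2_def)
  have dss2: "distinct (concat ss2)" unfolding ss2_def by (rule distinct_concat_filter [OF dss1])
  have near2: "near_identity (set (concat ss2)) S2"
    unfolding V2 S2_def by (rule merge_near_identity [OF near1 xy_in1])
  have bare2: "bare_headed ss2" unfolding ss2_def by (rule bare_headed_drop [OF bare1])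
  define ss3 where "ss3 = drop_elem ?cU ss2"
  have V3: "set (concat ss3) = set (concat ss2) - {?cU}" by (auto simp: ss3_def)
  have dss3: "distinct (concat ss3)" unfolding ss3_def by (rule distinct_concat_filter [OF dss2])
  have bare3: "bare_headed ss3" unfolding ss3_def by (rule bare_headed_drop [OF bare2])
  have near3: "near_identity (set (concat ss3)) S2"
    using near2 unfolding V3 near_identity_def by blast
  have "invariant D' = stitch_strands ss1 S1"
    unfolding invariant_def ss1_def S1_def t_def [symmetric] S_def [symmetric] ss_def [symmetric]
    by (rule stitch_strands_merge [OF adj(1) dss near bare_headed_nonempty [OF bare]])
  also have "\<dots> = stitch_strands ss2 S2"
    unfolding ss2_def S2_def
    by (rule stitch_strands_merge [OF adj1 dss1 near1 bare_headed_nonempty [OF bare1]])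
  also have "\<dots> = stitch_strands ss3 S2"
    unfolding ss3_def
  proof (rule stitch_strands_delete_passage [OF bare2 _ dss2 near2])
    show "?cU \<in> set (concat ss2)" unfolding V2 V1 using cd_in by simp
    \<comment> \<open>The critical entry leads from the lower arc to the upper one; it is (1 - t x)
      + (1 - t y) * t x = 1 - t x * t y = 0. On the lower arc itself the entry becomes t y * t x =
      1.\<close>
    show "identity_at (set (concat ss2)) ?cU S2"
      unfolding V2 V1 S2_def S1_def S_def using cd xy t
      by (auto simp: identity_at_def merge_apply algebra_simps)
  qed
  also have "\<dots> = stitch_strands (drop_elem ?x ss3) S2"
  proof (rule stitch_strands_delete_passage [OF bare3 _ dss3 near3])
    show "?x \<in> set (concat ss3)" unfolding V3 V2 V1 using xy_in by simp
    show "identity_at (set (concat ss3)) ?x S2"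
      unfolding V3 V2 V1 S2_def S1_def S_def using cd xy t
      by (auto simp: identity_at_def merge_apply algebra_simps)
  qed
  also have "drop_elem ?x ss3 = based_strands D"
  proof -
    have "drop_elem ?x ss3 = drop_elems {?x, ?y, ?cU, ?dU} ss"
      by (auto simp: ss1_def ss2_def ss3_def intro!: filter_cong)
    also have "{?x, ?y, ?cU, ?dU} = Passage ` {p. fst p \<in> {c, d}}"
      using xy by (auto simp: image_iff, (metis level.exhaust)+)
    finally show ?thesis
      unfolding erases_based_strands [OF D D' er] ss_def .
  qed
  also have "stitch_strands (based_strands D) S2 = apfst ((*) (fst S2)) (invariant D)"
  proof (rule erases_agree [OF D D' er])
    fix r s assume "r \<notin> Passage ` {p. fst p \<in> {c, d}}" "s \<notin> Passage ` {p. fst p \<in> {c, d}}"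
    then have "r \<noteq> ?x" "r \<noteq> ?y" "r \<noteq> ?cU" "r \<noteq> ?dU" "s \<noteq> ?x" "s \<noteq> ?y" "s \<noteq> ?cU" "s \<noteq> ?dU"
      using xy by auto
    then show "snd S2 r s = burau (weight D') r s"
      unfolding S2_def S1_def S_def t_def [symmetric] using cd by (simp add: merge_apply)
  qed
  also have "fst S2 = 1"
    unfolding S2_def S1_def S_def using cd xy by (auto simp: merge_apply)
  finally show "invariant D' = invariant D" by (cases "invariant D") simp
  show "strand_weight D' j = strand_weight D j" if j: "j < length (strands D)" for j
  proof -
    have j': "j < length (strands D')"
      using j by (simp add: erases_strands [OF D D' er])
    obtain k where k: "k < length (strands D')" "(c, Lower) \<in> set (strands D' ! k)" "(d, Lower) \<in> set (strands D' ! k)"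
      using lower consecutive_strand_of [OF _ dist(2)] by metis
    let ?X = "set (strands D' ! j)"
    have L: "(c, Lower) \<in> ?X \<longleftrightarrow> (d, Lower) \<in> ?X"
      using distinct_concat_unique [OF dist(2) j' k(1)] k by metis
    have sub: "{p \<in> ?X. fst p \<in> {c, d}} = {(c, Upper), (d, Upper), (c, Lower), (d, Lower)} \<inter> ?X"
      by (auto, (metis level.exhaust)+)
    have "(\<Prod>p\<in>{p \<in> ?X. fst p \<in> {c, d}}. col_weight t (Passage p)) =
        (\<Prod>p\<in>{(c, Upper), (d, Upper), (c, Lower), (d, Lower)}. if p \<in> ?X then col_weight t (Passage p) else 1)"
      unfolding sub by (simp only: prod.inter_restrict finite.intros)
    \<comment> \<open>Upper passages have weight 1. The two lower ones lie on strand
      \<open>j\<close> both or not at all, and their weights cancel.\<close>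
    also have "\<dots> = 1"
      using cd L t by auto
    finally show ?thesis
      using erases_strand_weight [OF D D' er j] by (simp add: t_def)
  qed
qed

section \<open>The third move\<close>

fun flip_slot :: "nat \<Rightarrow> nat \<Rightarrow> nat \<Rightarrow> slot \<Rightarrow> slot" where
  "flip_slot a b c (Passage p) = Passage (flip_triangle a b c p)"
| "flip_slot a b c (Bare_strand i) = Bare_strand i"

lemma flip_slot_simps:
  assumes "distinct [a, b, c]"
  shows "flip_slot a b c (Passage (a, Upper)) = Passage (b, Upper)"
    "flip_slot a b c (Passage (b, Upper)) = Passage (a, Upper)"
    "flip_slot a b c (Passage (a, Lower)) = Passage (c, Upper)"
    "flip_slot a b c (Passage (c, Upper)) = Passage (a, Lower)"
    "flip_slot a b c (Passage (b, Lower)) = Passage (c, Lower)"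
    "flip_slot a b c (Passage (c, Lower)) = Passage (b, Lower)"
  using assms by (simp_all add: flip_triangle_def)

lemma flip_slot_other:
  assumes "s \<notin> {Passage (a, Upper), Passage (b, Upper), Passage (a, Lower),
    Passage (c, Upper), Passage (b, Lower), Passage (c, Lower)}"
  shows "flip_slot a b c s = s"
  using assms by (cases s) (auto simp: flip_triangle_def)

text \<open>The Burau form of the braid relation for all eight patterns of directions. All three
  pivots are 1, so polynomial identities in the weights remain. The weights of \<open>a\<close> and
  \<open>b\<close> are powers of the variable of the top strand and therefore related; the weight of
  \<open>c\<close> is free.\<close>

lemma triangle_merges:
  fixes a b c :: nat and o1 o2 o3 :: bool
  assumes abc: "distinct [a, b, c]"
    and t: "if o2 = o3 then t a = t b else t a * t b = 1"
  defines "ms \<equiv> [if o1 then (Passage (b, Upper), Passage (a, Upper)) else (Passage (a, Upper), Passage (b, Upper)),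
      if o2 then (Passage (c, Upper), Passage (a, Lower)) else (Passage (a, Lower), Passage (c, Upper)),
      if o3 then (Passage (c, Lower), Passage (b, Lower)) else (Passage (b, Lower), Passage (c, Lower))]"
    and "f \<equiv> flip_slot a b c"
  shows "agree (- snd ` set ms) (merges ms (1, burau t)) (merges ms (reindex f f (1, burau t)))"
proof -
  have ne: "a \<noteq> b" "b \<noteq> a" "a \<noteq> c" "c \<noteq> a" "b \<noteq> c" "c \<noteq> b" using abc by auto
  note f = flip_slot_simps [OF abc, folded f_def]
  have f_other: "f s = s" if "s \<noteq> Passage (a, Upper)" "s \<noteq> Passage (b, Upper)" "s \<noteq> Passage (a, Lower)"
    "s \<noteq> Passage (c, Upper)" "s \<noteq> Passage (b, Lower)" "s \<noteq> Passage (c, Lower)" for s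
    unfolding f_def using that by (intro flip_slot_other) simp
  let ?X = "{Passage (a, Upper), Passage (b, Upper), Passage (a, Lower),
    Passage (c, Upper), Passage (b, Lower), Passage (c, Lower)}"
  let ?M = "\<lambda>r s. snd (merges ms (1, burau t)) r s" and ?N = "\<lambda>r s. snd (merges ms (reindex f f (1, burau t))) r s"
  have cases: "v \<in> fst ` set ms \<or> v \<notin> ?X" if "v \<notin> snd ` set ms" for v
    using that unfolding ms_def by (cases o1; cases o2; cases o3; simp; blast)
  \<comment> \<open>This 3-by-3 block between the arcs of the triangle is the only place where the
    relation between \<open>t a\<close> and \<open>t b\<close> enters.\<close>
  have live: "\<forall>r\<in>fst ` set ms. \<forall>s\<in>fst ` set ms. ?M r s = ?N r s"
    unfolding ms_def using t
    by (cases o1; cases o2; cases o3; simp add: merge_apply reindex_def f ne; simp add: algebra_simps)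
  have row: "\<forall>r\<in>fst ` set ms. ?M r s = ?N r s" if "s \<notin> ?X" for s
    using that unfolding ms_def
    by (cases o1; cases o2; cases o3; simp add: merge_apply reindex_def f f_other ne)
  have col: "\<forall>s\<in>fst ` set ms. ?M r s = ?N r s" if "r \<notin> ?X" for r
    using that unfolding ms_def
    by (cases o1; cases o2; cases o3; simp add: merge_apply reindex_def f f_other ne)
  have rest: "?M r s = ?N r s" if "r \<notin> ?X" "s \<notin> ?X" for r s
    using that unfolding ms_def
    by (cases o1; cases o2; cases o3; simp add: merge_apply reindex_def f f_other ne)
  have "?M r s = ?N r s" if "r \<notin> snd ` set ms" "s \<notin> snd ` set ms" for r s
    using cases [OF that(1)]
  proof
    assume r: "r \<in> fst ` set ms"
    show ?thesis using cases [OF that(2)] bspec [OF live r] bspec [OF row r] by (elim disjE) (erule bspec, assumption)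
  next
    assume r: "r \<notin> ?X"
    show ?thesis using cases [OF that(2)] bspec [OF col [OF r]] rest [OF r] by (elim disjE)
  qed
  moreover have "fst (merges ms (1, burau t)) = fst (merges ms (reindex f f (1, burau t)))"
    unfolding ms_def by (cases o1; cases o2; cases o3; simp add: merge_apply reindex_def f ne)
  ultimately show ?thesis by (simp add: agree_def)
qed

lemma invariant_triangle:
  assumes D: "tangle_diagram D" and D': "tangle_diagram D'" and R: "reidemeister_III D D'"
  shows "invariant D' = invariant D" "length (strands D') = length (strands D)"
    and "\<And>j. j < length (strands D) \<Longrightarrow> strand_weight D' j = strand_weight D j"
proof -
  obtain a b c e where tri: "triangle D a b c e"
    and strands: "strands D' = map (map (flip_triangle a b c)) (strands D)"
    and signs: "\<And>x. x \<in> crossings D \<Longrightarrow> from_right D' x = from_right D x"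
    using R unfolding reidemeister_III_def by blast
  have abc: "distinct [a, b, c]" using tri by (simp add: triangle_def)
  then have ne: "a \<noteq> b" "b \<noteq> a" "a \<noteq> c" "c \<noteq> a" "b \<noteq> c" "c \<noteq> b" by auto
  define \<pi> where "\<pi> = flip_triangle a b c"
  define f where "f = flip_slot a b c"
  define t where "t = weight D"
  define o1 where "o1 \<longleftrightarrow> from_right D c = e"
  define o2 where "o2 \<longleftrightarrow> from_right D b = e"
  define o3 where "o3 \<longleftrightarrow> from_right D a = e"
  have dist: "distinct (concat (strands D))" "distinct (concat (strands D'))"
    using D D' by (simp_all add: tangle_diagram_def)
  show len: "length (strands D') = length (strands D)" by (simp add: strands)
  have cons1: "consecutive D (if o1 then (b, Upper) else (a, Upper)) (if o1 then (a, Upper) else (b, Upper))"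
    and cons2: "consecutive D (if o2 then (c, Upper) else (a, Lower)) (if o2 then (a, Lower) else (c, Upper))"
    and cons3: "consecutive D (if o3 then (c, Lower) else (b, Lower)) (if o3 then (b, Lower) else (c, Lower))"
    using tri by (simp_all add: triangle_def o1_def o2_def o3_def split: if_splits)
  obtain k where k: "strand_of D (a, Upper) = k" "strand_of D (b, Upper) = k"
    by (rule consecutive_strand_of [OF cons1 dist(1)]) (auto split: if_splits)
  have same: "p \<in> set (strands D ! i) \<longleftrightarrow> q \<in> set (strands D ! i)"
    if "consecutive D p q" "i < length (strands D)" for p q i
    using consecutive_strand_of [OF that(1) dist(1)] distinct_concat_unique [OF dist(1) that(2)] by metis
  have same_abc: "(a, Upper) \<in> set (strands D ! i) \<longleftrightarrow> (b, Upper) \<in> set (strands D ! i)"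
    "(a, Lower) \<in> set (strands D ! i) \<longleftrightarrow> (c, Upper) \<in> set (strands D ! i)"
    "(b, Lower) \<in> set (strands D ! i) \<longleftrightarrow> (c, Lower) \<in> set (strands D ! i)"
    if "i < length (strands D)" for i
    using same [OF cons1 that] same [OF cons2 that] same [OF cons3 that] by (auto split: if_splits)
  have \<pi>\<pi>: "\<pi> (\<pi> p) = p" for p
    using ne by (auto simp: \<pi>_def flip_triangle_def)
  have \<pi>_in: "\<pi> p \<in> set (strands D ! i)" if "p \<in> set (strands D ! i)" "i < length (strands D)" for p i
    using that same_abc [OF that(2)] by (auto simp: \<pi>_def flip_triangle_def)
  \<comment> \<open>The two passages exchanged by \<pi> always lie on the same strand, so every
    strand keeps its set of passages; variables and strand weights are therefore unchanged.\<close>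
  have set_strands: "set (strands D' ! i) = set (strands D ! i)" if i: "i < length (strands D)" for i
  proof -
    have "set (strands D' ! i) = \<pi> ` set (strands D ! i)"
      using i by (simp add: strands \<pi>_def)
    also have "\<dots> = set (strands D ! i)"
      using \<pi>_in [OF _ i] \<pi>\<pi> by (auto simp: image_iff) metis
    finally show ?thesis .
  qed
  have pass: "passages D' = passages D"
    using set_strands by (intro set_eqI) (simp add: passages_nth len cong: conj_cong)
  then have cross: "crossings D' = crossings D" by (simp add: crossings_def)
  have weight: "weight D' x = weight D x" if x: "x \<in> crossings D" for x
  proof -
    have "(x, Upper) \<in> passages D" using crossing_passages [OF D x] .
    then obtain i where i: "i < length (strands D)" "(x, Upper) \<in> set (strands D ! i)"
      by (auto simp: passages_nth)
    then have "strand_of D (x, Upper) = i" "strand_of D' (x, Upper) = i"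
      using strand_of_eq [OF dist(1), of i] strand_of_eq [OF dist(2), of i] set_strands len by simp_all
    then show ?thesis using signs [OF x] by (simp add: weight_def crossing_sign_def)
  qed
  have cross_in: "fst p \<in> crossings D" if "p \<in> set (strands D ! i)" "i < length (strands D)" for p i
    using that by (auto simp: crossings_def passages_nth intro!: imageI)
  show "strand_weight D' j = strand_weight D j" if j: "j < length (strands D)" for j
  proof -
    have "col_weight (weight D') (Passage p) = col_weight (weight D) (Passage p)"
      if "p \<in> set (strands D ! j)" for p
      using weight [OF cross_in [OF that j]] by (cases p; cases "snd p") auto
    then show ?thesis
      using j len by (simp add: strand_weight_prod dist set_strands)
  qed
  have "f (f s) = s" for s
    using \<pi>\<pi> by (cases s) (simp_all add: f_def \<pi>_def)
  then have inj_f: "f r = f s \<longleftrightarrow> r = s" for r s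
    by metis
  define ss where "ss = based_strands D"
  have ss_ne: "[] \<notin> set ss" unfolding ss_def by (rule based_strands_nonempty)
  have dss: "distinct (concat ss)" unfolding ss_def by (rule distinct_based_strands [OF dist(1)])
  \<comment> \<open>The new strands are the old ones renamed by \<open>f\<close>. Pulling the
    renaming back onto the matrix lets both diagrams be stitched along the same lists.\<close>
  have "based_strands D' = map (map f) ss"
    by (auto simp: ss_def based_strands_def strands f_def)
  then have "invariant D' = stitch_strands ss (reindex f f (1, burau (weight D')))"
    unfolding invariant_def by (simp only: stitch_strands_rename [OF ss_ne])
  also have "\<dots> = stitch_strands ss (reindex f f (1, burau t))"
  proof (rule stitch_strands_cong [OF _ ss_ne])
    have "burau (weight D') (f r) (f s) = burau t (f r) (f s)" if s: "s \<in> set (concat ss)" for r s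
    proof (rule burau_cong_col)
      fix x assume x: "f s = Passage (x, Lower)"
      then obtain p where p: "s = Passage p" "\<pi> p = (x, Lower)"
        by (cases s) (auto simp: f_def \<pi>_def)
      then have "p \<in> passages D" using s unfolding ss_def set_based_strands by auto
      then obtain i where "i < length (strands D)" "p \<in> set (strands D ! i)" by (auto simp: passages_nth)
      then have "fst (\<pi> p) \<in> crossings D" using \<pi>_in cross_in by blast
      then show "weight D' x = t x" using weight p by (simp add: t_def)
    qed
    then show "agree (set (concat ss)) (reindex f f (1, burau (weight D'))) (reindex f f (1, burau t))"
      by (auto simp: agree_def reindex_def)
  qed
  also have "\<dots> = stitch_strands ss (1, burau t)"
  proof -
    \<comment> \<open>One pair for each arc of the triangle, in the order of passage before the
      move. As \<open>f\<close> exchanges the two members of each pair, the same merges serve both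
      networks.\<close>
    define ms where "ms = [if o1 then (Passage (b, Upper), Passage (a, Upper)) else (Passage (a, Upper), Passage (b, Upper)),
      if o2 then (Passage (c, Upper), Passage (a, Lower)) else (Passage (a, Lower), Passage (c, Upper)),
      if o3 then (Passage (c, Lower), Passage (b, Lower)) else (Passage (b, Lower), Passage (c, Lower))]"
    have "adjacent ss (fst m) (snd m)" if "m \<in> set ms" for m
      using that adjacent_based_strands [OF cons1] adjacent_based_strands [OF cons2]
        adjacent_based_strands [OF cons3] unfolding ms_def ss_def by (auto split: if_splits)
    then have adj: "adjacent ss (fst (ms ! 0)) (snd (ms ! 0))" "adjacent ss (fst (ms ! 1)) (snd (ms ! 1))"
      "adjacent ss (fst (ms ! 2)) (snd (ms ! 2))"
      by (auto simp: ms_def)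
    have coll: "collapsible ss ms"
      using adj ne unfolding ms_def
      by (cases o1; cases o2; cases o3; simp del: map_map; intro conjI adjacent_filter; simp)
    have near: "near_identity V (1, burau t)" for V
      unfolding t_def by (rule burau_near_identity [OF weight_near_one])
    have near': "near_identity (set (concat ss)) (reindex f f (1, burau t))"
      unfolding near_identity_def reindex_def snd_conv
    proof (intro ballI)
      fix r s
      have "burau t (f r) (f s) - (if f r = f s then 1 else 0) \<in> vanishing"
        using near [of UNIV] unfolding near_identity_def snd_conv by blast
      then show "burau t (f r) (f s) - (if r = s then 1 else 0) \<in> vanishing"
        by (simp only: inj_f)
    qed
    \<comment> \<open>The upper passages of \<open>a\<close> and \<open>b\<close> lie on the common
      strand \<open>k\<close>, and \<open>o2 = o3\<close> holds exactly if the two signs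
      agree.\<close>
    have "if o2 = o3 then t a = t b else t a * t b = 1"
      using k by (auto simp: t_def weight_def crossing_sign_def o2_def o3_def power_int_minus)
    then have "agree (- snd ` set ms) (merges ms (1, burau t)) (merges ms (reindex f f (1, burau t)))"
      unfolding ms_def f_def by (rule triangle_merges [OF abc])
    then have "agree (set (concat (drop_elems (snd ` set ms) ss)))
        (merges ms (1, burau t)) (merges ms (reindex f f (1, burau t)))"
      unfolding agree_def set_concat_filter by blast
    then show ?thesis
      using stitch_strands_merges [OF coll dss near ss_ne] stitch_strands_merges [OF coll dss near' ss_ne]
        stitch_strands_cong by metis
  qed
  finally show "invariant D' = invariant D"
    by (simp add: invariant_def ss_def t_def)
qed

theorem theorem2:
  fixes D D' :: tangle
  assumes "tangle_diagram D" "labelling D lab" "strand_order D ord"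
    and "tangle_diagram D'" "labelling D' lab'" "strand_order D' ord'"
  shows "(D' = D \<longrightarrow> Z_beta D' lab' ord' = Z_beta D lab ord) \<and>
    (\<forall>i c l. reidemeister_I i c l D D' \<longrightarrow>
       Z_beta D' lab' ord' = multiply_kink i (crossing_sign D' c) l (Z_beta D lab ord)) \<and>
    (reidemeister_II D D' \<longrightarrow> Z_beta D' lab' ord' = Z_beta D lab ord) \<and>
    (reidemeister_III D D' \<longrightarrow> Z_beta D' lab' ord' = Z_beta D lab ord)"
proof (intro conjI allI impI)
  note Z = Z_beta_eq(1) [OF assms(1-3)] and Z' = Z_beta_eq(1) [OF assms(4-6)]
  \<comment> \<open>This case compares two labellings and two orders for one diagram; the normal
    form contains neither.\<close>
  show "Z_beta D' lab' ord' = Z_beta D lab ord" if "D' = D"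
    using Z Z' that by simp
  show "Z_beta D' lab' ord' = multiply_kink i (crossing_sign D' c) l (Z_beta D lab ord)"
    if "reidemeister_I i c l D D'" for i c l
    using assms that by (rule Z_beta_kink)
  show "Z_beta D' lab' ord' = Z_beta D lab ord" if R: "reidemeister_II D D'"
  proof -
    have len: "length (strands D') = length (strands D)"
      using R by (auto simp: reidemeister_II_def erases_def)
    show ?thesis
      unfolding Z Z' len invariant_bigon(1) [OF assms(1,4) R]
      by (rule strand_array_cong) (rule invariant_bigon(2) [OF assms(1,4) R])
  qed
  show "Z_beta D' lab' ord' = Z_beta D lab ord" if R: "reidemeister_III D D'"
    unfolding Z Z' invariant_triangle(1,2) [OF assms(1,4) R]
    by (rule strand_array_cong) (rule invariant_triangle(3) [OF assms(1,4) R])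
qed

end
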